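(* Let $m\in\mathbb N_0$, $l\in\{0,\dots,m\}$ with $l+m$ even, $d\ge3$ odd and $k\in\{1,\dots,N_{l,d}\}$. The odd cone-beam transform $\mathcal D^{(\mathrm{odd})}$ (of functions on $\mathbb B^d$, with values functions on $\mathbb S^{d-1}\times\mathbb S^{d-1}$) satisfies for $a,\omega\in\mathbb S^{d-1}$ $$\mathcal D^{(\mathrm{odd})}\widetilde V_{m,l,k}(a,\omega)=\mu_{m,d}\sum_{j=1}^{N_{m+1,d}}\overline{Y_{m+1,d}^j(a)}\;\sum_{n=m+1-l,\ n\text{ odd}}^{m+1+l}\nu_{n,d}\sum_{i=1}^{N_{n,d}}G^{n,i,d}_{m+1,j,l,k}\,Y_{n,d}^i(\omega),$$ where $$\mu_{m,d}=\sqrt{\frac{2^{d+1}\pi^{d-1}}{2m+d}},\qquad \nu_{n,d}=\frac{(-1)^{\frac{n+1}{2}}(n-1)!!}{(n+d-3)!!}.$$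
   Context: $\mathbb S^{d-1}$ and $\mathbb B^d$ are the unit sphere and closed unit ball in $\mathbb R^d$. For a function $f$ on $\mathbb R^d$ supported in $\mathbb B^d$ (functions on $\mathbb B^d$ are extended by $0$), the cone-beam transform with scanning set $\mathbb S^{d-1}$ is $\mathcal Df(a,\omega)=\int_0^\infty f(a+t\omega)\,dt$, $a,\omega\in\mathbb S^{d-1}$, and its odd part is $\mathcal D^{(\mathrm{odd})}f(a,\omega)=\frac12\big(\mathcal Df(a,\omega)-\mathcal Df(a,-\omega)\big)$. $Y_{n,d}^k$, $k=1,\dots,N_{n,d}$, with $N_{n,d}=\frac{(2n+d-2)(n+d-3)!}{n!(d-2)!}$, is an orthonormal basis in $L^2(\mathbb S^{d-1})$ of the space of restrictions to $\mathbb S^{d-1}$ of harmonic polynomials homogeneous of degree $n$. Gaunt coefficients: $G^{n,k,d}_{n_1,k_1,n_2,k_2}=\int_{\mathbb S^{d-1}}Y_{n_1,d}^{k_1}(\xi)\,Y_{n_2,d}^{k_2}(\xi)\,\overline{Y_{n,d}^k(\xi)}\,d\xi$. For $m,l,k$ as in the claim, $$\widetilde V_{m,l,k}(s\omega)=\sqrt{2m+d}\;s^l\,P^{(0,\,l+\frac{d-2}{2})}_{\frac{m-l}{2}}(2s^2-1)\,Y_{l,d}^k(\omega),\quad s\in[0,1],\ \omega\in\mathbb S^{d-1},$$ where $P_n^{(\alpha,\beta)}$ is the Jacobi polynomial of degree $n$ (standard normalization $P_n^{(\alpha,\beta)}(1)=\binom{n+\alpha}{n}$). These form an orthonormal basis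 of $L^2(\mathbb B^d)$. Double factorials: $n!!=n(n-2)\cdots$ down to $2$ or $1$, with $0!!=1$. *)

theory Defs
  imports "HOL-Analysis.Analysis"
begin

text \<open>Throughout, \<open>\<real>\<^sup>d\<close> is a type \<open>'a::euclidean_space\<close> with \<open>DIM('a) = d\<close>.\<close>

text \<open>
  The surface measure of the unit sphere, as it is given by polar coordinates: a Borel set \<open>A\<close>
  of unit vectors has \<open>d\<close> times the Lebesgue measure of the cone \<open>{r \<omega> | 0 < r \<le> 1, \<omega> \<in> A}\<close>.
  It is not normalised: the total mass is \<open>d\<close> times the volume of the unit ball.
\<close>

definition sphere_measure :: "'a::euclidean_space measure" where
  "sphere_measure =
     scale_measure (ennreal (real DIM('a)))
       (distr (restrict_space lborel (cball 0 1 - {0})) (restrict_space borel (sphere 0 1))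
          (\<lambda>x. x /\<^sub>R norm x))"

lemma normalize_measurable:
  "(\<lambda>x::'a::euclidean_space. x /\<^sub>R norm x)
     \<in> measurable (restrict_space lborel (cball 0 1 - {0})) (restrict_space borel (sphere 0 1))"
proof (rule measurable_restrict_space2)
  show "(\<lambda>x::'a. x /\<^sub>R norm x) \<in> space (restrict_space lborel (cball 0 1 - {0})) \<rightarrow> sphere 0 1"
    by (auto simp: space_restrict_space)
  show "(\<lambda>x::'a. x /\<^sub>R norm x) \<in> borel_measurable (restrict_space lborel (cball 0 1 - {0}))"
    by (intro measurable_restrict_space1) measurable
qed

lemma emeasure_sphere_measure:
  fixes A :: "'a::euclidean_space set"
  assumes "A \<in> sets borel" "A \<subseteq> sphere 0 1"
  shows "emeasure sphere_measure A =
    ennreal (real DIM('a)) * emeasure lborel {x \<in> cball 0 1 - {0}. x /\<^sub>R norm x \<in> A}"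
proof -
  have A: "A \<in> sets (restrict_space borel (sphere 0 1))"
    using assms by (auto simp: sets_restrict_space)
  have eq: "(\<lambda>x::'a. x /\<^sub>R norm x) -` A \<inter> (cball 0 1 - {0}) = {x \<in> cball 0 1 - {0}. x /\<^sub>R norm x \<in> A}"
    by auto
  have *: "emeasure (restrict_space lborel (cball 0 1 - {0})) {x \<in> cball 0 1 - {0}. x /\<^sub>R norm x \<in> A}
      = emeasure lborel {x \<in> cball 0 1 - {0}. x /\<^sub>R norm x \<in> A}"
    by (intro emeasure_restrict_space) auto
  then show ?thesis
    unfolding sphere_measure_def emeasure_scale_measure emeasure_distr[OF normalize_measurable A]
    by (simp only: space_restrict_space space_lborel space_borel UNIV_I Int_UNIV_right eq *)
qed

definition laplacian :: "('a::euclidean_space \<Rightarrow> complex) \<Rightarrow> 'a \<Rightarrow> complex" where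
  "laplacian p x =
     (\<Sum>b\<in>Basis. vector_derivative
        (\<lambda>s. vector_derivative (\<lambda>t. p (x + t *\<^sub>R b)) (at s)) (at 0))"

definition harmonic_homogeneous :: "nat \<Rightarrow> ('a::euclidean_space \<Rightarrow> complex) set" where
  "harmonic_homogeneous n =
     {p. polynomial_function p \<and> (\<forall>t x. p (t *\<^sub>R x) = of_real (t ^ n) * p x) \<and>
         (\<forall>x. laplacian p x = 0)}"

text \<open>The dimension \<open>N\<close> of the space of spherical harmonics of degree \<open>n\<close>, meant for
  \<open>d \<ge> 3\<close>; the division is exact.\<close>

definition harm_dim :: "nat \<Rightarrow> nat \<Rightarrow> nat" where
  "harm_dim n d = ((2 * n + d - 2) * fact (n + d - 3)) div (fact n * fact (d - 2))"

lemma real_harm_dim: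
  assumes "3 \<le> d"
  shows "real (harm_dim n d) =
    real (2 * n + d - 2) * fact (n + d - 3) / (fact n * fact (d - 2))"
proof -
  obtain e where d: "d = e + 3"
    using assms by (metis add.commute le_Suc_ex)
  have "(fact n * fact (e + 1) :: nat) dvd (2 * n + e + 1) * fact (n + e)"
  proof (cases n)
    case 0
    then show ?thesis by simp
  next
    case (Suc j)
    have 1: "(fact n * fact (e + 1) :: nat) * ((n + (e + 1)) choose n) = (n + e + 1) * fact (n + e)"
      using binomial_fact_lemma[of n "n + (e + 1)"] by simp
    have 2: "(fact j * fact (e + 1) :: nat) * ((j + (e + 1)) choose j) = fact (n + e)"
      using binomial_fact_lemma[of j "j + (e + 1)"] Suc by simp
    have "(2 * n + e + 1) * fact (n + e) = (n + e + 1) * fact (n + e) + n * (fact (n + e) :: nat)"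
      by (simp add: algebra_simps)
    also have "\<dots> = (fact n * fact (e + 1)) * ((n + (e + 1)) choose n)
                  + (fact n * fact (e + 1)) * ((j + (e + 1)) choose j)"
    proof -
      have "fact n = n * (fact j :: nat)" using Suc by simp
      then have "n * (fact (n + e) :: nat) = (fact n * fact (e + 1)) * ((j + (e + 1)) choose j)"
        unfolding 2[symmetric] by (metis mult.assoc)
      then show ?thesis unfolding 1 by simp
    qed
    finally show ?thesis
      by (metis dvd_add dvd_triv_left)
  qed
  then show ?thesis
    unfolding harm_dim_def d by (subst real_of_nat_div) (simp_all add: algebra_simps)
qed

text \<open>
  For every degree \<open>n\<close>, the functions \<open>Y n 1, \<dots>, Y n N\<close>, restricted to the unit sphere, are an
  orthonormal basis of the restrictions of the homogeneous harmonic polynomials of degree \<open>n\<close>.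
  The values of \<open>Y n k\<close> off the sphere are irrelevant.
\<close>

definition spherical_harmonic_basis :: "(nat \<Rightarrow> nat \<Rightarrow> 'a::euclidean_space \<Rightarrow> complex) \<Rightarrow> bool" where
  "spherical_harmonic_basis Y \<longleftrightarrow>
     (\<forall>n.
        (\<forall>k\<in>{1..harm_dim n DIM('a)}. \<exists>p\<in>harmonic_homogeneous n. \<forall>\<xi>\<in>sphere 0 1. Y n k \<xi> = p \<xi>) \<and>
        (\<forall>p\<in>harmonic_homogeneous n. \<exists>c :: nat \<Rightarrow> complex. \<forall>\<xi>\<in>sphere 0 1.
           p \<xi> = (\<Sum>k=1..harm_dim n DIM('a). c k * Y n k \<xi>)) \<and>
        (\<forall>j\<in>{1..harm_dim n DIM('a)}. \<forall>k\<in>{1..harm_dim n DIM('a)}.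
           (LINT \<xi>|sphere_measure. Y n j \<xi> * cnj (Y n k \<xi>)) = (if j = k then 1 else 0)))"

text \<open>\<open>gaunt Y n k n1 k1 n2 k2\<close> is the coefficient with upper indices \<open>n, k\<close> and lower indices
  \<open>n1, k1, n2, k2\<close>.\<close>

definition gaunt ::
  "(nat \<Rightarrow> nat \<Rightarrow> 'a::euclidean_space \<Rightarrow> complex) \<Rightarrow> nat \<Rightarrow> nat \<Rightarrow> nat \<Rightarrow> nat \<Rightarrow> nat \<Rightarrow> nat \<Rightarrow> complex" where
  "gaunt Y n k n1 k1 n2 k2 =
     (LINT \<xi>|sphere_measure. Y n1 k1 \<xi> * Y n2 k2 \<xi> * cnj (Y n k \<xi>))"

definition cone_beam :: "('a::euclidean_space \<Rightarrow> complex) \<Rightarrow> 'a \<Rightarrow> 'a \<Rightarrow> complex" where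
  "cone_beam f a \<omega> = (LINT t:{0..}|lborel. f (a + t *\<^sub>R \<omega>))"

definition odd_cone_beam :: "('a::euclidean_space \<Rightarrow> complex) \<Rightarrow> 'a \<Rightarrow> 'a \<Rightarrow> complex" where
  "odd_cone_beam f a \<omega> = (cone_beam f a \<omega> - cone_beam f a (- \<omega>)) / 2"

text \<open>Jacobi polynomials, by the explicit formula of Szego's book (4.3.2).\<close>

definition jacobi :: "nat \<Rightarrow> real \<Rightarrow> real \<Rightarrow> real \<Rightarrow> real" where
  "jacobi n \<alpha> \<beta> x =
     (\<Sum>i\<le>n. ((real n + \<alpha>) gchoose (n - i)) * ((real n + \<beta>) gchoose i)
            * ((x - 1) / 2) ^ i * ((x + 1) / 2) ^ (n - i))"

lemma jacobi_1: "jacobi n \<alpha> \<beta> 1 = (real n + \<alpha>) gchoose n"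
proof -
  have "jacobi n \<alpha> \<beta> 1 = (\<Sum>i\<le>n. if i = 0 then (real n + \<alpha>) gchoose n else 0)"
    unfolding jacobi_def by (intro sum.cong) auto
  then show ?thesis by simp
qed

fun dfact :: "nat \<Rightarrow> nat" where
  "dfact 0 = 1"
| "dfact (Suc 0) = 1"
| "dfact (Suc (Suc n)) = Suc (Suc n) * dfact n"

text \<open>
  The functions on the unit ball, first in polar coordinates \<open>(s, \<omega>)\<close>, then as functions on the
  whole space that vanish off the ball. The origin has no unique direction; \<open>direction 0\<close> is some
  unit vector, and the choice does not matter (lemma \<open>V_ball_polar\<close>).
\<close>

definition V_polar ::
  "(nat \<Rightarrow> nat \<Rightarrow> 'a::euclidean_space \<Rightarrow> complex) \<Rightarrow> nat \<Rightarrow> nat \<Rightarrow> nat \<Rightarrow> real \<Rightarrow> 'a \<Rightarrow> complex" where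
  "V_polar Y m l k s \<omega> =
     of_real (sqrt (real (2 * m + DIM('a))) * s ^ l
              * jacobi ((m - l) div 2) 0 (real l + (real DIM('a) - 2) / 2) (2 * s\<^sup>2 - 1))
     * Y l k \<omega>"

definition direction :: "'a::euclidean_space \<Rightarrow> 'a" where
  "direction x = (SOME \<omega>. norm \<omega> = 1 \<and> x = norm x *\<^sub>R \<omega>)"

definition V_ball ::
  "(nat \<Rightarrow> nat \<Rightarrow> 'a::euclidean_space \<Rightarrow> complex) \<Rightarrow> nat \<Rightarrow> nat \<Rightarrow> nat \<Rightarrow> 'a \<Rightarrow> complex" where
  "V_ball Y m l k x = (if norm x \<le> 1 then V_polar Y m l k (norm x) (direction x) else 0)"

lemma direction:
  fixes x :: "'a::euclidean_space"
  shows "norm (direction x) = 1" "x = norm x *\<^sub>R direction x"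
proof -
  have "\<exists>\<omega>. norm \<omega> = 1 \<and> x = norm x *\<^sub>R \<omega>"
  proof (cases "x = 0")
    case True
    obtain b :: 'a where "b \<in> Basis" using nonempty_Basis by blast
    then have "norm b = 1" by simp
    then show ?thesis using True by auto
  next
    case False
    then show ?thesis by (intro exI[of _ "x /\<^sub>R norm x"]) simp
  qed
  from someI_ex[OF this] show "norm (direction x) = 1" "x = norm x *\<^sub>R direction x"
    unfolding direction_def by auto
qed

lemma V_ball_polar:
  fixes Y :: "nat \<Rightarrow> nat \<Rightarrow> 'a::euclidean_space \<Rightarrow> complex"
  assumes Y: "spherical_harmonic_basis Y" and k: "k \<in> {1..harm_dim l DIM('a)}"
    and s: "0 \<le> s" "s \<le> 1" and \<omega>: "\<omega> \<in> sphere 0 1"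
  shows "V_ball Y m l k (s *\<^sub>R \<omega>) = V_polar Y m l k s \<omega>"
proof -
  have n: "norm (s *\<^sub>R \<omega>) = s" using s \<omega> by simp
  consider "s \<noteq> 0" | "s = 0" "l \<noteq> 0" | "s = 0" "l = 0" by auto
  then have "V_polar Y m l k s (direction (s *\<^sub>R \<omega>)) = V_polar Y m l k s \<omega>"
  proof cases
    case 1
    have "s *\<^sub>R \<omega> = s *\<^sub>R direction (s *\<^sub>R \<omega>)"
      using direction(2)[of "s *\<^sub>R \<omega>"] unfolding n .
    then have "direction (s *\<^sub>R \<omega>) = \<omega>" using 1 by simp
    then show ?thesis by simp
  next
    case 2
    then show ?thesis by (simp add: V_polar_def)
  next
    case 3
    obtain p where p: "p \<in> harmonic_homogeneous l" "\<forall>\<xi>\<in>sphere 0 1. Y l k \<xi> = p \<xi>"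
      using Y k unfolding spherical_harmonic_basis_def by blast
    have "p (t *\<^sub>R x) = p x" for t x
      using p(1) 3 by (simp add: harmonic_homogeneous_def)
    from this[of 0] have "p x = p 0" for x by (metis scaleR_zero_left)
    then have "Y l k (direction (s *\<^sub>R \<omega>)) = Y l k \<omega>"
      using p(2) \<omega> direction(1)[of "s *\<^sub>R \<omega>"] by (metis dist_0_norm mem_sphere)
    then show ?thesis by (simp add: V_polar_def)
  qed
  then show ?thesis using s by (simp only: V_ball_def n if_True)
qed

definition mu :: "nat \<Rightarrow> nat \<Rightarrow> real" where
  "mu m d = sqrt (2 ^ (d + 1) * pi ^ (d - 1) / real (2 * m + d))"

text \<open>\<open>n\<close> is odd wherever this is used, so that \<open>(n + 1) div 2\<close> is exact.\<close>

definition nu :: "nat \<Rightarrow> nat \<Rightarrow> real" where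
  "nu n d = (-1) ^ ((n + 1) div 2) * real (dfact (n - 1)) / real (dfact (n + d - 3))"

end

(*
  With t = x . \<omega>, the line through a point a of the sphere in direction \<omega> leaves the ball at the mirror
  image of a, so D^odd V(a, \<omega>) is half the oriented integral of the polynomial V over that chord.
  Homogenised, this is a polynomial U in a. Integrating over chords commutes with the Laplacian, and
  the recursion of the Jacobi coefficients then says exactly that U is harmonic of degree m + 1. On
  the hyperplane t = 0 it vanishes, and its normal derivative is a multiple of Y_l.

  The right-hand side is, as a function of a, also a harmonic of degree m + 1: the functional
  q |-> \<Sum> nu_n Proj_n q (\<omega>) is a multiple of the principal value of q / t over the sphere (it inverts
  multiplication by t and kills functions even in t), and the sums over j and i assemble the reproducing
  kernels. Since the normal derivative at t = 0 of the zonal harmonic of degree m + 1 is t times the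
  reproducing kernel of the polynomials of degree m, its Cauchy data on t = 0 can be computed, and they
  agree with those of U. A harmonic polynomial is determined by its Cauchy data.
*)
theory Submission
  imports Defs "HOL-Computational_Algebra.Formal_Power_Series"
begin

text \<open>The vector \<omega> is fixed and a is the variable. Laplace's equation in a makes sense
  only once both sides are continued from unit vectors to polynomials of the same degree on the
  whole space: hence the harmonic extensions \<open>y n k\<close> of \<open>Y n k\<close>, and the
  homogenisation by powers of x . x, which l + m even permits. The nu come from splitting x .
  \<omega> times a harmonic of degree J, on the sphere, into harmonics of degrees J + 1 and J - 1.
  Their values at \<omega> are in the ratio J + d - 2 to J, and the two-term recursion of nu cancels
  them except for J = 0. So the functional sends (x . \<omega>) r to - (integral of r) / A with A =
  (area of the sphere) (d - 2)!!, the double factorial being that of nu at 1. For odd d, A =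
  sqrt(2^(d+1) pi^(d-1)), so mu = A / C with C = sqrt(2 m + d), the normalising constant of V. The
  normal derivatives of C U and of mu times the double sum are then C Y_l and - mu (2 m + d) / A Y_l
  = - C Y_l. They cancel, and D^odd V = - C U.\<close>

section \<open>Homogeneous polynomials and their directional derivatives\<close>

text \<open>Generated from linear forms rather than carved out of
  \<open>polynomial_function\<close>, so that the rules for derivatives, Euler's relation and the
  symmetry of second derivatives follow by induction. The zero function belongs to every
  degree.\<close>

inductive hpoly :: "nat \<Rightarrow> ('a::euclidean_space \<Rightarrow> complex) \<Rightarrow> bool" where
  hpoly_const: "hpoly 0 (\<lambda>x. c)"
| hpoly_inner_mult: "hpoly n p \<Longrightarrow> hpoly (Suc n) (\<lambda>x. of_real (x \<bullet> v) * p x)"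
| hpoly_add: "hpoly n p \<Longrightarrow> hpoly n q \<Longrightarrow> hpoly n (\<lambda>x. p x + q x)"

lemma hpoly_zero: "hpoly n (\<lambda>x. 0)"
proof (induction n)
  case 0
  show ?case by (rule hpoly_const)
next
  case (Suc n)
  from hpoly_inner_mult[OF Suc, of 0] show ?case by simp
qed

lemma hpoly_sum:
  assumes "\<And>i. i \<in> I \<Longrightarrow> hpoly n (p i)"
  shows "hpoly n (\<lambda>x. \<Sum>i\<in>I. p i x)"
  using assms
  by (induction I rule: infinite_finite_induct) (simp_all add: hpoly_zero hpoly_add)

lemma hpoly_cmult:
  assumes "hpoly n p"
  shows "hpoly n (\<lambda>x. c * p x)"
  using assms
proof induction
  case (hpoly_const e)
  show ?case by (rule hpoly.hpoly_const)
next
  case (hpoly_inner_mult n p v)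
  from hpoly.hpoly_inner_mult[OF hpoly_inner_mult.IH, of v] show ?case
    by (simp add: mult.left_commute)
next
  case (hpoly_add n p q)
  then show ?case by (simp add: distrib_left hpoly.hpoly_add)
qed

lemma hpoly_diff:
  assumes "hpoly n p" "hpoly n q"
  shows "hpoly n (\<lambda>x. p x - q x)"
  using hpoly_add[OF assms(1) hpoly_cmult[OF assms(2), of "- 1"]] by simp

lemma hpoly_mult:
  assumes "hpoly n p" "hpoly k q"
  shows "hpoly (n + k) (\<lambda>x. p x * q x)"
  using assms(1)
proof induction
  case (hpoly_const c)
  then show ?case using hpoly_cmult[OF assms(2)] by simp
next
  case (hpoly_inner_mult n p v)
  from hpoly.hpoly_inner_mult[OF hpoly_inner_mult.IH, of v] show ?case
    by (simp add: mult.assoc)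
next
  case (hpoly_add n p q)
  then show ?case by (simp add: distrib_right hpoly.hpoly_add)
qed

lemma hpoly_inner: "hpoly 1 (\<lambda>x. of_real (x \<bullet> v))"
  using hpoly_inner_mult[OF hpoly_const[of 1], of v] by simp

lemma hpoly_sqnorm: "hpoly 2 (\<lambda>x. of_real (x \<bullet> x))"
proof -
  have "hpoly 2 (\<lambda>x::'a. \<Sum>b\<in>Basis. of_real (x \<bullet> b) * of_real (x \<bullet> b))"
    by (intro hpoly_sum) (use hpoly_mult[OF hpoly_inner hpoly_inner] in \<open>simp add: numeral_2_eq_2\<close>)
  then show ?thesis
    by (subst euclidean_inner) simp
qed

lemma hpoly_sqnorm_power: "hpoly (2 * i) (\<lambda>x. of_real (x \<bullet> x) ^ i)"
proof (induction i)
  case 0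
  show ?case by (simp add: hpoly_const)
next
  case (Suc i)
  from hpoly_mult[OF hpoly_sqnorm Suc] show ?case by simp
qed

lemma hpoly_sqnorm_power_mult:
  assumes "hpoly n p" "N = 2 * i + n"
  shows "hpoly N (\<lambda>x. of_real (x \<bullet> x) ^ i * p x)"
  using hpoly_mult[OF hpoly_sqnorm_power assms(1)] assms(2) by simp

lemma hpoly_cnj:
  assumes "hpoly n p"
  shows "hpoly n (\<lambda>x. cnj (p x))"
  using assms by induction (auto intro: hpoly.intros)

lemma hpoly_linear:
  assumes "hpoly n p" and f: "linear f"
  shows "hpoly n (\<lambda>x. p (f x))"
  using assms(1)
proof induction
  case (hpoly_inner_mult n p v)
  from hpoly.hpoly_inner_mult[OF hpoly_inner_mult.IH, of "adjoint f v"] show ?case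
    by (simp add: adjoint_works[OF f])
qed (auto intro: hpoly.intros)

lemma hpoly_homogeneous:
  assumes "hpoly n p"
  shows "p (t *\<^sub>R x) = of_real (t ^ n) * p x"
  using assms by induction (auto simp: algebra_simps)

lemma hpoly_0_const: "hpoly 0 p \<Longrightarrow> p x = p y"
  by (metis hpoly_homogeneous mult_1 of_real_1 power_0 scaleR_zero_left)

lemma hpoly_eq_on_sphere:
  assumes "hpoly n p" "hpoly n q" "\<And>x. x \<in> sphere 0 1 \<Longrightarrow> p x = q x"
  shows "p = q"
proof
  fix x
  show "p x = q x"
    using hpoly_homogeneous[OF assms(1), of "norm x" "direction x"]
      hpoly_homogeneous[OF assms(2), of "norm x" "direction x"] assms(3)[of "direction x"]
      direction[of x] by simp
qed

definition dderiv :: "'a::euclidean_space \<Rightarrow> ('a \<Rightarrow> complex) \<Rightarrow> 'a \<Rightarrow> complex" where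
  "dderiv v p x = frechet_derivative p (at x) v"

lemma hpoly_differentiable:
  assumes "hpoly n p"
  shows "p differentiable (at x)"
  using assms
proof induction
  case (hpoly_inner_mult n p v)
  have "(\<lambda>x. complex_of_real (x \<bullet> v)) differentiable (at x)"
    by (rule bounded_linear_imp_differentiable)
       (intro bounded_linear_compose[OF bounded_linear_of_real] bounded_linear_inner_left)
  then show ?case using hpoly_inner_mult by simp
qed auto

lemma hpoly_has_derivative:
  assumes "hpoly n p"
  shows "(p has_derivative (\<lambda>v. dderiv v p x)) (at x)"
  using hpoly_differentiable[OF assms] unfolding dderiv_def
  by (simp add: frechet_derivative_works eta_contract_eq)

lemma dderiv_eqI: "(p has_derivative p') (at x) \<Longrightarrow> dderiv v p x = p' v"
  unfolding dderiv_def by (metis frechet_derivative_at)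

lemma hpoly_continuous_on: "hpoly n p \<Longrightarrow> continuous_on S p"
  by (meson differentiable_imp_continuous_within continuous_at_imp_continuous_on
      hpoly_differentiable)

lemma dderiv_const: "dderiv v (\<lambda>x. c) x = 0"
  by (rule dderiv_eqI) simp

lemma dderiv_add:
  assumes "hpoly n p" "hpoly k q"
  shows "dderiv v (\<lambda>x. p x + q x) x = dderiv v p x + dderiv v q x"
  by (rule dderiv_eqI, intro has_derivative_add hpoly_has_derivative[OF assms(1)]
      hpoly_has_derivative[OF assms(2)])

lemma dderiv_mult:
  assumes "hpoly n p" "hpoly k q"
  shows "dderiv v (\<lambda>x. p x * q x) x = p x * dderiv v q x + dderiv v p x * q x"
  by (rule dderiv_eqI, intro has_derivative_mult hpoly_has_derivative[OF assms(1)]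
      hpoly_has_derivative[OF assms(2)])

lemma dderiv_cmult:
  assumes "hpoly n p"
  shows "dderiv v (\<lambda>x. c * p x) x = c * dderiv v p x"
  using dderiv_mult[OF hpoly_const assms, of v c] by (simp add: dderiv_const)

lemma dderiv_sum:
  assumes "\<And>i. i \<in> I \<Longrightarrow> hpoly n (p i)"
  shows "dderiv v (\<lambda>x. \<Sum>i\<in>I. p i x) x = (\<Sum>i\<in>I. dderiv v (p i) x)"
  using assms
proof (induction I rule: infinite_finite_induct)
  case (insert i I)
  then show ?case
    using dderiv_add[of n "p i" n "\<lambda>x. \<Sum>i\<in>I. p i x"] by (simp add: hpoly_sum)
qed (simp_all add: dderiv_const)

lemma dderiv_inner: "dderiv v (\<lambda>x. of_real (x \<bullet> u)) x = of_real (v \<bullet> u)"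
  by (rule dderiv_eqI) (auto intro!: derivative_eq_intros)

lemma dderiv_cnj:
  assumes "hpoly n p"
  shows "dderiv v (\<lambda>x. cnj (p x)) x = cnj (dderiv v p x)"
  by (rule dderiv_eqI, rule has_derivative_cnj[OF hpoly_has_derivative[OF assms]])

lemma dderiv_linear:
  assumes "hpoly n p" and f: "linear f"
  shows "dderiv v (\<lambda>x. p (f x)) x = dderiv (f v) p (f x)"
proof (rule dderiv_eqI)
  have "(f has_derivative f) (at x)"
    using f by (simp add: linear_imp_has_derivative)
  from has_derivative_compose[OF this hpoly_has_derivative[OF assms(1)]]
  show "((\<lambda>x. p (f x)) has_derivative (\<lambda>v. dderiv (f v) p (f x))) (at x)" .
qed

lemma linear_dderiv:
  assumes "hpoly n p"
  shows "linear (\<lambda>v. dderiv v p x)"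
  using has_derivative_linear[OF hpoly_has_derivative[OF assms]] .

lemma dderiv_plus: "hpoly n p \<Longrightarrow> dderiv (u + v) p x = dderiv u p x + dderiv v p x"
  by (rule linear_add[OF linear_dderiv])

lemma dderiv_scaleR: "hpoly n p \<Longrightarrow> dderiv (c *\<^sub>R v) p x = of_real c * dderiv v p x"
  by (simp add: linear_scale[OF linear_dderiv] scaleR_conv_of_real)

lemma dderiv_Basis:
  assumes "hpoly n p"
  shows "(\<Sum>b\<in>Basis. of_real (v \<bullet> b) * dderiv b p x) = dderiv v p x"
proof -
  have "dderiv v p x = dderiv (\<Sum>b\<in>Basis. (v \<bullet> b) *\<^sub>R b) p x"
    by (simp add: euclidean_representation)
  also have "\<dots> = (\<Sum>b\<in>Basis. dderiv ((v \<bullet> b) *\<^sub>R b) p x)"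
    by (rule linear_sum[OF linear_dderiv[OF assms]])
  finally show ?thesis by (simp add: dderiv_scaleR[OF assms])
qed

lemma hpoly_0_dderiv: "hpoly 0 p \<Longrightarrow> dderiv v p x = 0"
  by (metis (full_types) dderiv_const ext hpoly_0_const)

text \<open>Truncated subtraction is harmless: a constant has derivative 0, and 0 is homogeneous of
  every degree.\<close>

lemma hpoly_dderiv_aux:
  assumes "hpoly n p"
  shows "hpoly (n - 1) (dderiv v p)"
  using assms
proof induction
  case (hpoly_const c)
  have "dderiv v (\<lambda>x. c) = (\<lambda>x. 0)" by (rule ext) (rule dderiv_const)
  then show ?case by (simp add: hpoly_zero)
next
  case (hpoly_inner_mult n p u)
  have *: "dderiv v (\<lambda>x. of_real (x \<bullet> u) * p x)
      = (\<lambda>x. of_real (x \<bullet> u) * dderiv v p x + of_real (v \<bullet> u) * p x)"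
    by (rule ext) (simp add: dderiv_mult[OF hpoly_inner hpoly_inner_mult.hyps] dderiv_inner)
  \<comment> \<open>For n = 0 the induction hypothesis gives \<open>dderiv v p\<close> degree 0 and
    hence the product degree 1; there the derivative vanishes.\<close>
  have "hpoly n (\<lambda>x. of_real (x \<bullet> u) * dderiv v p x)"
  proof (cases n)
    case 0
    then show ?thesis using hpoly_inner_mult.hyps by (simp add: hpoly_0_dderiv hpoly_zero)
  next
    case (Suc j)
    then show ?thesis using hpoly.hpoly_inner_mult[OF hpoly_inner_mult.IH, of u] by simp
  qed
  then show ?case unfolding * by (simp add: hpoly_add hpoly_cmult hpoly_inner_mult.hyps)
next
  case (hpoly_add n p q)
  have "dderiv v (\<lambda>x. p x + q x) = (\<lambda>x. dderiv v p x + dderiv v q x)"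
    by (rule ext) (rule dderiv_add[OF hpoly_add.hyps])
  then show ?case using hpoly_add by (simp add: hpoly.hpoly_add)
qed

lemma hpoly_dderiv: "hpoly n p \<Longrightarrow> k = n - 1 \<Longrightarrow> hpoly k (dderiv v p)"
  using hpoly_dderiv_aux by simp

lemma euler:
  assumes "hpoly n p"
  shows "dderiv x p x = of_nat n * p x"
  using assms
proof induction
  case (hpoly_inner_mult n p u)
  then show ?case
    by (simp add: dderiv_mult[OF hpoly_inner hpoly_inner_mult.hyps] dderiv_inner distrib_right
        mult.left_commute)
next
  case (hpoly_add n p q)
  then show ?case by (simp add: dderiv_add[OF hpoly_add.hyps] algebra_simps)
qed (rule hpoly_0_dderiv[OF hpoly.hpoly_const, THEN trans], simp)

lemma dderiv_commute:
  assumes "hpoly n p"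
  shows "dderiv u (dderiv v p) x = dderiv v (dderiv u p) x"
  using assms
proof (induction arbitrary: x)
  case (hpoly_const c)
  have "dderiv v (\<lambda>x. c) = (\<lambda>x. 0)" for v :: 'a by (rule ext) (rule dderiv_const)
  then show ?case by (simp add: dderiv_const)
next
  case (hpoly_inner_mult n p w)
  have *: "dderiv v (\<lambda>x. of_real (x \<bullet> w) * p x)
      = (\<lambda>x. of_real (x \<bullet> w) * dderiv v p x + of_real (v \<bullet> w) * p x)" for v
    by (rule ext) (simp add: dderiv_mult[OF hpoly_inner hpoly_inner_mult.hyps] dderiv_inner)
  have D: "hpoly (n - 1) (dderiv v p)" for v
    by (rule hpoly_dderiv_aux[OF hpoly_inner_mult.hyps])
  show ?case
    unfolding *
    by (simp add: dderiv_add[OF hpoly_mult[OF hpoly_inner D] hpoly_cmult[OF hpoly_inner_mult.hyps]]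
        dderiv_mult[OF hpoly_inner D] dderiv_inner dderiv_cmult[OF hpoly_inner_mult.hyps]
        hpoly_inner_mult.IH)
next
  case (hpoly_add n p q)
  have *: "dderiv v (\<lambda>x. p x + q x) = (\<lambda>x. dderiv v p x + dderiv v q x)" for v
    by (rule ext) (rule dderiv_add[OF hpoly_add.hyps])
  show ?case
    unfolding *
    by (simp add: dderiv_add[OF hpoly_dderiv_aux[OF hpoly_add.hyps(1)] hpoly_dderiv_aux[OF hpoly_add.hyps(2)]]
        hpoly_add.IH)
qed

lemma hpoly_has_vector_derivative_line:
  assumes "hpoly n p"
  shows "((\<lambda>t. p (x + t *\<^sub>R v)) has_vector_derivative dderiv v p (x + s *\<^sub>R v)) (at s)"
proof -
  have "((\<lambda>t. x + t *\<^sub>R v) has_derivative (\<lambda>h. h *\<^sub>R v)) (at s)"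
    by (auto intro!: derivative_eq_intros)
  from has_derivative_compose[OF this hpoly_has_derivative[OF assms]]
  show ?thesis
    by (simp add: has_vector_derivative_def dderiv_scaleR[OF assms] scaleR_conv_of_real)
qed

section \<open>The Laplacian of homogeneous polynomials\<close>

lemma laplacian_hpoly:
  assumes "hpoly n p"
  shows "laplacian p x = (\<Sum>b\<in>Basis. dderiv b (dderiv b p) x)"
proof -
  have "vector_derivative (\<lambda>t. p (x + t *\<^sub>R b)) (at s) = dderiv b p (x + s *\<^sub>R b)" for b s
    by (rule vector_derivative_at[OF hpoly_has_vector_derivative_line[OF assms]])
  moreover have "vector_derivative (\<lambda>s. dderiv b p (x + s *\<^sub>R b)) (at 0)
      = dderiv b (dderiv b p) (x + 0 *\<^sub>R b)" for b
    by (rule vector_derivative_at[OF hpoly_has_vector_derivative_line[OF hpoly_dderiv_aux[OF assms]]])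
  ultimately show ?thesis unfolding laplacian_def by simp
qed

lemma hpoly_laplacian:
  assumes "hpoly n p" "k = n - 2"
  shows "hpoly k (laplacian p)"
proof -
  have "hpoly (n - 1 - 1) (\<lambda>x. \<Sum>b\<in>Basis. dderiv b (dderiv b p) x)"
    by (intro hpoly_sum hpoly_dderiv_aux assms)
  moreover have "laplacian p = (\<lambda>x. \<Sum>b\<in>Basis. dderiv b (dderiv b p) x)"
    by (rule ext) (rule laplacian_hpoly[OF assms(1)])
  ultimately show ?thesis using assms(2) by (simp add: numeral_2_eq_2)
qed

lemma laplacian_mult:
  assumes p: "hpoly n p" and q: "hpoly k q"
  shows "laplacian (\<lambda>x. p x * q x) x = p x * laplacian q x
    + 2 * (\<Sum>b\<in>Basis. dderiv b p x * dderiv b q x) + laplacian p x * q x"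
proof -
  have *: "dderiv b (\<lambda>x. p x * q x) = (\<lambda>x. p x * dderiv b q x + dderiv b p x * q x)" for b
    by (rule ext) (rule dderiv_mult[OF p q])
  note D = hpoly_dderiv_aux
  have "dderiv b (dderiv b (\<lambda>x. p x * q x)) x
      = p x * dderiv b (dderiv b q) x + 2 * (dderiv b p x * dderiv b q x) + dderiv b (dderiv b p) x * q x" for b
    unfolding *
    by (simp add: dderiv_add[OF hpoly_mult[OF p D[OF q]] hpoly_mult[OF D[OF p] q]]
        dderiv_mult[OF p D[OF q]] dderiv_mult[OF D[OF p] q])
  then show ?thesis
    by (simp add: laplacian_hpoly[OF p] laplacian_hpoly[OF q] laplacian_hpoly[OF hpoly_mult[OF p q]]
        sum.distrib sum_distrib_left sum_distrib_right)
qed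

lemma laplacian_sum:
  assumes "\<And>i. i \<in> I \<Longrightarrow> hpoly n (p i)"
  shows "laplacian (\<lambda>x. \<Sum>i\<in>I. p i x) x = (\<Sum>i\<in>I. laplacian (p i) x)"
proof -
  have "dderiv b (\<lambda>x. \<Sum>i\<in>I. p i x) = (\<lambda>x. \<Sum>i\<in>I. dderiv b (p i) x)" for b
    by (rule ext) (rule dderiv_sum[OF assms])
  then have "dderiv b (dderiv b (\<lambda>x. \<Sum>i\<in>I. p i x)) x = (\<Sum>i\<in>I. dderiv b (dderiv b (p i)) x)" for b
    using dderiv_sum[of I "n - 1" "\<lambda>i. dderiv b (p i)", OF hpoly_dderiv_aux[OF assms]] by simp
  then have "laplacian (\<lambda>x. \<Sum>i\<in>I. p i x) x = (\<Sum>b\<in>Basis. \<Sum>i\<in>I. dderiv b (dderiv b (p i)) x)"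
    by (simp add: laplacian_hpoly[OF hpoly_sum[OF assms]])
  also have "\<dots> = (\<Sum>i\<in>I. \<Sum>b\<in>Basis. dderiv b (dderiv b (p i)) x)"
    by (rule sum.swap)
  also have "\<dots> = (\<Sum>i\<in>I. laplacian (p i) x)"
    by (rule sum.cong[OF refl]) (rule laplacian_hpoly[OF assms, symmetric])
  finally show ?thesis .
qed

lemma laplacian_const: "laplacian (\<lambda>x. c) x = 0"
  by (simp add: laplacian_def)

lemma laplacian_cmult:
  assumes "hpoly n p"
  shows "laplacian (\<lambda>x. c * p x) x = c * laplacian p x"
  using laplacian_mult[OF hpoly_const assms, of c x]
  by (simp add: laplacian_const dderiv_const)

lemma laplacian_add:
  assumes "hpoly n p" "hpoly n q"
  shows "laplacian (\<lambda>x. p x + q x) x = laplacian p x + laplacian q x"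
  \<comment> \<open>Two terms as a sum over the booleans.\<close>
  using laplacian_sum[of UNIV n "\<lambda>i. if i then p else q" x] assms
  by (simp add: UNIV_bool add.commute)

lemma laplacian_diff:
  assumes "hpoly n p" "hpoly n q"
  shows "laplacian (\<lambda>x. p x - q x) x = laplacian p x - laplacian q x"
  using laplacian_add[OF assms(1) hpoly_cmult[OF assms(2), of "- 1"]]
    laplacian_cmult[OF assms(2), of "- 1"] by simp

lemma laplacian_dderiv:
  assumes "hpoly n p"
  shows "laplacian (dderiv v p) x = dderiv v (laplacian p) x"
proof -
  have "laplacian p = (\<lambda>x. \<Sum>b\<in>Basis. dderiv b (dderiv b p) x)"
    by (rule ext) (rule laplacian_hpoly[OF assms])
  then have "dderiv v (laplacian p) x = (\<Sum>b\<in>Basis. dderiv v (dderiv b (dderiv b p)) x)"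
    using dderiv_sum[OF hpoly_dderiv_aux[OF hpoly_dderiv_aux[OF assms]]] by simp
  also have "\<dots> = (\<Sum>b\<in>Basis. dderiv b (dderiv b (dderiv v p)) x)"
  proof (intro sum.cong refl)
    fix b :: 'a
    have "dderiv v (dderiv b p) = dderiv b (dderiv v p)"
      by (rule ext) (rule dderiv_commute[OF assms])
    then show "dderiv v (dderiv b (dderiv b p)) x = dderiv b (dderiv b (dderiv v p)) x"
      using dderiv_commute[OF hpoly_dderiv_aux[OF assms]] by simp
  qed
  finally show ?thesis by (simp add: laplacian_hpoly[OF hpoly_dderiv_aux[OF assms]])
qed

lemma laplacian_inner_mult:
  assumes "hpoly n p"
  shows "laplacian (\<lambda>x. of_real (x \<bullet> v) * p x) x
    = of_real (x \<bullet> v) * laplacian p x + 2 * dderiv v p x"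
proof -
  have "laplacian (\<lambda>x. of_real (x \<bullet> v)) x = 0"
  proof -
    have "dderiv b (\<lambda>x. of_real (x \<bullet> v)) = (\<lambda>x. of_real (b \<bullet> v))" for b :: 'a
      by (rule ext) (rule dderiv_inner)
    then show ?thesis by (simp add: laplacian_hpoly[OF hpoly_inner] dderiv_const)
  qed
  then show ?thesis
    using dderiv_Basis[OF assms, of v x]
    by (simp add: laplacian_mult[OF hpoly_inner assms] dderiv_inner inner_commute)
qed

lemma dderiv_sqnorm: "dderiv v (\<lambda>x. of_real (x \<bullet> x)) x = 2 * of_real (x \<bullet> v)"
  by (rule dderiv_eqI) (auto intro!: derivative_eq_intros simp: inner_commute)

text \<open>The cross term of the product rule is 4 times the radial derivative of p, hence 4 n p by
  Euler's relation; 2 d is the Laplacian of x . x.\<close>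

lemma laplacian_sqnorm_mult:
  fixes p :: "'a::euclidean_space \<Rightarrow> complex"
  assumes "hpoly n p"
  shows "laplacian (\<lambda>x. of_real (x \<bullet> x) * p x) x
    = of_real (x \<bullet> x) * laplacian p x + of_nat (4 * n + 2 * DIM('a)) * p x"
proof -
  have "laplacian (\<lambda>x::'a. of_real (x \<bullet> x)) x = of_nat (2 * DIM('a))"
  proof -
    have "dderiv b (\<lambda>x. of_real (x \<bullet> x)) = (\<lambda>x. 2 * of_real (x \<bullet> b))" for b :: 'a
      by (rule ext) (rule dderiv_sqnorm)
    then show ?thesis
      by (simp add: laplacian_hpoly[OF hpoly_sqnorm] dderiv_cmult[OF hpoly_inner] dderiv_inner)
  qed
  moreover have "(\<Sum>b\<in>Basis. 2 * complex_of_real (x \<bullet> b) * dderiv b p x) = 2 * (of_nat n * p x)"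
    using dderiv_Basis[OF assms, of x x] euler[OF assms, of x]
    by (simp add: mult.assoc sum_distrib_left[symmetric])
  ultimately show ?thesis
    unfolding laplacian_mult[OF hpoly_sqnorm assms] dderiv_sqnorm by (simp add: algebra_simps)
qed

text \<open>For i = 0 the truncated exponent i - 1 is multiplied by 0. The 2 is subtracted in the
  complex numbers, where nothing is truncated.\<close>

lemma laplacian_sqnorm_power_mult:
  fixes p :: "'a::euclidean_space \<Rightarrow> complex"
  assumes p: "hpoly n p"
  shows "laplacian (\<lambda>x. of_real (x \<bullet> x) ^ i * p x) x
    = of_real (x \<bullet> x) ^ i * laplacian p x
      + of_nat (2 * i) * (of_nat (2 * i + 2 * n + DIM('a)) - 2) * (of_real (x \<bullet> x) ^ (i - 1) * p x)"
proof (induction i)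
  case 0
  show ?case by simp
next
  case (Suc i)
  let ?q = "\<lambda>x. of_real (x \<bullet> x) ^ i * p x"
  have q: "hpoly (2 * i + n) ?q" by (rule hpoly_sqnorm_power_mult[OF p refl])
  have e: "of_nat (2 * i) * (of_real (x \<bullet> x) * (complex_of_real (x \<bullet> x) ^ (i - 1) * p x)) = of_nat (2 * i) * ?q x"
    by (cases i) simp_all
  have "laplacian (\<lambda>x. of_real (x \<bullet> x) ^ Suc i * p x) x = laplacian (\<lambda>x. of_real (x \<bullet> x) * ?q x) x"
    by (simp add: mult.assoc)
  also have "\<dots> = of_real (x \<bullet> x) * laplacian ?q x + of_nat (4 * (2 * i + n) + 2 * DIM('a)) * ?q x"
    by (rule laplacian_sqnorm_mult[OF q])
  also have "\<dots> = of_real (x \<bullet> x) ^ Suc i * laplacian p x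
      + (of_nat (2 * i + 2 * n + DIM('a)) - 2) * (of_nat (2 * i) * (of_real (x \<bullet> x) * (complex_of_real (x \<bullet> x) ^ (i - 1) * p x)))
      + of_nat (4 * (2 * i + n) + 2 * DIM('a)) * ?q x"
    unfolding Suc.IH by (simp only: algebra_simps power_Suc)
  finally show ?case unfolding e by (simp add: algebra_simps)
qed

section \<open>Harmonic polynomials\<close>

text \<open>Splitting into homogeneous components. Those beyond K are required to vanish so that the
  bounds of two summands can be merged and products become Cauchy products.\<close>

lemma real_polynomial_function_graded:
  fixes r :: "'a::euclidean_space \<Rightarrow> real"
  assumes "real_polynomial_function r"
  shows "\<exists>K c. (\<forall>k. hpoly k (c k)) \<and> (\<forall>k>K. \<forall>x. c k x = 0) \<and> (\<forall>x. of_real (r x) = (\<Sum>k\<le>K. c k x))"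
  using assms
proof induction
  case (linear f)
  let ?c = "\<lambda>k x. if k = 1 then complex_of_real (f x) else 0"
  have f: "f x = x \<bullet> adjoint f 1" for x
    using adjoint_works[OF bounded_linear.linear[OF linear], of x 1] by simp
  have "hpoly k (?c k)" for k
  proof (cases "k = 1")
    case True
    then show ?thesis using hpoly_inner[of "adjoint f 1"] by (simp add: f[symmetric])
  qed (simp add: hpoly_zero)
  then show ?case by (intro exI[of _ 1] exI[of _ ?c]) auto
next
  case (const e)
  let ?c = "\<lambda>k (x::'a). if k = 0 then complex_of_real e else 0"
  have "hpoly k (?c k)" for k
    by (cases "k = 0") (simp_all add: hpoly_zero hpoly_const)
  then show ?case by (intro exI[of _ 0] exI[of _ ?c]) auto
next
  case (add f g)
  then obtain K c L e where c: "\<forall>k. hpoly k (c k)" "\<forall>k>K. \<forall>x. c k x = 0" "\<forall>x. of_real (f x) = (\<Sum>k\<le>K. c k x)"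
    and e: "\<forall>k. hpoly k (e k)" "\<forall>k>L. \<forall>x. e k x = 0" "\<forall>x. of_real (g x) = (\<Sum>k\<le>L. e k x)"
    by blast
  have "(\<Sum>k\<le>K. c k x) = (\<Sum>k\<le>K + L. c k x)" "(\<Sum>k\<le>L. e k x) = (\<Sum>k\<le>K + L. e k x)" for x
    using c(2) e(2) by (auto intro!: sum.mono_neutral_left intro: leI)
  then show ?case
    using c e by (intro exI[of _ "K + L"] exI[of _ "\<lambda>k x. c k x + e k x"])
      (auto simp: sum.distrib intro: hpoly_add)
next
  case (mult f g)
  then obtain K c L e where c: "\<forall>k. hpoly k (c k)" "\<forall>k>K. \<forall>x. c k x = 0" "\<forall>x. of_real (f x) = (\<Sum>k\<le>K. c k x)"
    and e: "\<forall>k. hpoly k (e k)" "\<forall>k>L. \<forall>x. e k x = 0" "\<forall>x. of_real (g x) = (\<Sum>k\<le>L. e k x)"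
    by blast
  let ?h = "\<lambda>r x. \<Sum>k\<le>r. c k x * e (r - k) x"
  have "hpoly r (?h r)" for r
    by (rule hpoly_sum) (metis atMost_iff c(1) e(1) hpoly_mult le_add_diff_inverse)
  moreover have "?h r x = 0" if "r > K + L" for r x
  proof (intro sum.neutral ballI)
    fix k assume "k \<in> {..r}"
    with that have "k > K \<or> r - k > L" by auto
    then show "c k x * e (r - k) x = 0" using c(2) e(2) by auto
  qed
  moreover have "of_real (f x * g x) = (\<Sum>r\<le>K + L. ?h r x)" for x
    using polynomial_product[of K "\<lambda>k. c k x" L "\<lambda>k. e k x" 1] c e by simp
  ultimately show ?case by (intro exI[of _ "K + L"] exI[of _ ?h]) blast
qed

text \<open>Along the ray t x both t^n p x and the graded expansion are polynomials in t; comparing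
  coefficients leaves only the component of degree n.\<close>

lemma hpoly_if_polynomial_function:
  fixes p :: "'a::euclidean_space \<Rightarrow> complex"
  assumes p: "polynomial_function p" and hom: "\<And>t x. p (t *\<^sub>R x) = of_real (t ^ n) * p x"
  shows "hpoly n p"
proof -
  have "real_polynomial_function (\<lambda>x. Re (p x))" "real_polynomial_function (\<lambda>x. Im (p x))"
    using p bounded_linear_Re bounded_linear_Im
    unfolding polynomial_function_def by (auto simp: o_def)
  from this[THEN real_polynomial_function_graded] obtain K c L e
    where c: "\<forall>k. hpoly k (c k)" "\<forall>k>K. \<forall>x. c k x = 0" "\<forall>x. of_real (Re (p x)) = (\<Sum>k\<le>K. c k x)"
    and e: "\<forall>k. hpoly k (e k)" "\<forall>k>L. \<forall>x. e k x = 0" "\<forall>x. of_real (Im (p x)) = (\<Sum>k\<le>L. e k x)"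
    by blast
  define N where "N = K + L + n"
  define g where "g k x = c k x + \<i> * e k x" for k x
  have g: "hpoly k (g k)" for k
    unfolding g_def by (intro hpoly_add hpoly_cmult c(1)[rule_format] e(1)[rule_format])
  have sum_g: "p x = (\<Sum>k\<le>N. g k x)" for x
  proof -
    have "(\<Sum>k\<le>K. c k x) = (\<Sum>k\<le>N. c k x)" "(\<Sum>k\<le>L. e k x) = (\<Sum>k\<le>N. e k x)"
      using c(2) e(2) by (auto intro!: sum.mono_neutral_left intro: leI simp: N_def)
    then show ?thesis
      using c(3) e(3) complex_eq[of "p x"]
      by (simp add: g_def sum.distrib sum_distrib_left[symmetric])
  qed
  have "p x = g n x" for x
  proof -
    have *: "(\<Sum>k\<le>N. of_real (t ^ k) * g k x) = of_real (t ^ n) * p x" for t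
      using sum_g[of "t *\<^sub>R x"] hom[of t x] hpoly_homogeneous[OF g, of _ t x] by simp
    \<comment> \<open>The variable t is real while the values are complex, so coefficients are
      compared for real and imaginary parts separately.\<close>
    have coeff: "f (g n x) = f (p x)" if f: "linear f" for f :: "complex \<Rightarrow> real"
    proof -
      have "f (of_real r * z) = f z * r" for r z
        using linear_scale[OF f, of r z] by (simp add: scaleR_conv_of_real mult.commute)
      then have "(\<Sum>k\<le>N. f (g k x) * t ^ k) = (\<Sum>k\<le>N. (if k = n then f (p x) else 0) * t ^ k)" for t
        using arg_cong[OF *[of t], of f]
        by (simp add: linear_sum[OF f] N_def if_distrib[of "\<lambda>y. y * _"] cong: if_cong del: of_real_power)
      then have "\<forall>k\<le>N. f (g k x) = (if k = n then f (p x) else 0)"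
        using polyfun_eq_coeffs[of "\<lambda>k. f (g k x)" N "\<lambda>k. if k = n then f (p x) else 0"] by simp
      then show ?thesis by (simp add: N_def)
    qed
    have "linear Re" "linear Im"
      by (auto intro: bounded_linear.linear bounded_linear_Re bounded_linear_Im)
    then show ?thesis using coeff[of Re] coeff[of Im] by (simp add: complex_eq_iff)
  qed
  then have "p = g n" by (rule ext)
  then show ?thesis using g by simp
qed

lemma hpoly_polynomial_function: "hpoly n p \<Longrightarrow> polynomial_function p"
proof (induction rule: hpoly.induct)
  case (hpoly_inner_mult n p v)
  have "real_polynomial_function (\<lambda>x. x \<bullet> v)"
    by (intro real_polynomial_function.intros(1) bounded_linear_inner_left)
  from polynomial_function_mult[OF _ hpoly_inner_mult.IH, of "\<lambda>x. x \<bullet> v"] this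
  show ?case by (simp add: real_polynomial_function_eq scaleR_conv_of_real)
qed auto

lemma harmonic_homogeneous_iff:
  "p \<in> harmonic_homogeneous n \<longleftrightarrow> hpoly n p \<and> (\<forall>x. laplacian p x = 0)"
  unfolding harmonic_homogeneous_def
  using hpoly_if_polynomial_function[of p n] hpoly_polynomial_function[of n p] hpoly_homogeneous[of n p]
  by auto

lemma harmonic_hpoly: "p \<in> harmonic_homogeneous n \<Longrightarrow> hpoly n p"
  by (simp add: harmonic_homogeneous_iff)

lemma harmonic_laplacian: "p \<in> harmonic_homogeneous n \<Longrightarrow> laplacian p x = 0"
  by (simp add: harmonic_homogeneous_iff)

lemma harmonic_cmult: "p \<in> harmonic_homogeneous n \<Longrightarrow> (\<lambda>x. c * p x) \<in> harmonic_homogeneous n"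
  by (auto simp: harmonic_homogeneous_iff hpoly_cmult laplacian_cmult)

lemma harmonic_sum:
  "(\<And>i. i \<in> I \<Longrightarrow> p i \<in> harmonic_homogeneous n) \<Longrightarrow> (\<lambda>x. \<Sum>i\<in>I. p i x) \<in> harmonic_homogeneous n"
  by (auto simp: harmonic_homogeneous_iff hpoly_sum laplacian_sum[where n = n])

lemma harmonic_add:
  "p \<in> harmonic_homogeneous n \<Longrightarrow> q \<in> harmonic_homogeneous n
    \<Longrightarrow> (\<lambda>x. p x + q x) \<in> harmonic_homogeneous n"
  by (auto simp: harmonic_homogeneous_iff hpoly_add laplacian_add)

lemma harmonic_cnj:
  assumes "p \<in> harmonic_homogeneous n"
  shows "(\<lambda>x. cnj (p x)) \<in> harmonic_homogeneous n"
proof -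
  have p: "hpoly n p" by (rule harmonic_hpoly[OF assms])
  have "dderiv b (\<lambda>x. cnj (p x)) = (\<lambda>x. cnj (dderiv b p x))" for b
    by (rule ext) (rule dderiv_cnj[OF p])
  then have "laplacian (\<lambda>x. cnj (p x)) x = cnj (laplacian p x)" for x
    by (simp add: laplacian_hpoly[OF hpoly_cnj[OF p]] laplacian_hpoly[OF p]
        dderiv_cnj[OF hpoly_dderiv_aux[OF p]])
  then show ?thesis
    using harmonic_laplacian[OF assms] hpoly_cnj[OF p] by (simp add: harmonic_homogeneous_iff)
qed

lemma harmonic_dderiv:
  assumes "p \<in> harmonic_homogeneous n" "k = n - 1"
  shows "dderiv v p \<in> harmonic_homogeneous k"
proof -
  have p: "hpoly n p" by (rule harmonic_hpoly[OF assms(1)])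
  have "laplacian p = (\<lambda>x. 0)" using harmonic_laplacian[OF assms(1)] by (rule ext)
  then have "laplacian (dderiv v p) x = 0" for x
    by (simp add: laplacian_dderiv[OF p] dderiv_const)
  then show ?thesis using hpoly_dderiv[OF p assms(2)] by (simp add: harmonic_homogeneous_iff)
qed

text \<open>Decompose the Laplacian of q, of degree n - 2, and lift each summand back: for harmonic
  f the Laplacian of |x|^(2j+2) f is a nonzero multiple of |x|^(2j) f. What remains of q is
  harmonic.\<close>

theorem harmonic_decomposition:
  fixes q :: "'a::euclidean_space \<Rightarrow> complex"
  assumes "hpoly n q"
  shows "\<exists>h. (\<forall>j\<le>n div 2. h j \<in> harmonic_homogeneous (n - 2 * j)) \<and>
    (\<forall>x. q x = (\<Sum>j\<le>n div 2. of_real (x \<bullet> x) ^ j * h j x))"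
  using assms
proof (induction n arbitrary: q rule: less_induct)
  case (less n)
  show ?case
  proof (cases "n < 2")
    case True
    then have "hpoly 0 (dderiv b q)" for b
      using hpoly_dderiv[OF less.prems] by simp
    then have "laplacian q x = 0" for x
      by (simp add: laplacian_hpoly[OF less.prems] hpoly_0_dderiv)
    then have "q \<in> harmonic_homogeneous n"
      using less.prems by (simp add: harmonic_homogeneous_iff)
    then show ?thesis using True by (intro exI[of _ "\<lambda>j. q"]) auto
  next
    case False
    define k where "k = n - 2"
    have n: "n = k + 2" using False by (simp add: k_def)
    obtain g where g: "\<And>j. j \<le> k div 2 \<Longrightarrow> g j \<in> harmonic_homogeneous (k - 2 * j)"
      and lap: "\<And>x. laplacian q x = (\<Sum>j\<le>k div 2. of_real (x \<bullet> x) ^ j * g j x)"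
      using less.IH[of k "laplacian q"] hpoly_laplacian[OF less.prems] n by auto
    \<comment> \<open>The factor in \<open>laplacian_sqnorm_power_mult\<close> for exponent j + 1
      and degree k - 2 j, where 2 (j + 1) has absorbed the - 2.\<close>
    define c :: "nat \<Rightarrow> complex" where
      "c j = of_nat (2 * Suc j) * of_nat (2 * j + 2 * (k - 2 * j) + DIM('a))" for j
    have c: "c j \<noteq> 0" for j
      unfolding c_def of_nat_mult[symmetric] of_nat_eq_0_iff by simp
    define f where "f j = (\<lambda>x. g j x / c j)" for j
    have f: "f j \<in> harmonic_homogeneous (k - 2 * j)" if "j \<le> k div 2" for j
      using harmonic_cmult[OF g[OF that], of "1 / c j"] by (simp add: f_def[abs_def])
    have p: "hpoly n (\<lambda>x. of_real (x \<bullet> x) ^ Suc j * f j x)" if "j \<le> k div 2" for j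
      by (rule hpoly_sqnorm_power_mult[OF harmonic_hpoly[OF f[OF that]]]) (use that n in auto)
    have lap_p: "laplacian (\<lambda>x. of_real (x \<bullet> x) ^ Suc j * f j x) x = of_real (x \<bullet> x) ^ j * g j x"
      if "j \<le> k div 2" for j x
    proof -
      have "laplacian (\<lambda>x. of_real (x \<bullet> x) ^ Suc j * f j x) x = c j * (of_real (x \<bullet> x) ^ j * f j x)"
        unfolding laplacian_sqnorm_power_mult[OF harmonic_hpoly[OF f[OF that]], of "Suc j"] c_def
        by (simp add: harmonic_laplacian[OF f[OF that]])
      then show ?thesis using c[of j] by (simp add: f_def)
    qed
    \<comment> \<open>The lifted summands move up by one power of x . x; index 0 is taken by the
      harmonic remainder.\<close>
    define h where "h j = (case j of 0 \<Rightarrow> (\<lambda>x. q x - (\<Sum>j\<le>k div 2. of_real (x \<bullet> x) ^ Suc j * f j x))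
      | Suc i \<Rightarrow> f i)" for j
    have sp: "hpoly n (\<lambda>x. \<Sum>j\<le>k div 2. of_real (x \<bullet> x) ^ Suc j * f j x)"
      by (intro hpoly_sum p) auto
    have "laplacian (\<lambda>x. \<Sum>j\<le>k div 2. of_real (x \<bullet> x) ^ Suc j * f j x) x = laplacian q x" for x
      using laplacian_sum[of "{..k div 2}" n "\<lambda>j x. of_real (x \<bullet> x) ^ Suc j * f j x" x] p
      by (simp add: lap_p lap del: power_Suc)
    then have "laplacian (h 0) x = 0" for x
      unfolding h_def by (simp add: laplacian_diff[OF less.prems sp] del: power_Suc)
    then have "h 0 \<in> harmonic_homogeneous n"
      using hpoly_diff[OF less.prems sp] by (simp add: harmonic_homogeneous_iff h_def)
    then have "h j \<in> harmonic_homogeneous (n - 2 * j)" if "j \<le> n div 2" for j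
      using that f n by (cases j) (auto simp: h_def)
    moreover have "q x = (\<Sum>j\<le>n div 2. of_real (x \<bullet> x) ^ j * h j x)" for x
    proof -
      have "n div 2 = Suc (k div 2)" using n by simp
      then show ?thesis
        by (simp add: sum.atMost_Suc_shift h_def del: sum.atMost_Suc)
    qed
    ultimately show ?thesis by blast
  qed
qed

lemma dderiv_inner_mult:
  assumes "hpoly n p"
  shows "dderiv v (\<lambda>x. of_real (x \<bullet> u) * p x) x = of_real (x \<bullet> u) * dderiv v p x + of_real (v \<bullet> u) * p x"
  by (simp add: dderiv_mult[OF hpoly_inner assms] dderiv_inner)

text \<open>The harmonic part of a linear form times h. The Laplacian turns (x . v) h into 2 D_v h
  and |x|^2 D_v h into 2 (2 n + d - 2) D_v h, which fixes the coefficient; the side condition keeps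
  its denominator nonzero.\<close>

lemma harmonic_inner_mult:
  fixes h :: "'a::euclidean_space \<Rightarrow> complex"
  assumes "h \<in> harmonic_homogeneous n" and "n > 0 \<or> DIM('a) > 2"
  shows "(\<lambda>x. of_real (x \<bullet> v) * h x - of_real (x \<bullet> x) * (dderiv v h x / (of_nat (2 * n + DIM('a)) - 2)))
    \<in> harmonic_homogeneous (Suc n)"
proof -
  let ?c = "of_nat (2 * n + DIM('a)) - 2 :: complex"
  have h: "hpoly n h" by (rule harmonic_hpoly[OF assms(1)])
  have c: "?c \<noteq> 0"
  proof
    assume "?c = 0"
    then have "(of_nat (2 * n + DIM('a)) :: complex) = of_nat 2" by simp
    then have "2 * n + DIM('a) = 2" by (simp only: of_nat_eq_iff)
    moreover have "DIM('a) \<ge> 1" by simp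
    ultimately show False using assms(2) by linarith
  qed
  have 1: "hpoly (Suc n) (\<lambda>x. of_real (x \<bullet> v) * h x)" by (rule hpoly_inner_mult[OF h])
  show ?thesis
  proof (cases n)
    case 0
    then have "dderiv v h x = 0" for x using h hpoly_0_dderiv by blast
    moreover have "laplacian (\<lambda>x. of_real (x \<bullet> v) * h x) x = 0" for x
      by (simp add: laplacian_inner_mult[OF h] harmonic_laplacian[OF assms(1)] calculation)
    ultimately show ?thesis using 1 by (simp add: harmonic_homogeneous_iff)
  next
    case (Suc j)
    have D: "dderiv v h \<in> harmonic_homogeneous j" by (rule harmonic_dderiv[OF assms(1)]) (simp add: Suc)
    note D = harmonic_cmult[OF D, of "1 / ?c"]
    have 2: "hpoly (Suc n) (\<lambda>x. of_real (x \<bullet> x) * (1 / ?c * dderiv v h x))"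
      using hpoly_sqnorm_power_mult[OF harmonic_hpoly[OF D], of "Suc n" 1] Suc by simp
    have "laplacian (\<lambda>x. of_real (x \<bullet> v) * h x - of_real (x \<bullet> x) * (1 / ?c * dderiv v h x)) x = 0" for x
    proof -
      have e: "of_nat (4 * j + 2 * DIM('a)) = 2 * ?c" using Suc by simp
      show ?thesis
        unfolding laplacian_diff[OF 1 2] laplacian_inner_mult[OF h] laplacian_sqnorm_mult[OF harmonic_hpoly[OF D]] e
        by (simp only: harmonic_laplacian[OF D] harmonic_laplacian[OF assms(1)]) (use c in \<open>simp add: field_simps\<close>)
    qed
    then show ?thesis using hpoly_diff[OF 1 2] by (simp add: harmonic_homogeneous_iff)
  qed
qed

section \<open>The Cauchy problem for Laplace's equation on a hyperplane\<close>

lemma laplacian_inner_power_mult: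
  assumes p: "hpoly n p" and v: "norm v = 1"
  shows "laplacian (\<lambda>x. of_real (x \<bullet> v) ^ (k + 2) * p x) x
    = of_real (x \<bullet> v) ^ k * (of_real (x \<bullet> v) ^ 2 * laplacian p x
        + 2 * of_nat (k + 2) * of_real (x \<bullet> v) * dderiv v p x + of_nat ((k + 2) * (k + 1)) * p x)"
proof (induction k)
  have vv: "v \<bullet> v = 1" using v by (simp add: dot_square_norm)
  have hp: "hpoly (k + n) (\<lambda>x. of_real (x \<bullet> v) ^ k * p x)" for k
  proof (induction k)
    case (Suc k)
    from hpoly_inner_mult[OF this, of v] show ?case by (simp add: mult.assoc)
  qed (simp add: p)
  have dd: "dderiv v (\<lambda>x. of_real (x \<bullet> v) ^ Suc k * p x) x
      = of_real (x \<bullet> v) ^ k * (of_real (x \<bullet> v) * dderiv v p x + of_nat (Suc k) * p x)" for k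
  proof (induction k)
    case 0
    show ?case by (simp add: dderiv_inner_mult[OF p] vv)
  next
    case (Suc k)
    show ?case
      using dderiv_inner_mult[OF hp[of "Suc k"], of v v x] Suc by (simp add: vv algebra_simps)
  qed
  case 0
  show ?case
    using laplacian_inner_mult[OF hp[of 1], of v x] dd[of 0] laplacian_inner_mult[OF p, of v x]
    by (simp add: mult.assoc power2_eq_square algebra_simps)
  case (Suc k)
  show ?case
    using laplacian_inner_mult[OF hp[of "k + 2"], of v x] Suc dd[of "Suc k"]
    by (simp add: mult.assoc power2_eq_square algebra_simps)
qed

text \<open>For a unit vector \<open>\<omega>\<close>, the values \<open>s = - 1\<close> and \<open>s = 0\<close> give the reflection in the hyperplane
  orthogonal to \<open>\<omega>\<close> and the projection onto it.\<close>

definition squeeze :: "'a::euclidean_space \<Rightarrow> real \<Rightarrow> 'a \<Rightarrow> 'a" where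
  "squeeze \<omega> s x = x + ((s - 1) * (x \<bullet> \<omega>)) *\<^sub>R \<omega>"

lemma linear_squeeze: "linear (squeeze \<omega> s)"
  unfolding squeeze_def by (intro linearI) (auto simp: inner_simps algebra_simps)

lemma squeeze_1 [simp]: "squeeze \<omega> 1 x = x"
  by (simp add: squeeze_def)

lemma squeeze_squeeze: "norm \<omega> = 1 \<Longrightarrow> squeeze \<omega> s (squeeze \<omega> r x) = squeeze \<omega> (s * r) x"
  by (simp add: squeeze_def inner_simps dot_square_norm algebra_simps)

lemma squeeze_inner: "norm \<omega> = 1 \<Longrightarrow> squeeze \<omega> s x \<bullet> \<omega> = s * (x \<bullet> \<omega>)"
  by (simp add: squeeze_def inner_simps dot_square_norm algebra_simps)

lemma squeeze_orthogonal: "x \<bullet> \<omega> = 0 \<Longrightarrow> squeeze \<omega> s x = x"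
  by (simp add: squeeze_def)

lemma squeeze_inner_squeeze:
  "norm \<omega> = 1 \<Longrightarrow> squeeze \<omega> s x \<bullet> squeeze \<omega> s x = x \<bullet> x + (s\<^sup>2 - 1) * (x \<bullet> \<omega>)\<^sup>2"
  by (simp add: squeeze_def inner_simps norm_eq_1 inner_commute algebra_simps power2_eq_square)

text \<open>Division by the linear form x . \<omega>: the remainder is p at the foot of the
  perpendicular to the hyperplane. The clause for n = 0 repairs the truncated degree of the
  quotient.\<close>

lemma hpoly_divide:
  assumes "hpoly n p" and "norm \<omega> = 1"
  shows "\<exists>C. hpoly (n - 1) C \<and> (n = 0 \<longrightarrow> C = (\<lambda>x. 0)) \<and>
    (\<forall>x. p x = p (squeeze \<omega> 0 x) + of_real (x \<bullet> \<omega>) * C x)"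
  using assms(1)
proof induction
  case (hpoly_const c)
  show ?case by (intro exI[of _ "\<lambda>x. 0"]) (simp add: hpoly_zero)
next
  case (hpoly_inner_mult n p v)
  then obtain C where C: "hpoly (n - 1) C" "n = 0 \<Longrightarrow> C = (\<lambda>x. 0)"
    "\<And>x. p x = p (squeeze \<omega> 0 x) + of_real (x \<bullet> \<omega>) * C x" by blast
  \<comment> \<open>From x . v = (value at the projection) + (x . \<omega>) (\<omega> . v), dividing
    p only in the first summand.\<close>
  let ?C = "\<lambda>x. of_real (squeeze \<omega> 0 x \<bullet> v) * C x + of_real (\<omega> \<bullet> v) * p x"
  have "hpoly n (\<lambda>x. of_real (squeeze \<omega> 0 x \<bullet> v) * C x)"
  proof (cases n)
    case 0
    then show ?thesis using C(2) by (simp add: hpoly_zero)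
  next
    case (Suc j)
    then show ?thesis
      using hpoly_mult[OF hpoly_linear[OF hpoly_inner linear_squeeze] C(1)] by simp
  qed
  then have "hpoly (Suc n - 1) ?C" unfolding diff_Suc_1 by (intro hpoly_add hpoly_cmult hpoly_inner_mult.hyps)
  moreover have "of_real (x \<bullet> v) * p x
      = of_real (squeeze \<omega> 0 x \<bullet> v) * p (squeeze \<omega> 0 x) + of_real (x \<bullet> \<omega>) * ?C x" for x
  proof -
    have e: "x \<bullet> v = squeeze \<omega> 0 x \<bullet> v + (x \<bullet> \<omega>) * (\<omega> \<bullet> v)"
      by (simp add: squeeze_def inner_simps)
    have "of_real (x \<bullet> v) * p x = of_real (squeeze \<omega> 0 x \<bullet> v) * p x
        + of_real (x \<bullet> \<omega>) * of_real (\<omega> \<bullet> v) * p x"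
      by (subst e) (simp add: distrib_right)
    also have "of_real (squeeze \<omega> 0 x \<bullet> v) * p x
        = of_real (squeeze \<omega> 0 x \<bullet> v) * (p (squeeze \<omega> 0 x) + of_real (x \<bullet> \<omega>) * C x)"
      by (simp only: C(3)[of x, symmetric])
    finally show ?thesis by (simp add: algebra_simps)
  qed
  ultimately show ?case by blast
next
  case (hpoly_add n p q)
  then obtain C E where C: "hpoly (n - 1) C" "n = 0 \<Longrightarrow> C = (\<lambda>x. 0)"
      "\<And>x. p x = p (squeeze \<omega> 0 x) + of_real (x \<bullet> \<omega>) * C x"
    and E: "hpoly (n - 1) E" "n = 0 \<Longrightarrow> E = (\<lambda>x. 0)"
      "\<And>x. q x = q (squeeze \<omega> 0 x) + of_real (x \<bullet> \<omega>) * E x" by blast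
  have "p x + q x = p (squeeze \<omega> 0 x) + q (squeeze \<omega> 0 x) + of_real (x \<bullet> \<omega>) * (C x + E x)" for x
    using C(3)[of x] E(3)[of x] by (simp add: distrib_left)
  moreover have "hpoly (n - 1) (\<lambda>x. C x + E x)" by (intro hpoly.hpoly_add C E)
  moreover have "(\<lambda>x. C x + E x) = (\<lambda>x. 0)" if "n = 0" using C(2) E(2) that by simp
  ultimately show ?case by (intro exI[of _ "\<lambda>x. C x + E x"] conjI allI impI)
qed

text \<open>Lets a power of x . \<omega> be cancelled from an identity between continuous functions,
  even on the hyperplane where it vanishes.\<close>

lemma eq_0_if_off_hyperplane:
  fixes f :: "'a::euclidean_space \<Rightarrow> complex"
  assumes "continuous_on UNIV f" and "norm \<omega> = 1" and "\<And>x. x \<bullet> \<omega> \<noteq> 0 \<Longrightarrow> f x = 0"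
  shows "f x = 0"
proof (cases "x \<bullet> \<omega> = 0")
  case True
  have "(\<lambda>n. x + inverse (real (Suc n)) *\<^sub>R \<omega>) \<longlonglongrightarrow> x + 0 *\<^sub>R \<omega>"
    by (intro tendsto_intros LIMSEQ_inverse_real_of_nat)
  then have "(\<lambda>n. f (x + inverse (real (Suc n)) *\<^sub>R \<omega>)) \<longlonglongrightarrow> f x"
    using assms(1) continuous_on_tendsto_compose[of UNIV f] by simp
  moreover have "f (x + inverse (real (Suc n)) *\<^sub>R \<omega>) = 0" for n
    by (rule assms(3)) (simp add: inner_simps True dot_square_norm assms(2))
  ultimately show ?thesis by (simp add: LIMSEQ_const_iff)
qed (rule assms(3))

text \<open>Uniqueness in the Cauchy problem for the hyperplane orthogonal to \<open>\<omega>\<close>: Laplace's equation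
  makes \<open>h\<close> divisible by every power of the linear form \<open>x \<bullet> \<omega>\<close>.\<close>

lemma harmonic_cauchy_unique:
  fixes h :: "'a::euclidean_space \<Rightarrow> complex"
  assumes h: "h \<in> harmonic_homogeneous n" and \<omega>: "norm \<omega> = 1"
    and h0: "\<And>x. x \<bullet> \<omega> = 0 \<Longrightarrow> h x = 0" and h1: "\<And>x. x \<bullet> \<omega> = 0 \<Longrightarrow> dderiv \<omega> h x = 0"
  shows "h x = 0"
proof -
  have hp: "hpoly n h" by (rule harmonic_hpoly[OF h])
  have "\<exists>r. hpoly (n - k) r \<and> (\<forall>x. h x = of_real (x \<bullet> \<omega>) ^ k * r x)" for k
  proof (induction k)
    case 0
    then show ?case using hp by (intro exI[of _ h]) simp
  next
    case (Suc k)
    then obtain r where r: "hpoly (n - k) r" "\<And>x. h x = of_real (x \<bullet> \<omega>) ^ k * r x" by blast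
    have h_eq: "h = (\<lambda>x. of_real (x \<bullet> \<omega>) ^ k * r x)" by (rule ext) (rule r(2))
    have r0: "r y = 0" if y: "y \<bullet> \<omega> = 0" for y
    proof -
      consider "k = 0" | "k = 1" | j where "k = j + 2"
        using le_Suc_ex[of 2 k] by (cases "k < 2") (auto simp: less_2_cases_iff)
      then show ?thesis
      proof cases
        case 1
        then show ?thesis using h0[OF y] r(2)[of y] by simp
      next
        case 2
        then have "dderiv \<omega> h y = r y"
          unfolding h_eq using dderiv_inner_mult[OF r(1), of \<omega> \<omega> y] y \<omega> by (simp add: dot_square_norm)
        then show ?thesis using h1[OF y] by simp
      next
        case 3
        \<comment> \<open>What is left of Laplace's equation for (x . \<omega>)^(j+2) r after
          cancelling (x . \<omega>)^j. On the hyperplane only the last term survives, which forces r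
          to vanish there.\<close>
        define f where "f x = of_real (x \<bullet> \<omega>) ^ 2 * laplacian r x
          + 2 * of_nat (j + 2) * of_real (x \<bullet> \<omega>) * dderiv \<omega> r x + of_nat ((j + 2) * (j + 1)) * r x" for x
        have "continuous_on UNIV f"
          unfolding f_def
          by (intro continuous_intros hpoly_continuous_on[OF hpoly_laplacian[OF r(1) refl]]
              hpoly_continuous_on[OF hpoly_dderiv_aux[OF r(1)]] hpoly_continuous_on[OF r(1)])
        moreover have "f x = 0" if "x \<bullet> \<omega> \<noteq> 0" for x
          using laplacian_inner_power_mult[OF r(1) \<omega>, of j x] harmonic_laplacian[OF h, of x] that
          by (simp add: h_eq 3 f_def)
        ultimately have "f y = 0" by (rule eq_0_if_off_hyperplane[OF _ \<omega>])
        then show ?thesis by (simp add: f_def y del: of_nat_mult of_nat_add of_nat_Suc)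
      qed
    qed
    obtain C where C: "hpoly (n - k - 1) C" "\<And>x. r x = r (squeeze \<omega> 0 x) + of_real (x \<bullet> \<omega>) * C x"
      using hpoly_divide[OF r(1) \<omega>] by blast
    have "r x = of_real (x \<bullet> \<omega>) * C x" for x
      using C(2)[of x] r0[of "squeeze \<omega> 0 x"] by (simp add: squeeze_inner[OF \<omega>])
    then show ?case using C(1) r(2) by (intro exI[of _ C]) (simp add: mult.assoc mult.left_commute)
  qed
  \<comment> \<open>With exponent n + 1 the cofactor is constant, so h is homogeneous of degree n +
    1 as well as of degree n.\<close>
  from this[of "Suc n"] obtain r where r: "hpoly 0 r" "\<And>x. h x = of_real (x \<bullet> \<omega>) ^ Suc n * r x"
    by auto
  have "2 ^ n * h x = h (2 *\<^sub>R x)"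
    using hpoly_homogeneous[OF hp, of 2 x] by simp
  also have "\<dots> = 2 ^ Suc n * h x"
    unfolding r(2) hpoly_0_const[OF r(1), of "2 *\<^sub>R x" x] by (simp add: power_mult_distrib)
  finally show ?thesis by simp
qed

section \<open>Averages over segments that are symmetric in a hyperplane\<close>

lemma laplacian_squeeze:
  assumes p: "hpoly n p" and \<omega>: "norm \<omega> = 1"
  shows "laplacian (\<lambda>x. p (squeeze \<omega> s x)) x = laplacian p (squeeze \<omega> s x)
    + of_real (s\<^sup>2 - 1) * dderiv \<omega> (dderiv \<omega> p) (squeeze \<omega> s x)"
proof -
  let ?y = "squeeze \<omega> s x"
  note D = hpoly_dderiv_aux[OF p]
  have lin: "dderiv b (\<lambda>x. p (squeeze \<omega> s x)) = (\<lambda>x. dderiv (squeeze \<omega> s b) p (squeeze \<omega> s x))" for b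
    by (rule ext) (rule dderiv_linear[OF p linear_squeeze])
  have split: "dderiv (squeeze \<omega> s b) q x
      = dderiv b q x + of_real ((s - 1) * (b \<bullet> \<omega>)) * dderiv \<omega> q x" if "hpoly k q" for k q b x
    unfolding squeeze_def dderiv_plus[OF that] dderiv_scaleR[OF that] ..
  \<comment> \<open>Both derivatives are expanded along b + (s - 1) (b . \<omega>) \<omega>. Summed
    over b, the mixed and the pure terms contribute 2 (s - 1) + (s - 1)^2 = s^2 - 1.\<close>
  have "dderiv b (dderiv b (\<lambda>x. p (squeeze \<omega> s x))) x
      = dderiv b (dderiv b p) ?y
        + 2 * of_real (s - 1) * (of_real (\<omega> \<bullet> b) * dderiv b (dderiv \<omega> p) ?y)
        + of_real ((s - 1)\<^sup>2) * dderiv \<omega> (dderiv \<omega> p) ?y * of_real ((\<omega> \<bullet> b) * (\<omega> \<bullet> b))" for b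
  proof -
    have "dderiv b (dderiv b (\<lambda>x. p (squeeze \<omega> s x))) x
        = dderiv (squeeze \<omega> s b) (dderiv (squeeze \<omega> s b) p) ?y"
      unfolding lin by (rule dderiv_linear[OF D linear_squeeze])
    also have "dderiv (squeeze \<omega> s b) p = (\<lambda>x. dderiv b p x + of_real ((s - 1) * (b \<bullet> \<omega>)) * dderiv \<omega> p x)"
      by (rule ext) (rule split[OF p])
    finally show ?thesis
      unfolding dderiv_add[OF D hpoly_cmult[OF D]] dderiv_cmult[OF D] split[OF D]
        dderiv_commute[OF p, of \<omega> b]
      by (simp add: inner_commute[of b \<omega>] power2_eq_square algebra_simps)
  qed
  then have "laplacian (\<lambda>x. p (squeeze \<omega> s x)) x = laplacian p ?y
      + 2 * of_real (s - 1) * (\<Sum>b\<in>Basis. of_real (\<omega> \<bullet> b) * dderiv b (dderiv \<omega> p) ?y)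
      + of_real ((s - 1)\<^sup>2) * dderiv \<omega> (dderiv \<omega> p) ?y * of_real (\<Sum>b\<in>Basis. (\<omega> \<bullet> b) * (\<omega> \<bullet> b))"
    by (simp add: laplacian_hpoly[OF hpoly_linear[OF p linear_squeeze]] laplacian_hpoly[OF p]
        sum.distrib sum_distrib_left)
  also have "(\<Sum>b\<in>Basis. (\<omega> \<bullet> b) * (\<omega> \<bullet> b)) = 1"
    using \<omega> by (metis euclidean_inner norm_eq_1)
  finally show ?thesis
    unfolding dderiv_Basis[OF D] by (simp add: power2_eq_square algebra_simps)
qed

lemma harmonic_reflect:
  assumes "h \<in> harmonic_homogeneous n" "norm \<omega> = 1"
  shows "(\<lambda>x. h (squeeze \<omega> (-1) x)) \<in> harmonic_homogeneous n"
  using laplacian_squeeze[OF harmonic_hpoly[OF assms(1)] assms(2), of "-1"]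
    hpoly_linear[OF harmonic_hpoly[OF assms(1)] linear_squeeze]
  by (simp add: harmonic_homogeneous_iff harmonic_laplacian[OF assms(1)])

text \<open>The composition is polynomial in s, with coefficients homogeneous in x. Integrals over s
  thereby become finite sums, and derivatives pass through them without any limit argument.\<close>

lemma hpoly_squeeze_expand:
  assumes "hpoly n p" and \<omega>: "norm \<omega> = 1"
  shows "\<exists>c. (\<forall>k. hpoly n (c k)) \<and> (\<forall>k>n. c k = (\<lambda>x. 0)) \<and>
    (\<forall>s x. p (squeeze \<omega> s x) = (\<Sum>k\<le>n. of_real s ^ k * c k x))"
  using assms(1)
proof induction
  case (hpoly_const e)
  show ?case by (intro exI[of _ "\<lambda>k x. if k = 0 then e else 0"]) (auto simp: hpoly_zero hpoly.hpoly_const)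
next
  case (hpoly_inner_mult n p v)
  then obtain c where c: "\<And>k. hpoly n (c k)" "\<And>k. k > n \<Longrightarrow> c k = (\<lambda>x. 0)"
    "\<And>s x. p (squeeze \<omega> s x) = (\<Sum>k\<le>n. of_real s ^ k * c k x)" by blast
  \<comment> \<open>The part of v along \<omega>: squeezing multiplies its contribution by s and
    leaves that of the rest of v alone.\<close>
  let ?w = "(\<omega> \<bullet> v) *\<^sub>R \<omega>"
  let ?c = "\<lambda>k x. of_real (x \<bullet> (v - ?w)) * c k x
    + (if k = 0 then 0 else of_real (x \<bullet> ?w) * c (k - 1) x)"
  have "hpoly (Suc n) (\<lambda>x. if k = 0 then 0 else of_real (x \<bullet> ?w) * c (k - 1) x)" for k
    by (cases k) (simp_all add: hpoly_zero hpoly.hpoly_inner_mult[OF c(1)] del: inner_scaleR_right)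
  then have h1: "hpoly (Suc n) (?c k)" for k
    by (intro hpoly_add hpoly.hpoly_inner_mult c(1))
  have h2: "?c k = (\<lambda>x. 0)" if "k > Suc n" for k
  proof -
    have "k > n" "k - 1 > n" using that by auto
    then show ?thesis by (simp add: c(2))
  qed
  have h3: "of_real (squeeze \<omega> s x \<bullet> v) * p (squeeze \<omega> s x)
      = (\<Sum>k\<le>Suc n. of_real s ^ k * ?c k x)" for s x
  proof -
    have expand: "(A + of_real s * B) * (\<Sum>k\<le>n. of_real s ^ k * c k x)
        = (\<Sum>k\<le>n. of_real s ^ k * (A * c k x)) + (\<Sum>k\<le>n. of_real s ^ Suc k * (B * c k x))" for A B
      by (simp add: sum_distrib_left sum.distrib algebra_simps)
    have "squeeze \<omega> s x \<bullet> v = x \<bullet> (v - ?w) + s * (x \<bullet> ?w)"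
      by (simp add: squeeze_def inner_simps algebra_simps)
    then have "of_real (squeeze \<omega> s x \<bullet> v) * p (squeeze \<omega> s x)
       = (\<Sum>k\<le>n. of_real s ^ k * (of_real (x \<bullet> (v - ?w)) * c k x))
         + (\<Sum>k\<le>n. of_real s ^ Suc k * (of_real (x \<bullet> ?w) * c k x))"
      unfolding c(3) using expand by (simp only: of_real_add of_real_mult)
    also have "(\<Sum>k\<le>n. of_real s ^ k * (of_real (x \<bullet> (v - ?w)) * c k x))
        = (\<Sum>k\<le>Suc n. of_real s ^ k * (of_real (x \<bullet> (v - ?w)) * c k x))"
      by (simp add: c(2))
    also have "(\<Sum>k\<le>n. of_real s ^ Suc k * (of_real (x \<bullet> ?w) * c k x))
        = (\<Sum>k\<le>Suc n. of_real s ^ k * (if k = 0 then 0 else of_real (x \<bullet> ?w) * c (k - 1) x))"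
      by (simp add: sum.atMost_Suc_shift del: sum.atMost_Suc)
    finally show ?thesis by (simp only: sum.distrib distrib_left)
  qed
  show ?case by (intro exI[of _ ?c] conjI allI impI h1 h2 h3)
next
  case (hpoly_add n p q)
  from hpoly_add.IH obtain c e where c: "\<And>k. hpoly n (c k)" "\<And>k. k > n \<Longrightarrow> c k = (\<lambda>x. 0)"
      "\<And>s x. p (squeeze \<omega> s x) = (\<Sum>k\<le>n. of_real s ^ k * c k x)"
    and e: "\<And>k. hpoly n (e k)" "\<And>k. k > n \<Longrightarrow> e k = (\<lambda>x. 0)"
      "\<And>s x. q (squeeze \<omega> s x) = (\<Sum>k\<le>n. of_real s ^ k * e k x)" by blast
  have h1: "hpoly n (\<lambda>x. c k x + e k x)" for k
    by (rule hpoly.hpoly_add[OF c(1) e(1)])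
  have h2: "(\<lambda>x. c k x + e k x) = (\<lambda>x. 0)" if "k > n" for k
    using that by (simp add: c(2) e(2))
  have h3: "p (squeeze \<omega> s x) + q (squeeze \<omega> s x) = (\<Sum>k\<le>n. of_real s ^ k * (c k x + e k x))" for s x
    by (simp only: c(3) e(3) sum.distrib distrib_left)
  show ?case by (intro exI[of _ "\<lambda>k x. c k x + e k x"] conjI allI impI h1 h2 h3)
qed

text \<open>The mean of p over the segment from the mirror image of x to x. Its signed length is 2
  (x . \<omega>), so x . \<omega> times the mean is half the oriented integral.\<close>

definition avg :: "'a::euclidean_space \<Rightarrow> ('a \<Rightarrow> complex) \<Rightarrow> 'a \<Rightarrow> complex" where
  "avg \<omega> p x = integral {-1..1} (\<lambda>s. p (squeeze \<omega> s x)) / 2"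

lemma squeeze_integrable:
  assumes "hpoly n p"
  shows "(\<lambda>s. p (squeeze \<omega> s x)) integrable_on {a..b}"
proof -
  have "continuous_on {a..b} (\<lambda>s. p (squeeze \<omega> s x))"
    by (rule continuous_on_compose2[OF hpoly_continuous_on[OF assms, of UNIV]])
       (auto simp: squeeze_def intro!: continuous_intros)
  then show ?thesis by (rule integrable_continuous_real)
qed

lemma avg_orthogonal: "x \<bullet> \<omega> = 0 \<Longrightarrow> avg \<omega> p x = p x"
  by (simp add: avg_def squeeze_orthogonal scaleR_conv_of_real)

lemma avg_facts:
  fixes p :: "'a::euclidean_space \<Rightarrow> complex"
  assumes p: "hpoly n p" and \<omega>: "norm \<omega> = 1"
  shows hpoly_avg: "hpoly n (avg \<omega> p)"
    and dderiv_avg: "dderiv \<omega> (avg \<omega> p) x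
      = integral {-1..1} (\<lambda>s. of_real s * dderiv \<omega> p (squeeze \<omega> s x)) / 2"
    and laplacian_avg: "laplacian (avg \<omega> p) x = integral {-1..1} (\<lambda>s. laplacian p (squeeze \<omega> s x)
      + of_real (s\<^sup>2 - 1) * dderiv \<omega> (dderiv \<omega> p) (squeeze \<omega> s x)) / 2"
proof -
  obtain c where c: "\<And>k. hpoly n (c k)"
    "\<And>s x. p (squeeze \<omega> s x) = (\<Sum>k\<le>n. of_real s ^ k * c k x)"
    using hpoly_squeeze_expand[OF assms] by metis
  define I where "I k = integral {-1..1} (\<lambda>s. complex_of_real s ^ k) / 2" for k
  have int: "(\<lambda>s. complex_of_real s ^ k * z) integrable_on {-1..1}" for k z
    by (intro integrable_continuous_real continuous_intros)
  have sum_I: "integral {-1..1} (\<lambda>s. \<Sum>k\<le>n. of_real s ^ k * z k) / 2 = (\<Sum>k\<le>n. I k * z k)" for z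
    by (subst integral_sum) (simp_all add: int I_def sum_divide_distrib)
  have avg: "avg \<omega> p = (\<lambda>x. \<Sum>k\<le>n. I k * c k x)"
    by (rule ext) (simp add: avg_def c(2) sum_I)
  show "hpoly n (avg \<omega> p)"
    unfolding avg by (intro hpoly_sum hpoly_cmult c(1))
  have sq: "(\<lambda>x. p (squeeze \<omega> s x)) = (\<lambda>x. \<Sum>k\<le>n. of_real s ^ k * c k x)" for s
    by (rule ext) (rule c(2))
  have "of_real s * dderiv \<omega> p (squeeze \<omega> s x) = (\<Sum>k\<le>n. of_real s ^ k * dderiv \<omega> (c k) x)" for s
  proof -
    have "squeeze \<omega> s \<omega> = s *\<^sub>R \<omega>"
      using \<omega> by (simp add: squeeze_def dot_square_norm algebra_simps)
    then have "of_real s * dderiv \<omega> p (squeeze \<omega> s x) = dderiv \<omega> (\<lambda>x. p (squeeze \<omega> s x)) x"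
      by (simp add: dderiv_linear[OF p linear_squeeze] dderiv_scaleR[OF p])
    then show ?thesis
      unfolding sq by (simp add: dderiv_sum[OF hpoly_cmult[OF c(1)]] dderiv_cmult[OF c(1)])
  qed
  then show "dderiv \<omega> (avg \<omega> p) x
      = integral {-1..1} (\<lambda>s. of_real s * dderiv \<omega> p (squeeze \<omega> s x)) / 2"
    by (simp add: sum_I avg dderiv_sum[OF hpoly_cmult[OF c(1)]] dderiv_cmult[OF c(1)])
  have "laplacian p (squeeze \<omega> s x) + of_real (s\<^sup>2 - 1) * dderiv \<omega> (dderiv \<omega> p) (squeeze \<omega> s x)
      = (\<Sum>k\<le>n. of_real s ^ k * laplacian (c k) x)" for s
    unfolding laplacian_squeeze[OF assms, symmetric] sq
    by (simp add: laplacian_sum[OF hpoly_cmult[OF c(1)]] laplacian_cmult[OF c(1)])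
  then show "laplacian (avg \<omega> p) x = integral {-1..1} (\<lambda>s. laplacian p (squeeze \<omega> s x)
      + of_real (s\<^sup>2 - 1) * dderiv \<omega> (dderiv \<omega> p) (squeeze \<omega> s x)) / 2"
    by (simp only: sum_I avg laplacian_sum[OF hpoly_cmult[OF c(1)]] laplacian_cmult[OF c(1)])
qed

text \<open>The terms by which the two sides differ combine to the integral over s of the derivative
  of (s^2 - 1) D p, where D p is the derivative along \<omega> at
  \<open>squeeze \<omega> s x\<close>. The factor s^2 - 1 vanishes at both ends.\<close>

lemma laplacian_inner_mult_avg:
  assumes p: "hpoly n p" and \<omega>: "norm \<omega> = 1"
  shows "laplacian (\<lambda>x. of_real (x \<bullet> \<omega>) * avg \<omega> p x) x = of_real (x \<bullet> \<omega>) * avg \<omega> (laplacian p) x"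
proof -
  let ?t = "x \<bullet> \<omega>"
  let ?D = "dderiv \<omega> p" and ?DD = "dderiv \<omega> (dderiv \<omega> p)"
  let ?S = "\<lambda>s. squeeze \<omega> s x"
  note Dp = hpoly_dderiv_aux[OF p] and DDp = hpoly_dderiv_aux[OF hpoly_dderiv_aux[OF p]]
  have cont: "continuous_on {-1..1} (\<lambda>s. q (?S s))" if "hpoly k q" for k q
    by (rule continuous_on_compose2[OF hpoly_continuous_on[OF that, of UNIV]])
       (auto simp: squeeze_def intro!: continuous_intros)
  have der: "((\<lambda>s. of_real (s\<^sup>2 - 1) * ?D (?S s)) has_vector_derivative
      (of_real ?t * (of_real (s\<^sup>2 - 1) * ?DD (?S s)) + 2 * (of_real s * ?D (?S s)))) (at s within {-1..1})" for s
  proof -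
    have "((\<lambda>s. ?S s) has_derivative (\<lambda>h. h *\<^sub>R (?t *\<^sub>R \<omega>))) (at s)"
      unfolding squeeze_def by (auto intro!: derivative_eq_intros)
    from has_derivative_compose[OF this hpoly_has_derivative[OF Dp]]
    have "((\<lambda>s. ?D (?S s)) has_vector_derivative of_real ?t * ?DD (?S s)) (at s)"
      by (simp add: has_vector_derivative_def dderiv_scaleR[OF Dp] scaleR_conv_of_real mult.assoc)
    moreover have "((\<lambda>s. of_real (s\<^sup>2 - 1) :: complex) has_vector_derivative of_real (2 * s)) (at s)"
      by (rule has_vector_derivative_of_real) (auto intro!: derivative_eq_intros simp: has_real_derivative_iff_has_vector_derivative[symmetric])
    ultimately have "((\<lambda>s. of_real (s\<^sup>2 - 1) * ?D (?S s)) has_vector_derivative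
      (of_real (s\<^sup>2 - 1) * (of_real ?t * ?DD (?S s)) + of_real (2 * s) * ?D (?S s))) (at s)"
      by (rule has_vector_derivative_mult[rotated])
    moreover have "of_real (s\<^sup>2 - 1) * (of_real ?t * ?DD (?S s)) + of_real (2 * s) * ?D (?S s)
        = of_real ?t * (of_real (s\<^sup>2 - 1) * ?DD (?S s)) + 2 * (of_real s * ?D (?S s))"
      by (simp add: mult_ac)
    ultimately show ?thesis
      by (simp only: has_vector_derivative_at_within)
  qed
  have "((\<lambda>s. of_real ?t * (of_real (s\<^sup>2 - 1) * ?DD (?S s)) + 2 * (of_real s * ?D (?S s))) has_integral
      (of_real (1\<^sup>2 - 1) * ?D (?S 1) - of_real ((-1)\<^sup>2 - 1) * ?D (?S (-1)))) {-1..1}"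
    by (rule fundamental_theorem_of_calculus[OF _ der]) simp
  then have 0: "((\<lambda>s. of_real ?t * (of_real (s\<^sup>2 - 1) * ?DD (?S s)) + 2 * (of_real s * ?D (?S s))) has_integral 0) {-1..1}"
    by simp
  have i1: "(\<lambda>s. laplacian p (?S s)) integrable_on {-1..1}"
    by (rule squeeze_integrable[OF hpoly_laplacian[OF p refl]])
  have i2: "(\<lambda>s. of_real (s\<^sup>2 - 1) * ?DD (?S s)) integrable_on {-1..1}"
    by (intro integrable_continuous_real continuous_intros cont[OF DDp])
  have i3: "(\<lambda>s. of_real s * ?D (?S s)) integrable_on {-1..1}"
    by (intro integrable_continuous_real continuous_intros cont[OF Dp])
  have "of_real ?t * integral {-1..1} (\<lambda>s. of_real (s\<^sup>2 - 1) * ?DD (?S s))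
      + 2 * integral {-1..1} (\<lambda>s. of_real s * ?D (?S s)) = 0"
    using has_integral_unique[OF 0 has_integral_add[OF
        has_integral_mult_right[OF integrable_integral[OF i2]]
        has_integral_mult_right[OF integrable_integral[OF i3]]]] by simp
  moreover have "T * ((A + B) / 2) + 2 * (C / 2) = T * (A / 2) + (T * B + 2 * C) / 2" for T A B C :: complex
    by (simp add: field_simps)
  ultimately show ?thesis
    unfolding laplacian_inner_mult[OF hpoly_avg[OF assms]] dderiv_avg[OF assms] laplacian_avg[OF assms]
      integral_add[OF i1 i2] avg_def[of \<omega> "laplacian p"] by simp
qed

section \<open>Integration over the sphere\<close>

lemma scale_measure_eq_density: "scale_measure r M = density M (\<lambda>_. r)"
  by (rule measure_eqI) (simp_all add: emeasure_density_const)

lemma lborel_integral_scale: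
  fixes F :: "'a::euclidean_space \<Rightarrow> complex"
  assumes [measurable]: "F \<in> borel_measurable borel" and "\<rho> > 0"
  shows "(LINT x|lborel. F x) = \<rho> ^ DIM('a) *\<^sub>R (LINT x|lborel. F (\<rho> *\<^sub>R x))"
proof -
  have "(LINT x|lborel. F x)
      = integral\<^sup>L (density (distr lborel borel (\<lambda>x. 0 + \<rho> *\<^sub>R x)) (\<lambda>_. \<bar>\<rho>\<bar> ^ DIM('a))) F"
    by (subst lborel_affine[of \<rho> 0]) (use assms in auto)
  also have "\<dots> = (LINT x|lborel. \<rho> ^ DIM('a) *\<^sub>R F (\<rho> *\<^sub>R x))"
    using assms(2) by (simp add: integral_density integral_distr)
  finally show ?thesis by simp
qed

lemma set_integrable_cball:
  fixes F :: "'a::euclidean_space \<Rightarrow> complex"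
  assumes "F \<in> borel_measurable borel" "\<And>x. x \<in> cball 0 r \<Longrightarrow> norm (F x) \<le> M"
  shows "set_integrable lborel (cball 0 r) F"
  unfolding set_integrable_def
  by (rule integrableI_bounded_set_indicator[where B = M])
     (use assms emeasure_lborel_cball_finite[of "0::'a" r] in auto)

lemma set_integral_cball_scale:
  fixes F :: "'a::euclidean_space \<Rightarrow> complex"
  assumes F: "F \<in> borel_measurable borel" and "\<rho> > 0"
    and hom: "\<And>x. F (\<rho> *\<^sub>R x) = of_real (\<rho> ^ N) * F x"
  shows "(LINT x:cball 0 \<rho>|lborel. F x) = of_real (\<rho> ^ (N + DIM('a))) * (LINT x:cball 0 1|lborel. F x)"
proof -
  note F [measurable]
  have [measurable]: "cball (0::'a) \<rho> \<in> sets borel" by simp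
  have "(LINT x:cball 0 \<rho>|lborel. F x)
      = \<rho> ^ DIM('a) *\<^sub>R (LINT x|lborel. indicator (cball 0 \<rho>) (\<rho> *\<^sub>R x) *\<^sub>R F (\<rho> *\<^sub>R x))"
    unfolding set_lebesgue_integral_def
    by (rule lborel_integral_scale[OF _ assms(2)]) measurable
  also have "(\<lambda>x. indicator (cball 0 \<rho>) (\<rho> *\<^sub>R x) *\<^sub>R F (\<rho> *\<^sub>R x))
      = (\<lambda>x. of_real (\<rho> ^ N) * (indicator (cball (0::'a) 1) x *\<^sub>R F x))"
    using assms(2) by (auto simp: fun_eq_iff hom indicator_def)
  finally show ?thesis
    by (simp add: set_lebesgue_integral_def scaleR_conv_of_real power_add)
qed

lemma sphere_integral_eq:
  fixes f :: "'a::euclidean_space \<Rightarrow> complex"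
  assumes [measurable]: "f \<in> borel_measurable borel"
  shows "(LINT \<xi>|sphere_measure. f \<xi>) = of_nat DIM('a) * (LINT x:cball 0 1|lborel. f (x /\<^sub>R norm x))"
proof -
  have f: "f \<in> borel_measurable (restrict_space borel (sphere 0 1))"
    by (rule measurable_restrict_space1) measurable
  have "(LINT \<xi>|sphere_measure. f \<xi>) = real DIM('a) *\<^sub>R
      (LINT x|restrict_space lborel (cball 0 1 - {0}). f (x /\<^sub>R norm x))"
    unfolding sphere_measure_def scale_measure_eq_density
    by (subst integral_density) (use f in \<open>simp_all add: integral_distr[OF normalize_measurable f]\<close>)
  also have "(LINT x|restrict_space lborel (cball 0 1 - {0}). f (x /\<^sub>R norm x))
      = (LINT x|lborel. indicator (cball 0 1 - {0}) x *\<^sub>R f (x /\<^sub>R norm x))"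
    by (rule integral_restrict_space) auto
  \<comment> \<open>The origin, which \<open>sphere_measure\<close> leaves out, is a null
    set.\<close>
  also have "\<dots> = (LINT x:cball 0 1|lborel. f (x /\<^sub>R norm x))"
    unfolding set_lebesgue_integral_def
  proof (rule integral_cong_AE)
    show "AE x in lborel. indicator (cball 0 1 - {0}) x *\<^sub>R f (x /\<^sub>R norm x) = indicator (cball 0 1) x *\<^sub>R f (x /\<^sub>R norm x)"
      using AE_lborel_singleton[of 0] by eventually_elim (auto simp: indicator_def)
    have "(\<lambda>x. f (x /\<^sub>R norm x)) \<in> borel_measurable borel" by measurable
    then show "(\<lambda>x. indicat_real (cball 0 1 - {0}) x *\<^sub>R f (x /\<^sub>R norm x)) \<in> borel_measurable lborel"
      "(\<lambda>x. indicat_real (cball 0 1) x *\<^sub>R f (x /\<^sub>R norm x)) \<in> borel_measurable lborel"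
      unfolding measurable_lborel1
      by (auto intro!: borel_measurable_scaleR borel_measurable_indicator)
  qed
  finally show ?thesis by (simp add: scaleR_conv_of_real)
qed

lemma hpoly_borel_measurable: "hpoly n p \<Longrightarrow> p \<in> borel_measurable borel"
  by (intro borel_measurable_continuous_onI hpoly_continuous_on)

lemma hpoly_bounded:
  fixes p :: "'a::euclidean_space \<Rightarrow> complex"
  assumes "hpoly n p"
  obtains M where "M \<ge> 0" "\<And>x. x \<in> cball 0 1 \<Longrightarrow> norm (p x) \<le> M"
proof -
  have "bounded (p ` cball 0 1)"
    by (intro compact_imp_bounded compact_continuous_image hpoly_continuous_on[OF assms]) simp
  then obtain M where "\<forall>y\<in>p ` cball 0 1. norm y \<le> M" unfolding bounded_iff ..
  then have M: "norm (p x) \<le> M" if "x \<in> cball 0 1" for x using that by simp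
  have "M \<ge> 0" by (rule order_trans[OF norm_ge_zero M[of 0]]) simp
  then show ?thesis using M that by blast
qed

text \<open>Polar coordinates for homogeneous integrands, by comparing the integrals of \<open>q\<close> and of its
  degree-0 extension \<open>h\<close> over thin shells \<open>\<rho> < norm x \<le> 1\<close>.\<close>

lemma ball_integral_hpoly:
  fixes q :: "'a::euclidean_space \<Rightarrow> complex"
  assumes q: "hpoly N q"
  shows "of_nat (N + DIM('a)) * (LINT x:cball 0 1|lborel. q x) = (LINT \<xi>|sphere_measure. q \<xi>)"
proof -
  let ?d = "DIM('a)"
  define h where "h x = q (x /\<^sub>R norm x)" for x
  define A where "A = (LINT x:cball 0 1|lborel. q x)"
  define B where "B = (LINT x:cball 0 1|lborel. h x)"
  define V where "V = measure lborel (cball (0::'a) 1)"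
  \<comment> \<open>The quotient (1 - \<rho>^k) / (1 - \<rho>) as a geometric sum, whose limit for
    \<rho> to 1 is k.\<close>
  define S where "S k \<rho> = (\<Sum>i<k. \<rho> ^ i)" for k and \<rho> :: real
  have qm [measurable]: "q \<in> borel_measurable borel" by (rule hpoly_borel_measurable[OF q])
  have hm [measurable]: "h \<in> borel_measurable borel"
    unfolding h_def by measurable
  obtain M where M: "M \<ge> 0" "\<And>x. x \<in> cball 0 1 \<Longrightarrow> norm (q x) \<le> M"
    using hpoly_bounded[OF q] by blast
  have hM: "norm (h x) \<le> M" for x
    unfolding h_def by (rule M(2)) (simp add: norm_inverse_le_norm divide_simps)
  have qh: "q x = of_real (norm x ^ N) * h x" for x
    using hpoly_homogeneous[OF q, of "norm x" "x /\<^sub>R norm x"] by (cases "x = 0") (auto simp: h_def)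
  \<comment> \<open>On the shell q and h differ by at most M (1 - \<rho>^N), and the volume of the
    shell is of order 1 - \<rho>. So the difference of the two integrals tends to 0 even after
    division by 1 - \<rho>.\<close>
  have key: "norm (of_real (S (N + ?d) \<rho>) * A - of_real (S ?d \<rho>) * B) \<le> M * (S N \<rho> * (1 - \<rho>)) * (S ?d \<rho> * V)"
    if \<rho>: "0 < \<rho>" "\<rho> < 1" for \<rho>
  proof -
    have pow: "1 - \<rho> ^ k = (1 - \<rho>) * S k \<rho>" for k
      unfolding S_def by (rule one_diff_power_eq)
    have sub: "cball (0::'a) \<rho> \<subseteq> cball 0 1" using \<rho> by auto
    have iq: "set_integrable lborel (cball 0 1) q" "set_integrable lborel (cball 0 \<rho>) q"
      using sub M by (auto intro!: set_integrable_cball[where M = M] qm)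
    have ih: "set_integrable lborel (cball 0 1) h" "set_integrable lborel (cball 0 \<rho>) h"
      using hM by (auto intro!: set_integrable_cball[where M = M] hm)
    have q\<rho>: "(LINT x:cball 0 \<rho>|lborel. q x) = of_real (\<rho> ^ (N + ?d)) * A"
      unfolding A_def by (rule set_integral_cball_scale[OF qm \<rho>(1) hpoly_homogeneous[OF q]])
    have "(\<rho> *\<^sub>R x) /\<^sub>R norm (\<rho> *\<^sub>R x) = x /\<^sub>R norm x" for x :: 'a
      using \<rho> by (cases "x = 0") (auto simp: field_simps)
    then have "h (\<rho> *\<^sub>R x) = h x" for x
      by (simp only: h_def)
    then have h\<rho>: "(LINT x:cball 0 \<rho>|lborel. h x) = of_real (\<rho> ^ ?d) * B"
      unfolding B_def using set_integral_cball_scale[OF hm \<rho>(1), of 0] by simp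
    let ?D = "\<lambda>x. (indicator (cball 0 1) x *\<^sub>R q x - indicator (cball 0 \<rho>) x *\<^sub>R q x)
        - (indicator (cball 0 1) x *\<^sub>R h x - indicator (cball 0 \<rho>) x *\<^sub>R h x)"
    let ?m = "\<lambda>x::'a. M * (1 - \<rho> ^ N) * (indicator (cball 0 1) x - indicator (cball 0 \<rho>) x)"
    have D: "of_real (1 - \<rho> ^ (N + ?d)) * A - of_real (1 - \<rho> ^ ?d) * B = (LINT x|lborel. ?D x)"
    proof -
      have "(LINT x|lborel. ?D x) = (A - (LINT x:cball 0 \<rho>|lborel. q x)) - (B - (LINT x:cball 0 \<rho>|lborel. h x))"
        using iq ih unfolding A_def B_def set_lebesgue_integral_def set_integrable_def by simp
      then show ?thesis unfolding q\<rho> h\<rho> by (simp add: algebra_simps)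
    qed
    have fin: "emeasure lborel (cball (0::'a) r) < \<infinity>" for r
      by (rule emeasure_lborel_cball_finite)
    have int_i: "integrable lborel (indicator (cball (0::'a) r) :: 'a \<Rightarrow> real)" for r
      using fin[of r] by simp
    have bound: "norm (?D x) \<le> ?m x" for x
    proof (cases "x \<in> cball 0 1 - cball 0 \<rho>")
      case True
      then have n: "\<rho> \<le> norm x" "norm x \<le> 1" by auto
      have "?D x = of_real (norm x ^ N - 1) * h x"
        using True by (simp add: qh indicator_def algebra_simps)
      then have "norm (?D x) = \<bar>norm x ^ N - 1\<bar> * norm (h x)"
        by (simp only: norm_mult norm_of_real)
      also have "\<dots> \<le> (1 - \<rho> ^ N) * M"
      proof (rule mult_mono)
        have "\<rho> ^ N \<le> norm x ^ N" "norm x ^ N \<le> 1"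
          using n \<rho> by (auto intro: power_mono power_le_one)
        then show "\<bar>norm x ^ N - 1\<bar> \<le> 1 - \<rho> ^ N" by simp
        show "0 \<le> 1 - \<rho> ^ N" using \<rho> by (simp add: power_le_one)
      qed (use hM in auto)
      finally show ?thesis using True by (simp add: indicator_def mult.commute)
    next
      case False
      then have "indicator (cball 0 1) x = (indicator (cball 0 \<rho>) x :: real)"
        using \<rho> by (auto simp: indicator_def)
      then show ?thesis by simp
    qed
    have "norm (LINT x|lborel. ?D x) \<le> (LINT x|lborel. ?m x)"
    proof (rule Bochner_Integration.integral_norm_bound_integral)
      show "integrable lborel ?D"
        using iq ih unfolding set_integrable_def by (intro Bochner_Integration.integrable_diff)
      show "integrable lborel ?m"
        by (intro integrable_mult_right Bochner_Integration.integrable_diff int_i)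
    qed (rule bound)
    also have "(LINT x|lborel. ?m x) = M * (1 - \<rho> ^ N) * (V - measure lborel (cball (0::'a) \<rho>))"
      using int_i by (simp add: V_def)
    also have "measure lborel (cball (0::'a) \<rho>) = \<rho> ^ ?d * V"
      using \<rho> by (simp add: V_def content_cball)
    finally have "norm (of_real (1 - \<rho> ^ (N + ?d)) * A - of_real (1 - \<rho> ^ ?d) * B)
        \<le> M * (1 - \<rho> ^ N) * ((1 - \<rho> ^ ?d) * V)"
      unfolding D by (simp add: algebra_simps)
    also have "of_real (1 - \<rho> ^ (N + ?d)) * A - of_real (1 - \<rho> ^ ?d) * B
        = of_real (1 - \<rho>) * (of_real (S (N + ?d) \<rho>) * A - of_real (S ?d \<rho>) * B)"
      unfolding pow by (simp add: algebra_simps)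
    also have "norm \<dots> = (1 - \<rho>) * norm (of_real (S (N + ?d) \<rho>) * A - of_real (S ?d \<rho>) * B)"
      using \<rho> by (simp add: norm_mult del: of_real_diff)
    also have "M * (1 - \<rho> ^ N) * ((1 - \<rho> ^ ?d) * V) = (1 - \<rho>) * (M * (S N \<rho> * (1 - \<rho>)) * (S ?d \<rho> * V))"
      unfolding pow by (simp add: algebra_simps)
    finally show ?thesis using \<rho> by (simp only: mult_le_cancel_left_pos diff_gt_0_iff_gt)
  qed
  have tS: "(S k \<longlongrightarrow> S k 1) (at_left 1)" for k
    unfolding S_def by (intro tendsto_intros)
  have S1: "S k 1 = real k" for k by (simp add: S_def)
  have lim0: "((\<lambda>\<rho>. of_real (S (N + ?d) \<rho>) * A - of_real (S ?d \<rho>) * B) \<longlongrightarrow> 0) (at_left 1)"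
  proof (rule Lim_null_comparison)
    show "\<forall>\<^sub>F \<rho> in at_left 1. norm (of_real (S (N + ?d) \<rho>) * A - of_real (S ?d \<rho>) * B)
        \<le> M * (S N \<rho> * (1 - \<rho>)) * (S ?d \<rho> * V)"
      by (rule eventually_mono[OF eventually_at_left_real[of 0 1]]) (use key in auto)
    have "((\<lambda>\<rho>. M * (S N \<rho> * (1 - \<rho>)) * (S ?d \<rho> * V)) \<longlongrightarrow> M * (S N 1 * (1 - 1)) * (S ?d 1 * V)) (at_left 1)"
      by (intro tendsto_intros tS)
    then show "((\<lambda>\<rho>. M * (S N \<rho> * (1 - \<rho>)) * (S ?d \<rho> * V)) \<longlongrightarrow> 0) (at_left 1)" by simp
  qed
  have "((\<lambda>\<rho>. of_real (S (N + ?d) \<rho>) * A - of_real (S ?d \<rho>) * B)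
      \<longlongrightarrow> of_real (S (N + ?d) 1) * A - of_real (S ?d 1) * B) (at_left 1)"
    by (intro tendsto_intros tS)
  then have "of_real (S (N + ?d) 1) * A - of_real (S ?d 1) * B = 0"
    by (rule tendsto_unique[OF trivial_limit_at_left_real _ lim0])
  then have "of_nat (N + ?d) * A = of_nat ?d * B" unfolding S1 by simp
  also have "\<dots> = (LINT \<xi>|sphere_measure. q \<xi>)"
    unfolding B_def h_def sphere_integral_eq[OF qm] ..
  finally show ?thesis unfolding A_def .
qed

text \<open>Difference quotients of g integrate to 0 by translation invariance, and they converge to
  g' under a common integrable bound.\<close>

lemma integral_directional_derivative_0:
  fixes g :: "'a::euclidean_space \<Rightarrow> complex"
  assumes [measurable]: "g \<in> borel_measurable borel" "g' \<in> borel_measurable borel"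
    and der: "\<And>x s. ((\<lambda>t. g (x + t *\<^sub>R v)) has_vector_derivative g' (x + s *\<^sub>R v)) (at s)"
    and C: "\<And>x. norm (g' x) \<le> C" and M: "\<And>x. norm (g x) \<le> M"
    and supp: "\<And>x. norm x > 1 \<Longrightarrow> g x = 0"
  shows "(LINT x|lborel. g' x) = 0"
proof -
  define e where "e n = inverse (real (Suc n))" for n
  have e: "e n > 0" "e n \<le> 1" for n by (simp_all add: e_def field_simps)
  define f where "f n x = (g (x + e n *\<^sub>R v) - g x) /\<^sub>R e n" for n x
  have [measurable]: "f n \<in> borel_measurable borel" for n
    unfolding f_def by measurable
  have C0: "C \<ge> 0" using C[of 0] norm_ge_zero order_trans by blast
  have ig: "integrable lborel g"
  proof -
    have "(\<lambda>x. indicator (cball 0 1) x *\<^sub>R g x) = g"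
      using supp by (auto simp: fun_eq_iff indicator_def)
    then show ?thesis
      using set_integrable_cball[of g 1 M] M unfolding set_integrable_def by simp
  qed
  have translate: "integrable lborel (\<lambda>x. g (x + c))" "(LINT x|lborel. g (x + c)) = (LINT x|lborel. g x)" for c
  proof -
    have "integrable (distr lborel borel ((+) c)) g" using ig by (simp add: lborel_distr_plus)
    then show "integrable lborel (\<lambda>x. g (x + c))"
      by (subst (asm) integrable_distr_eq) (simp_all add: add.commute)
    have "integral\<^sup>L (distr lborel borel ((+) c)) g = (LINT x|lborel. g (c + x))"
      by (rule integral_distr) measurable
    then show "(LINT x|lborel. g (x + c)) = (LINT x|lborel. g x)"
      by (simp add: lborel_distr_plus add.commute)
  qed
  have "(LINT x|lborel. f n x) = 0" for n
    unfolding f_def using ig translate by simp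
  moreover have "(\<lambda>n. LINT x|lborel. f n x) \<longlonglongrightarrow> (LINT x|lborel. g' x)"
  proof (rule integral_dominated_convergence)
    \<comment> \<open>The mean value inequality bounds every quotient by C, and steps of size at
      most 1 move the support by at most \<open>norm v\<close>.\<close>
    show "integrable lborel (\<lambda>x. C * indicator (cball (0::'a) (1 + norm v)) x)"
      by (intro integrable_mult_right) (use emeasure_lborel_cball_finite[of "0::'a" "1 + norm v"] in simp)
    show "AE x in lborel. (\<lambda>n. f n x) \<longlonglongrightarrow> g' x"
    proof (rule AE_I2)
      fix x
      have "((\<lambda>t. g (x + t *\<^sub>R v)) has_vector_derivative g' x) (at 0)"
        using der[of x 0] by simp
      then have "((\<lambda>h. norm (g (x + h *\<^sub>R v) - g x - h *\<^sub>R g' x) / \<bar>h\<bar>) \<longlongrightarrow> 0) (at 0)"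
        by (simp add: has_vector_derivative_def has_derivative_at)
      then have "((\<lambda>h. norm ((g (x + h *\<^sub>R v) - g x) /\<^sub>R h - g' x)) \<longlongrightarrow> 0) (at 0)"
      proof (rule LIM_cong[OF refl _ refl, THEN iffD1, rotated])
        show "norm (g (x + h *\<^sub>R v) - g x - h *\<^sub>R g' x) / \<bar>h\<bar>
          = norm ((g (x + h *\<^sub>R v) - g x) /\<^sub>R h - g' x)" if "h \<noteq> 0" for h
        proof -
          have "g (x + h *\<^sub>R v) - g x - h *\<^sub>R g' x = h *\<^sub>R ((g (x + h *\<^sub>R v) - g x) /\<^sub>R h - g' x)"
            using that by (simp add: scaleR_diff_right)
          then show ?thesis using that by (simp del: scaleR_diff_right)
        qed
      qed
      then have "((\<lambda>h. (g (x + h *\<^sub>R v) - g x) /\<^sub>R h) \<longlongrightarrow> g' x) (at 0)"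
        by (rule LIM_zero_cancel[OF tendsto_norm_zero_cancel])
      moreover have "filterlim e (at 0) sequentially"
        unfolding filterlim_at e_def using LIMSEQ_inverse_real_of_nat by auto
      ultimately show "(\<lambda>n. f n x) \<longlonglongrightarrow> g' x"
        unfolding f_def by (rule filterlim_compose)
    qed
    show "AE x in lborel. norm (f n x) \<le> C * indicator (cball 0 (1 + norm v)) x" for n
    proof (rule AE_I2)
      fix x
      have d: "((\<lambda>t. g (x + t *\<^sub>R v)) has_derivative (\<lambda>h. h *\<^sub>R g' (x + s *\<^sub>R v))) (at s)" for s
        using der[of x s] by (simp add: has_vector_derivative_def)
      have "\<exists>s\<in>{0<..<e n}. norm (g (x + e n *\<^sub>R v) - g (x + 0 *\<^sub>R v)) \<le> norm ((e n - 0) *\<^sub>R g' (x + s *\<^sub>R v))"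
      proof (rule mvt_general[where f = "\<lambda>t. g (x + t *\<^sub>R v)"
            and f' = "\<lambda>s h. h *\<^sub>R g' (x + s *\<^sub>R v)"])
        show "continuous_on {0..e n} (\<lambda>t. g (x + t *\<^sub>R v))"
          by (rule has_derivative_continuous_on[OF has_derivative_at_withinI[OF d]])
      qed (use e(1) d in auto)
      then obtain s where "norm (g (x + e n *\<^sub>R v) - g x) \<le> norm (e n *\<^sub>R g' (x + s *\<^sub>R v))" by auto
      also have "\<dots> \<le> e n * C" using e(1)[of n] C by simp
      finally have 1: "norm (f n x) \<le> C"
        using e(1)[of n] unfolding f_def norm_scaleR by (simp add: divide_simps mult.commute)
      have 2: "f n x = 0" if "norm x > 1 + norm v"
      proof -
        have "norm (e n *\<^sub>R v) \<le> norm v" using e[of n] by (simp add: mult_left_le_one_le)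
        then have "norm (x + e n *\<^sub>R v) > 1"
          using that norm_diff_ineq[of x "e n *\<^sub>R v"] by simp
        moreover have "norm x > 1" using that norm_ge_zero[of v] by linarith
        ultimately show ?thesis by (simp add: f_def supp)
      qed
      show "norm (f n x) \<le> C * indicator (cball 0 (1 + norm v)) x"
        using 1 2 by (auto simp: indicator_def)
    qed
  qed measurable
  ultimately show ?thesis by (simp add: LIMSEQ_const_iff)
qed

text \<open>Squaring smooths the corner at 0, so that the cut-off below is differentiable across the
  sphere.\<close>

lemma has_real_derivative_max_0_sq: "((\<lambda>u. (max 0 u)\<^sup>2) has_real_derivative 2 * max 0 u) (at u)" for u :: real
proof -
  consider "u > 0" | "u < 0" | "u = 0" by linarith
  then show ?thesis
  proof cases
    case 1
    have "((\<lambda>u. u\<^sup>2) has_real_derivative 2 * max 0 u) (at u)"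
      using 1 by (auto intro!: derivative_eq_intros)
    moreover have "\<forall>\<^sub>F v in nhds u. (max 0 v)\<^sup>2 = v\<^sup>2"
      using eventually_nhds_in_open[of "{0<..}" u] 1 by (auto elim!: eventually_mono)
    ultimately show ?thesis by (subst DERIV_cong_ev[OF refl _ refl])
  next
    case 2
    have "((\<lambda>u. 0) has_real_derivative 2 * max 0 u) (at u)"
      using 2 by (auto intro!: derivative_eq_intros)
    moreover have "\<forall>\<^sub>F v in nhds u. (max 0 v)\<^sup>2 = 0"
      using eventually_nhds_in_open[of "{..<0}" u] 2 by (auto elim!: eventually_mono)
    ultimately show ?thesis by (subst DERIV_cong_ev[OF refl _ refl])
  next
    case 3
    have "((\<lambda>h. (max 0 h)\<^sup>2 / h) \<longlongrightarrow> 0) (at (0::real))"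
    proof (rule Lim_null_comparison)
      show "\<forall>\<^sub>F h in at (0::real). norm ((max 0 h)\<^sup>2 / h) \<le> \<bar>h\<bar>"
        by (rule always_eventually) (auto simp: max_def power2_eq_square)
      show "((\<lambda>h::real. \<bar>h\<bar>) \<longlongrightarrow> 0) (at 0)" by (intro tendsto_rabs_zero tendsto_ident_at)
    qed
    then show ?thesis using 3 by (simp add: DERIV_def)
  qed
qed

text \<open>The divergence theorem on the sphere, obtained by testing with the cut-off
  \<open>(max 0 (1 - x \<bullet> x))\<^sup>2\<close>.\<close>

lemma sphere_integral_dderiv:
  fixes q :: "'a::euclidean_space \<Rightarrow> complex"
  assumes q: "hpoly n q"
  shows "(LINT \<xi>|sphere_measure. dderiv v q \<xi>)
    = of_nat (n + DIM('a) - 1) * (LINT \<xi>|sphere_measure. of_real (\<xi> \<bullet> v) * q \<xi>)"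
proof -
  define K where "K = n + DIM('a) - 1"
  have K: "K + 1 = n + DIM('a)" using DIM_positive[where 'a = 'a] unfolding K_def by linarith
  define w where "w x = max 0 (1 - x \<bullet> x)" for x :: 'a
  define g where "g x = of_real ((w x)\<^sup>2) * q x" for x
  define g' where "g' x = of_real ((w x)\<^sup>2) * dderiv v q x + of_real (- 4 * w x * (x \<bullet> v)) * q x" for x
  note cq = hpoly_continuous_on[OF q] and cD = hpoly_continuous_on[OF hpoly_dderiv_aux[OF q]]
  have cg: "continuous_on UNIV g" unfolding g_def w_def by (intro continuous_intros cq)
  have cg': "continuous_on UNIV g'" unfolding g'_def w_def by (intro continuous_intros cq cD)
  have supp: "g x = 0" "g' x = 0" if "norm x > 1" for x
  proof -
    have "1 < norm x * norm x" using that by (simp add: less_1_mult)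
    then have "w x = 0" by (simp add: w_def dot_square_norm power2_eq_square)
    then show "g x = 0" "g' x = 0" by (simp_all add: g_def g'_def)
  qed
  have bdd: "\<exists>C. \<forall>x. norm (f x) \<le> C"
    if f: "continuous_on UNIV f" "\<And>x. norm x > 1 \<Longrightarrow> f x = 0" for f :: "'a \<Rightarrow> complex"
  proof -
    have "bounded (f ` cball 0 1)"
      by (intro compact_imp_bounded compact_continuous_image continuous_on_subset[OF f(1)]) auto
    then obtain C where "\<forall>y\<in>f ` cball 0 1. norm y \<le> C" unfolding bounded_iff ..
    then have C: "norm (f x) \<le> C" if "x \<in> cball 0 1" for x using that by simp
    have "norm (f x) \<le> max C 0" for x
      using C[of x] f(2)[of x] by (cases "norm x > 1") auto
    then show ?thesis by blast
  qed
  obtain C where C: "\<And>x. norm (g' x) \<le> C" using bdd[OF cg' supp(2)] by blast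
  obtain M where M: "\<And>x. norm (g x) \<le> M" using bdd[OF cg supp(1)] by blast
  have der: "((\<lambda>t. g (x + t *\<^sub>R v)) has_vector_derivative g' (x + s *\<^sub>R v)) (at s)" for x s
  proof -
    have "((\<lambda>t. 1 - (x + t *\<^sub>R v) \<bullet> (x + t *\<^sub>R v)) has_real_derivative - 2 * ((x + s *\<^sub>R v) \<bullet> v)) (at s)"
      unfolding has_real_derivative_iff_has_vector_derivative has_vector_derivative_def
      by (auto intro!: derivative_eq_intros simp: inner_simps inner_commute algebra_simps)
    from DERIV_chain2[OF has_real_derivative_max_0_sq this]
    have "((\<lambda>t. complex_of_real ((w (x + t *\<^sub>R v))\<^sup>2)) has_vector_derivative
        of_real (2 * w (x + s *\<^sub>R v) * (- 2 * ((x + s *\<^sub>R v) \<bullet> v)))) (at s)"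
      unfolding w_def by (rule has_vector_derivative_of_real)
    from has_vector_derivative_mult[OF this hpoly_has_vector_derivative_line[OF q]]
    show ?thesis unfolding g_def g'_def by (simp add: algebra_simps)
  qed
  have 0: "(LINT x|lborel. g' x) = 0"
    by (rule integral_directional_derivative_0[OF _ _ der C M supp(1)])
       (intro borel_measurable_continuous_onI cg cg')+
  define L where "L p = (LINT \<xi>|sphere_measure. p \<xi>)" for p :: "'a \<Rightarrow> complex"
  define I where "I p = (LINT x:cball 0 1|lborel. p x)" for p :: "'a \<Rightarrow> complex"
  define D where "D = dderiv v q"
  define r where "r = (\<lambda>x. of_real (x \<bullet> v) * q x)"
  \<comment> \<open>On the sphere the extra factor is 1, while in the ball it shifts the degree. So
    each ball integral below, times a known number, is the sphere integral of D or of r.\<close>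
  define P where "P i p = (\<lambda>x::'a. complex_of_real (x \<bullet> x) ^ i * p x)" for i p
  have r: "hpoly (n + 1) r" unfolding r_def using hpoly_inner_mult[OF q] by simp
  have P_L: "L (P i p) = L p" for i p
    unfolding L_def P_def
    by (rule Bochner_Integration.integral_cong) (auto simp: sphere_measure_def space_scale_measure space_restrict_space dot_square_norm)
  have I_r: "of_nat (K + 2 + 2 * i) * I (P i r) = L r" for i
    using ball_integral_hpoly[OF hpoly_sqnorm_power_mult[OF r refl], of i] K P_L[of i r]
    by (simp add: P_def I_def L_def algebra_simps)
  \<comment> \<open>For n = 0 the degree n - 1 of D is truncated and the count of degrees would be
    off by one; there D = 0.\<close>
  have I_D: "of_nat (K + 2 * i) * I (P i D) = L D" for i
  proof (cases n)
    case 0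
    then have "D = (\<lambda>x. 0)" unfolding D_def using q hpoly_0_dderiv by blast
    then show ?thesis by (simp add: P_def I_def L_def set_lebesgue_integral_def)
  next
    case (Suc j)
    have "hpoly j D" unfolding D_def by (rule hpoly_dderiv[OF q]) (simp add: Suc)
    from ball_integral_hpoly[OF hpoly_sqnorm_power_mult[OF this refl], of i] P_L[of i D]
    show ?thesis using Suc K by (simp add: P_def I_def L_def algebra_simps)
  qed
  have int: "set_integrable lborel (cball 0 1) (P i p)" if "hpoly k p" for i k p
  proof -
    have *: "hpoly (2 * i + k) (P i p)" unfolding P_def by (rule hpoly_sqnorm_power_mult[OF that refl])
    obtain M where "\<And>x. x \<in> cball 0 1 \<Longrightarrow> norm (P i p x) \<le> M" using hpoly_bounded[OF *] by blast
    then show ?thesis by (intro set_integrable_cball[OF hpoly_borel_measurable[OF *]])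
  qed
  have "g' = (\<lambda>x. indicator (cball 0 1) x *\<^sub>R (P 0 D x - 2 * P 1 D x + P 2 D x - 4 * P 0 r x + 4 * P 1 r x))"
  proof
    fix x
    show "g' x = indicator (cball 0 1) x *\<^sub>R (P 0 D x - 2 * P 1 D x + P 2 D x - 4 * P 0 r x + 4 * P 1 r x)"
    proof (cases "norm x \<le> 1")
      case True
      then have "norm x * norm x \<le> 1" by (simp add: mult_le_one)
      then have w: "w x = 1 - x \<bullet> x" by (simp add: w_def dot_square_norm power2_eq_square)
      show ?thesis unfolding g'_def P_def D_def r_def w using True
        by (simp add: power2_eq_square algebra_simps)
    next
      case False
      then show ?thesis using supp(2)[of x] by simp
    qed
  qed
  then have "0 = (LINT x:cball 0 1|lborel. P 0 D x - 2 * P 1 D x + P 2 D x - 4 * P 0 r x + 4 * P 1 r x)"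
    using 0 by (simp add: set_lebesgue_integral_def)
  also have "\<dots> = I (P 0 D) - 2 * I (P 1 D) + I (P 2 D) - 4 * I (P 0 r) + 4 * I (P 1 r)"
    unfolding I_def
    using int[OF hpoly_dderiv_aux[OF q, of v, folded D_def]] int[OF r]
    by (simp add: set_integral_add set_integral_diff)
  finally have 1: "I (P 0 D) - 2 * I (P 1 D) + I (P 2 D) - 4 * I (P 0 r) + 4 * I (P 1 r) = 0" by simp
  define k where "k = (of_nat K :: complex)"
  have nz: "k + 2 \<noteq> 0" "k + 4 \<noteq> 0"
    unfolding k_def by (metis add_eq_0_iff_both_eq_0 of_nat_add of_nat_eq_0_iff of_nat_numeral zero_neq_numeral)+
  have e: "k * I (P 0 D) = L D" "(k + 2) * I (P 1 D) = L D" "(k + 4) * I (P 2 D) = L D"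
      "(k + 2) * I (P 0 r) = L r" "(k + 4) * I (P 1 r) = L r"
    using I_D[of 0] I_D[of 1] I_D[of 2] I_r[of 0] I_r[of 1] by (simp_all add: k_def add_ac)
  \<comment> \<open>With the denominators k, k + 2, k + 4 cleared, the coefficients of L D add up to
    8 and those of L r to - 8 k.\<close>
  have "0 = k * (k + 2) * (k + 4) * (I (P 0 D) - 2 * I (P 1 D) + I (P 2 D) - 4 * I (P 0 r) + 4 * I (P 1 r))"
    unfolding 1 by simp
  also have "\<dots> = (k + 2) * (k + 4) * (k * I (P 0 D)) - 2 * (k * (k + 4) * ((k + 2) * I (P 1 D)))
      + k * (k + 2) * ((k + 4) * I (P 2 D)) - 4 * (k * (k + 4) * ((k + 2) * I (P 0 r)))
      + 4 * (k * (k + 2) * ((k + 4) * I (P 1 r)))"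
    by (simp add: algebra_simps)
  also have "\<dots> = 8 * (L D - k * L r)"
    unfolding e by (simp add: algebra_simps)
  finally show ?thesis by (simp add: L_def D_def r_def k_def K_def)
qed

section \<open>Spherical harmonics and reproducing kernels\<close>

definition sint :: "('a::euclidean_space \<Rightarrow> complex) \<Rightarrow> complex" where
  "sint q = (LINT \<xi>|sphere_measure. q \<xi>)"

lemma space_sphere_measure: "space (sphere_measure :: 'a::euclidean_space measure) = sphere 0 1"
  by (simp add: sphere_measure_def space_scale_measure space_restrict_space)

lemma sint_cong: "(\<And>\<xi>. \<xi> \<in> sphere 0 1 \<Longrightarrow> f \<xi> = g \<xi>) \<Longrightarrow> sint f = sint g"
  unfolding sint_def by (rule Bochner_Integration.integral_cong) (simp_all add: space_sphere_measure)

lemma finite_sphere_measure: "finite_measure (sphere_measure :: 'a::euclidean_space measure)"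
proof
  have "emeasure lborel {x \<in> cball 0 1 - {0}. x /\<^sub>R norm x \<in> sphere (0::'a) 1} \<le> emeasure lborel (cball (0::'a) 1)"
    by (rule emeasure_mono) auto
  also have "\<dots> < \<infinity>" by (rule emeasure_lborel_cball_finite)
  finally show "emeasure sphere_measure (space (sphere_measure :: 'a measure)) \<noteq> \<infinity>"
    by (simp add: space_sphere_measure emeasure_sphere_measure ennreal_mult_eq_top_iff)
qed

lemma hpoly_sphere_integrable:
  assumes "hpoly n p"
  shows "integrable sphere_measure p"
proof -
  obtain M where "M \<ge> 0" and M: "\<And>x. x \<in> cball 0 1 \<Longrightarrow> norm (p x) \<le> M"
    using hpoly_bounded[OF assms] by blast
  have sets: "sets (sphere_measure :: 'a measure) = sets (restrict_space borel (sphere 0 1))"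
    by (simp add: sphere_measure_def)
  have "p \<in> borel_measurable sphere_measure"
    unfolding measurable_cong_sets[OF sets refl]
    by (rule measurable_restrict_space1[OF hpoly_borel_measurable[OF assms]])
  moreover have "AE x in sphere_measure. norm (p x) \<le> M"
    by (rule AE_I2) (use M in \<open>simp add: space_sphere_measure\<close>)
  ultimately show ?thesis
    by (intro finite_measure.integrable_const_bound[OF finite_sphere_measure])
qed

lemma sint_cmult: "sint (\<lambda>x. c * f x) = c * sint f"
  unfolding sint_def by simp

lemma sint_sum:
  assumes "\<And>i. i \<in> I \<Longrightarrow> hpoly (n i) (f i)"
  shows "sint (\<lambda>x. \<Sum>i\<in>I. f i x) = (\<Sum>i\<in>I. sint (f i))"
  unfolding sint_def
  by (rule Bochner_Integration.integral_sum) (rule hpoly_sphere_integrable[OF assms])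

lemma sint_add: "hpoly n f \<Longrightarrow> hpoly k g \<Longrightarrow> sint (\<lambda>x. f x + g x) = sint f + sint g"
  unfolding sint_def by (intro Bochner_Integration.integral_add hpoly_sphere_integrable)

lemma sint_diff: "hpoly n f \<Longrightarrow> hpoly k g \<Longrightarrow> sint (\<lambda>x. f x - g x) = sint f - sint g"
  unfolding sint_def by (intro Bochner_Integration.integral_diff hpoly_sphere_integrable)

lemma sint_cnj: "sint (\<lambda>x. cnj (f x)) = cnj (sint f)"
  unfolding sint_def by simp

lemma sint_const: "sint (\<lambda>x::'a::euclidean_space. c) = of_real (real DIM('a) * unit_ball_vol (real DIM('a))) * c"
proof -
  have "(LINT x:cball (0::'a) 1|lborel. c) = of_real (measure lborel (cball (0::'a) 1)) * c"
    unfolding set_lebesgue_integral_def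
    using emeasure_lborel_cball_finite[of "0::'a" 1]
    by (simp add: scaleR_conv_of_real[symmetric] del: scaleR_conv_of_real)
  then show ?thesis
    using ball_integral_hpoly[OF hpoly_const[of c], where 'a = 'a]
    by (simp add: sint_def content_cball mult.assoc)
qed

text \<open>Apply the divergence theorem to (D_b h) q and sum over b. The gradient products drop out
  by \<open>IH\<close>, so the integral of (Laplacian of h) q, which is 0, is K times that of
  (radial derivative of h) q, and the radial derivative is n h.\<close>

lemma harmonic_orthogonal_step:
  fixes h :: "'a::euclidean_space \<Rightarrow> complex"
  assumes dim: "2 \<le> DIM('a)" and h: "h \<in> harmonic_homogeneous n" and q: "hpoly k q" and "0 < n"
    and IH: "\<And>b. sint (\<lambda>x. dderiv b h x * dderiv b q x) = 0"
  shows "sint (\<lambda>x. h x * q x) = 0"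
proof -
  note hp = harmonic_hpoly[OF h]
  note Dh = hpoly_dderiv_aux[OF hp] and Dq = hpoly_dderiv_aux[OF q]
  let ?K = "n - 1 + k + DIM('a) - 1"
  have 1: "sint (\<lambda>x. dderiv b (dderiv b h) x * q x) = of_nat ?K * sint (\<lambda>x. of_real (x \<bullet> b) * dderiv b h x * q x)" for b
  proof -
    have "sint (dderiv b (\<lambda>x. dderiv b h x * q x)) = of_nat ?K * sint (\<lambda>x. of_real (x \<bullet> b) * dderiv b h x * q x)"
      using sphere_integral_dderiv[OF hpoly_mult[OF Dh q], of b b] by (simp add: sint_def mult.assoc)
    also have "dderiv b (\<lambda>x. dderiv b h x * q x) = (\<lambda>x. dderiv b h x * dderiv b q x + dderiv b (dderiv b h) x * q x)"
      by (rule ext) (rule dderiv_mult[OF Dh q])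
    also have "sint \<dots> = sint (\<lambda>x. dderiv b (dderiv b h) x * q x)"
      by (simp add: sint_add[OF hpoly_mult[OF Dh Dq] hpoly_mult[OF hpoly_dderiv_aux[OF Dh] q]] IH)
    finally show ?thesis .
  qed
  have "0 = sint (\<lambda>x. laplacian h x * q x)"
    by (simp add: harmonic_laplacian[OF h] sint_def)
  also have "(\<lambda>x. laplacian h x * q x) = (\<lambda>x. \<Sum>b\<in>Basis. dderiv b (dderiv b h) x * q x)"
    by (rule ext) (simp add: laplacian_hpoly[OF hp] sum_distrib_right)
  also have "sint \<dots> = (\<Sum>b\<in>Basis. sint (\<lambda>x. dderiv b (dderiv b h) x * q x))"
    by (rule sint_sum[OF hpoly_mult[OF hpoly_dderiv_aux[OF Dh] q]])
  also have "\<dots> = of_nat ?K * (\<Sum>b\<in>Basis. sint (\<lambda>x. of_real (x \<bullet> b) * dderiv b h x * q x))"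
    by (simp only: 1 sum_distrib_left)
  also have "(\<Sum>b\<in>Basis. sint (\<lambda>x. of_real (x \<bullet> b) * dderiv b h x * q x))
      = sint (\<lambda>x. \<Sum>b\<in>Basis. of_real (x \<bullet> b) * dderiv b h x * q x)"
    by (rule sint_sum[OF hpoly_mult[OF hpoly_inner_mult[OF Dh] q], symmetric])
  also have "(\<lambda>x. \<Sum>b\<in>Basis. of_real (x \<bullet> b) * dderiv b h x * q x) = (\<lambda>x. of_nat n * (h x * q x))"
    by (rule ext) (simp add: sum_distrib_right[symmetric] dderiv_Basis[OF hp] euler[OF hp])
  finally have "of_nat (?K * n) * sint (\<lambda>x. h x * q x) = 0"
    by (simp add: sint_cmult)
  moreover have "?K * n \<noteq> 0"
    using dim \<open>0 < n\<close> by auto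
  ultimately show "sint (\<lambda>x. h x * q x) = 0" by (auto simp only: mult_eq_0_iff of_nat_eq_0_iff)
qed

text \<open>Derivatives lower both degrees by one, so induction on k ends at constant q. As q is an
  arbitrary polynomial, products of harmonics may be inserted for it.\<close>

lemma harmonic_orthogonal_lower:
  fixes h :: "'a::euclidean_space \<Rightarrow> complex"
  assumes dim: "2 \<le> DIM('a)" and "h \<in> harmonic_homogeneous n" "hpoly k q" "k < n"
  shows "sint (\<lambda>x. h x * q x) = 0"
  using assms(2-)
proof (induction k arbitrary: n h q)
  case 0
  then show ?case
    by (intro harmonic_orthogonal_step[OF dim 0(1,2)]) (simp_all add: hpoly_0_dderiv sint_def)
next
  case (Suc k)
  have "sint (\<lambda>x. dderiv b h x * dderiv b q x) = 0" for b
    by (rule Suc.IH[of _ "n - 1"])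
       (use Suc.prems in \<open>auto intro: harmonic_dderiv hpoly_dderiv\<close>)
  then show ?case
    using Suc.prems by (intro harmonic_orthogonal_step[OF dim Suc.prems(1,2)]) auto
qed

lemma harmonic_orthogonal:
  fixes h :: "'a::euclidean_space \<Rightarrow> complex"
  assumes dim: "2 \<le> DIM('a)" and h: "h \<in> harmonic_homogeneous n" and q: "q \<in> harmonic_homogeneous k" and "n \<noteq> k"
  shows "sint (\<lambda>x. h x * q x) = 0"
proof (cases "k < n")
  case True
  then show ?thesis by (rule harmonic_orthogonal_lower[OF dim h harmonic_hpoly[OF q]])
next
  case False
  then have "n < k" using assms(4) by simp
  from harmonic_orthogonal_lower[OF dim q harmonic_hpoly[OF h] this]
  show ?thesis by (simp add: mult.commute)
qed

lemma on_sphere: "\<xi> \<in> sphere (0::'a::euclidean_space) 1 \<Longrightarrow> \<xi> \<bullet> \<xi> = 1"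
  by (simp add: dot_square_norm)

section \<open>Projections and reproducing kernels of spherical harmonics\<close>

locale spherical_harmonics =
  fixes Y :: "nat \<Rightarrow> nat \<Rightarrow> 'a::euclidean_space \<Rightarrow> complex"
  assumes basis: "spherical_harmonic_basis Y" and dim: "2 \<le> DIM('a)"
begin

text \<open>\<open>Y\<close> is arbitrary off the sphere; Laplacians and normal derivatives need the
  polynomial that agrees with it on the sphere.\<close>

definition y :: "nat \<Rightarrow> nat \<Rightarrow> 'a \<Rightarrow> complex" where
  "y n k = (SOME p. p \<in> harmonic_homogeneous n \<and> (\<forall>\<xi>\<in>sphere 0 1. Y n k \<xi> = p \<xi>))"

lemma y_facts:
  assumes "k \<in> {1..harm_dim n DIM('a)}"
  shows y_harmonic: "y n k \<in> harmonic_homogeneous n"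
    and Y_eq_y: "\<xi> \<in> sphere 0 1 \<Longrightarrow> Y n k \<xi> = y n k \<xi>"
proof -
  have "\<exists>p. p \<in> harmonic_homogeneous n \<and> (\<forall>\<xi>\<in>sphere 0 1. Y n k \<xi> = p \<xi>)"
    using basis assms unfolding spherical_harmonic_basis_def by blast
  from someI_ex[OF this] show "y n k \<in> harmonic_homogeneous n"
    "\<xi> \<in> sphere 0 1 \<Longrightarrow> Y n k \<xi> = y n k \<xi>"
    unfolding y_def by auto
qed

lemma y_hpoly: "k \<in> {1..harm_dim n DIM('a)} \<Longrightarrow> hpoly n (y n k)"
  by (rule harmonic_hpoly[OF y_harmonic])

lemma y_spans:
  assumes "q \<in> harmonic_homogeneous n"
  obtains c where "q = (\<lambda>x. \<Sum>k=1..harm_dim n DIM('a). c k * y n k x)"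
proof -
  obtain c where c: "\<forall>\<xi>\<in>sphere 0 1. q \<xi> = (\<Sum>k=1..harm_dim n DIM('a). c k * Y n k \<xi>)"
    using basis assms unfolding spherical_harmonic_basis_def by blast
  have "q = (\<lambda>x. \<Sum>k=1..harm_dim n DIM('a). c k * y n k x)"
    by (rule hpoly_eq_on_sphere[OF harmonic_hpoly[OF assms] hpoly_sum[OF hpoly_cmult[OF y_hpoly]]])
       (use c in \<open>auto simp: Y_eq_y intro!: sum.cong\<close>)
  then show ?thesis by (rule that)
qed

lemma y_orthonormal:
  assumes "j \<in> {1..harm_dim n DIM('a)}" "k \<in> {1..harm_dim n DIM('a)}"
  shows "sint (\<lambda>\<xi>. y n j \<xi> * cnj (y n k \<xi>)) = (if j = k then 1 else 0)"
proof -
  have "sint (\<lambda>\<xi>. y n j \<xi> * cnj (y n k \<xi>)) = sint (\<lambda>\<xi>. Y n j \<xi> * cnj (Y n k \<xi>))"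
    by (rule sint_cong) (simp add: Y_eq_y[OF assms(1)] Y_eq_y[OF assms(2)] del: mem_sphere)
  then show ?thesis
    using basis assms unfolding spherical_harmonic_basis_def sint_def by simp
qed

text \<open>Orthogonal projection onto the harmonics of degree n. Only values of q on the sphere
  enter, so factors x . x may be dropped.\<close>

definition proj :: "nat \<Rightarrow> ('a \<Rightarrow> complex) \<Rightarrow> 'a \<Rightarrow> complex" where
  "proj n q x = (\<Sum>i=1..harm_dim n DIM('a). sint (\<lambda>\<xi>. q \<xi> * cnj (y n i \<xi>)) * y n i x)"

lemma proj_cong: "(\<And>\<xi>. \<xi> \<in> sphere 0 1 \<Longrightarrow> f \<xi> = g \<xi>) \<Longrightarrow> proj n f x = proj n g x"
  unfolding proj_def
  by (intro sum.cong refl arg_cong2[where f = "(*)"] sint_cong) auto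

lemma proj_cmult: "proj n (\<lambda>x. c * f x) x = c * proj n f x"
  by (simp add: proj_def mult.assoc sint_cmult sum_distrib_left)

lemma proj_sum:
  assumes "\<And>j. j \<in> J \<Longrightarrow> hpoly (k j) (f j)"
  shows "proj n (\<lambda>x. \<Sum>j\<in>J. f j x) x = (\<Sum>j\<in>J. proj n (f j) x)"
proof -
  have "sint (\<lambda>\<xi>. (\<Sum>j\<in>J. f j \<xi>) * cnj (y n i \<xi>)) = (\<Sum>j\<in>J. sint (\<lambda>\<xi>. f j \<xi> * cnj (y n i \<xi>)))"
    if "i \<in> {1..harm_dim n DIM('a)}" for i
    unfolding sum_distrib_right
    by (rule sint_sum[where n = "\<lambda>j. k j + n"]) (intro hpoly_mult assms hpoly_cnj y_hpoly that)
  then have "proj n (\<lambda>x. \<Sum>j\<in>J. f j x) x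
      = (\<Sum>i=1..harm_dim n DIM('a). \<Sum>j\<in>J. sint (\<lambda>\<xi>. f j \<xi> * cnj (y n i \<xi>)) * y n i x)"
    unfolding proj_def by (intro sum.cong refl) (simp add: sum_distrib_right)
  also have "\<dots> = (\<Sum>j\<in>J. proj n (f j) x)"
    unfolding proj_def by (rule sum.swap)
  finally show ?thesis .
qed

lemma proj_harmonic:
  assumes "q \<in> harmonic_homogeneous k"
  shows "proj n q x = (if n = k then q x else 0)"
proof (cases "n = k")
  case True
  obtain c where c: "q = (\<lambda>x. \<Sum>k=1..harm_dim n DIM('a). c k * y n k x)"
    by (rule y_spans[OF assms[folded True]])
  have "sint (\<lambda>\<xi>. q \<xi> * cnj (y n i \<xi>)) = c i" if i: "i \<in> {1..harm_dim n DIM('a)}" for i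
  proof -
    have "sint (\<lambda>\<xi>. q \<xi> * cnj (y n i \<xi>)) = sint (\<lambda>\<xi>. \<Sum>k=1..harm_dim n DIM('a). c k * (y n k \<xi> * cnj (y n i \<xi>)))"
      by (simp add: c sum_distrib_right mult.assoc)
    also have "\<dots> = (\<Sum>k=1..harm_dim n DIM('a). sint (\<lambda>\<xi>. c k * (y n k \<xi> * cnj (y n i \<xi>))))"
      by (rule sint_sum[where n = "\<lambda>_. n + n"]) (intro hpoly_cmult hpoly_mult hpoly_cnj y_hpoly i)
    also have "\<dots> = (\<Sum>k=1..harm_dim n DIM('a). if k = i then c k else 0)"
      by (intro sum.cong refl) (simp add: sint_cmult y_orthonormal[OF _ i])
    also have "\<dots> = c i" using i by simp
    finally show ?thesis .
  qed
  then have "proj n q x = q x" unfolding proj_def c by (intro sum.cong refl) simp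
  then show ?thesis using True by simp
next
  case False
  have "sint (\<lambda>\<xi>. q \<xi> * cnj (y n i \<xi>)) = 0" if "i \<in> {1..harm_dim n DIM('a)}" for i
    by (rule harmonic_orthogonal[OF dim assms harmonic_cnj[OF y_harmonic[OF that]]]) (use False in simp)
  then show ?thesis using False by (simp add: proj_def)
qed

text \<open>Source of the lower limit m + 1 - l in the sum over n: h is orthogonal to q times a
  conjugated harmonic of degree n, a polynomial of degree n + l below k.\<close>

lemma proj_eq_0_if_lower:
  assumes h: "h \<in> harmonic_homogeneous k" and q: "hpoly l q" and "n + l < k"
  shows "proj n (\<lambda>x. h x * q x) x = 0"
proof -
  have "sint (\<lambda>\<xi>. h \<xi> * (q \<xi> * cnj (y n i \<xi>))) = 0" if "i \<in> {1..harm_dim n DIM('a)}" for i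
    by (rule harmonic_orthogonal_lower[OF dim h hpoly_mult[OF q hpoly_cnj[OF y_hpoly[OF that]]]])
       (use assms(3) in simp)
  then show ?thesis by (simp add: proj_def mult.assoc)
qed

definition kernel :: "nat \<Rightarrow> 'a \<Rightarrow> 'a \<Rightarrow> complex" where
  "kernel n a x = (\<Sum>i=1..harm_dim n DIM('a). cnj (y n i a) * y n i x)"

lemma kernel_harmonic: "kernel n a \<in> harmonic_homogeneous n"
  unfolding kernel_def[abs_def] by (intro harmonic_sum harmonic_cmult y_harmonic)

text \<open>The pairing carries no conjugate, so the expansion behind it is that of
  \<open>cnj q\<close>, which is harmonic of the same degree.\<close>

lemma kernel_reproducing:
  assumes "q \<in> harmonic_homogeneous k"
  shows "sint (\<lambda>\<xi>. kernel n a \<xi> * q \<xi>) = (if n = k then q a else 0)"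
proof -
  have q: "hpoly k q" by (rule harmonic_hpoly[OF assms])
  have "sint (\<lambda>\<xi>. kernel n a \<xi> * q \<xi>) = sint (\<lambda>\<xi>. \<Sum>i=1..harm_dim n DIM('a). cnj (y n i a) * (y n i \<xi> * q \<xi>))"
    by (simp add: kernel_def sum_distrib_right mult.assoc)
  also have "\<dots> = (\<Sum>i=1..harm_dim n DIM('a). sint (\<lambda>\<xi>. cnj (y n i a) * (y n i \<xi> * q \<xi>)))"
    by (rule sint_sum[where n = "\<lambda>_. n + k"]) (intro hpoly_cmult hpoly_mult q y_hpoly)
  also have "\<dots> = cnj (proj n (\<lambda>x. cnj (q x)) a)"
    unfolding proj_def by (simp add: sint_cmult sint_cnj[symmetric] mult.commute)
  finally show ?thesis
    by (simp add: proj_harmonic[OF harmonic_cnj[OF assms]])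
qed

text \<open>The reproducing kernel of all homogeneous polynomials of degree m. On the sphere these
  are sums of harmonics of degrees m, m - 2, and so on; the powers of x . x make the sum of the
  kernels homogeneous.\<close>

definition poly_kernel :: "nat \<Rightarrow> 'a \<Rightarrow> 'a \<Rightarrow> complex" where
  "poly_kernel m a x = (\<Sum>j\<le>m div 2. of_real (x \<bullet> x) ^ j * kernel (m - 2 * j) a x)"

lemma poly_kernel_hpoly: "hpoly m (poly_kernel m a)"
  unfolding poly_kernel_def[abs_def]
  by (intro hpoly_sum hpoly_sqnorm_power_mult[OF harmonic_hpoly[OF kernel_harmonic]]) auto

lemma poly_kernel_reproducing:
  assumes q: "hpoly m q" and a: "a \<in> sphere 0 1"
  shows "sint (\<lambda>\<xi>. poly_kernel m a \<xi> * q \<xi>) = q a"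
proof -
  obtain h where h: "\<And>j. j \<le> m div 2 \<Longrightarrow> h j \<in> harmonic_homogeneous (m - 2 * j)"
    "\<And>x. q x = (\<Sum>j\<le>m div 2. of_real (x \<bullet> x) ^ j * h j x)"
    using harmonic_decomposition[OF q] by blast
  have "sint (\<lambda>\<xi>. poly_kernel m a \<xi> * q \<xi>)
      = sint (\<lambda>\<xi>. \<Sum>(i, j)\<in>{..m div 2} \<times> {..m div 2}. kernel (m - 2 * i) a \<xi> * h j \<xi>)"
    by (rule sint_cong) (simp add: poly_kernel_def h(2) on_sphere sum_product sum.cartesian_product
        del: mem_sphere)
  also have "\<dots> = sint (\<lambda>\<xi>. \<Sum>p\<in>{..m div 2} \<times> {..m div 2}. kernel (m - 2 * fst p) a \<xi> * h (snd p) \<xi>)"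
    by (simp add: case_prod_beta')
  also have "\<dots> = (\<Sum>p\<in>{..m div 2} \<times> {..m div 2}. sint (\<lambda>\<xi>. kernel (m - 2 * fst p) a \<xi> * h (snd p) \<xi>))"
    by (rule sint_sum[where n = "\<lambda>p. (m - 2 * fst p) + (m - 2 * snd p)"])
       (auto intro!: hpoly_mult harmonic_hpoly[OF kernel_harmonic] harmonic_hpoly[OF h(1)])
  also have "\<dots> = (\<Sum>i\<le>m div 2. \<Sum>j\<le>m div 2. sint (\<lambda>\<xi>. kernel (m - 2 * i) a \<xi> * h j \<xi>))"
    by (simp add: sum.cartesian_product case_prod_beta')
  also have "\<dots> = (\<Sum>i\<le>m div 2. \<Sum>j\<le>m div 2. if i = j then h j a else 0)"
  proof (intro sum.cong refl)
    fix i j assume ij: "i \<in> {..m div 2}" "j \<in> {..m div 2}"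
    then have "m - 2 * i = m - 2 * j \<longleftrightarrow> i = j" by auto
    then show "sint (\<lambda>\<xi>. kernel (m - 2 * i) a \<xi> * h j \<xi>) = (if i = j then h j a else 0)"
      using kernel_reproducing[OF h(1), of j "m - 2 * i" a] ij by simp
  qed
  also have "\<dots> = q a" by (simp add: h(2) on_sphere[OF a])
  finally show ?thesis .
qed

text \<open>The reproducing kernel at \<xi> is one of the test functions, and against it the
  integral is e \<xi>.\<close>

lemma eq_0_on_sphere_if_orthogonal:
  fixes e :: "'a \<Rightarrow> complex"
  assumes e: "hpoly n e" and "\<And>q. hpoly n q \<Longrightarrow> sint (\<lambda>x. e x * q x) = 0" and \<xi>: "\<xi> \<in> sphere 0 1"
  shows "e \<xi> = 0"
proof -
  have "e \<xi> = sint (\<lambda>x. poly_kernel n \<xi> x * e x)"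
    by (rule poly_kernel_reproducing[OF e \<xi>, symmetric])
  then show ?thesis using assms(2)[OF poly_kernel_hpoly, of \<xi>] by (simp add: mult.commute)
qed

lemma kernel_dderiv_harmonic:
  "(\<lambda>x. \<Sum>i=1..harm_dim n DIM('a). cnj (dderiv v (y n i) a) * y n i x) \<in> harmonic_homogeneous n"
  by (intro harmonic_sum harmonic_cmult y_harmonic)

text \<open>The reproducing identity, differentiated in the point a.\<close>

lemma kernel_dderiv_reproducing:
  assumes q: "q \<in> harmonic_homogeneous n"
  shows "sint (\<lambda>\<xi>. (\<Sum>i=1..harm_dim n DIM('a). cnj (dderiv v (y n i) a) * y n i \<xi>) * q \<xi>) = dderiv v q a"
proof -
  note hq = harmonic_hpoly[OF q]
  let ?c = "\<lambda>i. sint (\<lambda>\<xi>. y n i \<xi> * q \<xi>)"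
  have lin: "sint (\<lambda>\<xi>. (\<Sum>i=1..harm_dim n DIM('a). z i * y n i \<xi>) * q \<xi>) = (\<Sum>i=1..harm_dim n DIM('a). ?c i * z i)" for z
  proof -
    have "sint (\<lambda>\<xi>. (\<Sum>i=1..harm_dim n DIM('a). z i * y n i \<xi>) * q \<xi>) = sint (\<lambda>\<xi>. \<Sum>i=1..harm_dim n DIM('a). z i * (y n i \<xi> * q \<xi>))"
      by (simp add: sum_distrib_right mult.assoc)
    also have "\<dots> = (\<Sum>i=1..harm_dim n DIM('a). sint (\<lambda>\<xi>. z i * (y n i \<xi> * q \<xi>)))"
      by (rule sint_sum[where n = "\<lambda>_. n + n"]) (intro hpoly_cmult hpoly_mult hq y_hpoly)
    finally show ?thesis by (simp add: sint_cmult mult.commute)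
  qed
  have "q = (\<lambda>x. \<Sum>i=1..harm_dim n DIM('a). ?c i * cnj (y n i x))"
    using kernel_reproducing[OF q, of n] lin unfolding kernel_def by (simp add: fun_eq_iff)
  then have "dderiv v q a = dderiv v (\<lambda>x. \<Sum>i=1..harm_dim n DIM('a). ?c i * cnj (y n i x)) a" by (rule arg_cong)
  also have "\<dots> = (\<Sum>i=1..harm_dim n DIM('a). dderiv v (\<lambda>x. ?c i * cnj (y n i x)) a)"
    by (rule dderiv_sum[OF hpoly_cmult[OF hpoly_cnj[OF y_hpoly]]])
  also have "\<dots> = (\<Sum>i=1..harm_dim n DIM('a). ?c i * cnj (dderiv v (y n i) a))"
    by (intro sum.cong refl) (simp add: dderiv_cmult[OF hpoly_cnj[OF y_hpoly]] dderiv_cnj[OF y_hpoly])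
  finally show ?thesis unfolding lin by simp
qed

text \<open>For \<open>a\<close> orthogonal to \<open>\<omega>\<close>, the derivative of the zonal harmonic of degree \<open>m + 1\<close> is \<open>\<xi> \<bullet> \<omega>\<close>
  times a reproducing kernel; in terms of Gegenbauer polynomials this is the identity
  \<open>(C\<^sub>m\<^sub>+\<^sub>1)' = 2 \<Sum> (k + \<lambda>) C\<^sub>k\<close>, the sum over \<open>k \<le> m\<close> of the parity of \<open>m\<close>.\<close>

lemma kernel_dderiv_eq:
  assumes a: "a \<in> sphere 0 1" "a \<bullet> \<omega> = 0" and \<xi>: "\<xi> \<in> sphere 0 1"
  shows "(\<Sum>i=1..harm_dim (Suc m) DIM('a). cnj (dderiv \<omega> (y (Suc m) i) a) * y (Suc m) i \<xi>)
    = of_nat (2 * m + DIM('a)) * of_real (\<xi> \<bullet> \<omega>) * poly_kernel m a \<xi>"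
proof -
  let ?k = "\<lambda>x. \<Sum>i=1..harm_dim (Suc m) DIM('a). cnj (dderiv \<omega> (y (Suc m) i) a) * y (Suc m) i x"
  let ?c = "of_nat (2 * m + DIM('a)) :: complex"
  let ?K = "\<lambda>x. ?c * (of_real (x \<bullet> \<omega>) * poly_kernel m a x)"
  note k = kernel_dderiv_harmonic[where n = "Suc m" and v = \<omega> and a = a]
  note hk = harmonic_hpoly[OF k]
  have hK: "hpoly (Suc m) ?K" by (intro hpoly_cmult hpoly_inner_mult poly_kernel_hpoly)
  have c0: "?c \<noteq> 0" using dim by (simp only: of_nat_eq_0_iff)
  \<comment> \<open>Against components of degree below m + 1 both sides vanish: the left by
    orthogonality, the right because (x . \<omega>) q, raised to degree m by powers of x . x, is
    evaluated at a, where x . \<omega> is 0.\<close>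
  have lower: "sint (\<lambda>x. ?k x * q x) = sint (\<lambda>x. ?K x * q x)" if q: "q \<in> harmonic_homogeneous n" and n: "Suc m = n + 2 * j" "j > 0" for q n j
  proof -
    obtain i where i: "j = Suc i" using n(2) by (cases j) auto
    let ?q = "\<lambda>x. of_real (x \<bullet> x) ^ i * (of_real (x \<bullet> \<omega>) * q x)"
    have "hpoly m ?q"
      by (rule hpoly_sqnorm_power_mult[OF hpoly_inner_mult[OF harmonic_hpoly[OF q]]]) (use n i in simp)
    from poly_kernel_reproducing[OF this a(1)] have "sint (\<lambda>x. poly_kernel m a x * ?q x) = 0"
      by (simp add: a(2))
    moreover have "sint (\<lambda>x. ?K x * q x) = sint (\<lambda>x. ?c * (poly_kernel m a x * ?q x))"
      by (rule sint_cong) (simp add: on_sphere algebra_simps del: mem_sphere)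
    ultimately have "sint (\<lambda>x. ?K x * q x) = 0" by (simp add: sint_cmult)
    moreover have "sint (\<lambda>x. ?k x * q x) = 0"
      by (rule harmonic_orthogonal[OF dim k q]) (use n in simp)
    ultimately show ?thesis by simp
  qed
  \<comment> \<open>Split (x . \<omega>) q into a harmonic of degree m + 2, orthogonal to the kernel
    of degree m, and |x|^2 D q / (2 m + d), which the kernel evaluates at a. This is the origin of
    the factor 2 m + d.\<close>
  have top: "sint (\<lambda>x. ?k x * q x) = sint (\<lambda>x. ?K x * q x)" if q: "q \<in> harmonic_homogeneous (Suc m)" for q
  proof -
    let ?g = "\<lambda>x. of_real (x \<bullet> \<omega>) * q x - of_real (x \<bullet> x) * (dderiv \<omega> q x / ?c)"
    have g: "?g \<in> harmonic_homogeneous (Suc (Suc m))"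
      using harmonic_inner_mult[OF q, of \<omega>] by simp
    have D: "hpoly m (\<lambda>x. dderiv \<omega> q x / ?c)"
      using hpoly_cmult[OF hpoly_dderiv[OF harmonic_hpoly[OF q], of m \<omega>], of "1 / ?c"] by simp
    have "sint (\<lambda>x. ?K x * q x)
        = sint (\<lambda>x. ?c * (poly_kernel m a x * ?g x + poly_kernel m a x * (dderiv \<omega> q x / ?c)))"
      by (rule sint_cong) (simp add: on_sphere algebra_simps del: mem_sphere)
    also have "\<dots> = ?c * (sint (\<lambda>x. poly_kernel m a x * ?g x) + sint (\<lambda>x. poly_kernel m a x * (dderiv \<omega> q x / ?c)))"
      unfolding sint_cmult
      by (subst sint_add[OF hpoly_mult[OF poly_kernel_hpoly harmonic_hpoly[OF g]]
            hpoly_mult[OF poly_kernel_hpoly D]]) (rule refl)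
    also have "sint (\<lambda>x. poly_kernel m a x * ?g x) = 0"
      using harmonic_orthogonal_lower[OF dim g poly_kernel_hpoly[of m a]] by (simp add: mult.commute)
    also have "sint (\<lambda>x. poly_kernel m a x * (dderiv \<omega> q x / ?c)) = dderiv \<omega> q a / ?c"
      by (rule poly_kernel_reproducing[OF D a(1)])
    finally show ?thesis using c0 kernel_dderiv_reproducing[OF q, of \<omega> a] by simp
  qed
  have "?k \<xi> - ?K \<xi> = 0"
  proof (rule eq_0_on_sphere_if_orthogonal[OF hpoly_diff[OF hk hK] _ \<xi>])
    fix q :: "'a \<Rightarrow> complex" assume q: "hpoly (Suc m) q"
    obtain h where h: "\<And>j. j \<le> Suc m div 2 \<Longrightarrow> h j \<in> harmonic_homogeneous (Suc m - 2 * j)"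
      "\<And>x. q x = (\<Sum>j\<le>Suc m div 2. of_real (x \<bullet> x) ^ j * h j x)"
      using harmonic_decomposition[OF q] by blast
    have expand: "sint (\<lambda>x. f x * q x) = (\<Sum>j\<le>Suc m div 2. sint (\<lambda>x. f x * h j x))" if "hpoly (Suc m) f" for f
    proof -
      have "sint (\<lambda>x. f x * q x) = sint (\<lambda>x. \<Sum>j\<le>Suc m div 2. f x * h j x)"
        by (rule sint_cong) (simp add: h(2) on_sphere sum_distrib_left del: mem_sphere)
      also have "\<dots> = (\<Sum>j\<le>Suc m div 2. sint (\<lambda>x. f x * h j x))"
        by (rule sint_sum[where n = "\<lambda>j. Suc m + (Suc m - 2 * j)"])
           (intro hpoly_mult that harmonic_hpoly[OF h(1)], simp)
      finally show ?thesis .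
    qed
    have "sint (\<lambda>x. ?k x * h j x) = sint (\<lambda>x. ?K x * h j x)" if "j \<le> Suc m div 2" for j
    proof (cases "j = 0")
      case True
      then show ?thesis using top[of "h 0"] h(1)[of 0] by simp
    next
      case False
      show ?thesis by (rule lower[OF h(1)[OF that], of j]) (use that False in auto)
    qed
    then have "sint (\<lambda>x. ?k x * q x) = sint (\<lambda>x. ?K x * q x)"
      unfolding expand[OF hk] expand[OF hK] by (intro sum.cong refl) auto
    then show "sint (\<lambda>x. (?k x - ?K x) * q x) = 0"
      unfolding left_diff_distrib by (subst sint_diff[OF hpoly_mult[OF hk q] hpoly_mult[OF hK q]]) simp
  qed
  then show ?thesis by (simp add: mult.assoc)
qed

text \<open>The reflection fixes a and preserves sphere integrals, so the reflected kernel
  reproduces the same harmonics at the same point.\<close>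

lemma kernel_reflect:
  assumes "norm \<omega> = 1" "a \<in> sphere 0 1" "a \<bullet> \<omega> = 0"
  shows "kernel n a (squeeze \<omega> (-1) x) = kernel n a x"
proof -
  let ?R = "squeeze \<omega> (-1)"
  have RR: "?R (?R x) = x" for x by (simp add: squeeze_squeeze[OF assms(1)])
  note k = kernel_harmonic[of n a] and kR = harmonic_reflect[OF kernel_harmonic[of n a] assms(1)]
  \<comment> \<open>Read off from the harmonic decomposition: only a component of degree 0 can have
    a nonzero integral, and it is constant.\<close>
  have inv: "sint (\<lambda>x. f (?R x)) = sint f" if f: "hpoly N f" for f N
  proof -
    obtain h where h: "\<And>j. j \<le> N div 2 \<Longrightarrow> h j \<in> harmonic_homogeneous (N - 2 * j)"
      "\<And>x. f x = (\<Sum>j\<le>N div 2. of_real (x \<bullet> x) ^ j * h j x)"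
      using harmonic_decomposition[OF f] by blast
    have R1: "?R x \<bullet> ?R x = x \<bullet> x" for x by (simp add: squeeze_inner_squeeze[OF assms(1)])
    have eq: "sint (\<lambda>x. h j (?R x)) = sint (h j)" if j: "j \<le> N div 2" for j
    proof (cases "N - 2 * j = 0")
      case True
      then have "h j (?R x) = h j x" for x using harmonic_hpoly[OF h(1)[OF j]] hpoly_0_const by metis
      then show ?thesis by simp
    next
      case False
      then have "sint (\<lambda>x. g x * 1) = 0" if "g \<in> harmonic_homogeneous (N - 2 * j)" for g :: "'a \<Rightarrow> complex"
        by (intro harmonic_orthogonal_lower[OF dim that hpoly_const]) simp
      then show ?thesis using h(1)[OF j] harmonic_reflect[OF h(1)[OF j] assms(1)] by simp
    qed
    have "sint f = sint (\<lambda>x. \<Sum>j\<le>N div 2. h j x)"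
      by (rule sint_cong) (simp add: h(2) on_sphere del: mem_sphere)
    also have "\<dots> = (\<Sum>j\<le>N div 2. sint (h j))"
      by (rule sint_sum[where n = "\<lambda>j. N - 2 * j"]) (auto intro!: harmonic_hpoly h)
    also have "\<dots> = (\<Sum>j\<le>N div 2. sint (\<lambda>x. h j (?R x)))"
      by (intro sum.cong refl eq[symmetric]) simp
    also have "\<dots> = sint (\<lambda>x. \<Sum>j\<le>N div 2. h j (?R x))"
      by (rule sint_sum[where n = "\<lambda>j. N - 2 * j", symmetric])
         (auto intro!: harmonic_hpoly[OF harmonic_reflect[OF h(1) assms(1)]])
    also have "\<dots> = sint (\<lambda>x. f (?R x))"
      by (rule sint_cong) (simp add: h(2) R1 on_sphere del: mem_sphere)
    finally show ?thesis by simp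
  qed
  have "kernel n a (?R \<xi>) - kernel n a \<xi> = 0" if \<xi>: "\<xi> \<in> sphere 0 1" for \<xi>
  proof (rule eq_0_on_sphere_if_orthogonal[OF hpoly_diff[OF harmonic_hpoly[OF kR] harmonic_hpoly[OF k]] _ \<xi>])
    fix q :: "'a \<Rightarrow> complex" assume q: "hpoly n q"
    obtain h where h: "\<And>j. j \<le> n div 2 \<Longrightarrow> h j \<in> harmonic_homogeneous (n - 2 * j)"
      "\<And>x. q x = (\<Sum>j\<le>n div 2. of_real (x \<bullet> x) ^ j * h j x)"
      using harmonic_decomposition[OF q] by blast
    have expand: "sint (\<lambda>x. f x * q x) = sint (\<lambda>x. f x * h 0 x)" if f: "f \<in> harmonic_homogeneous n" for f
    proof -
      have "sint (\<lambda>x. f x * q x) = sint (\<lambda>x. \<Sum>j\<le>n div 2. f x * h j x)"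
        by (rule sint_cong) (simp add: h(2) on_sphere sum_distrib_left del: mem_sphere)
      also have "\<dots> = (\<Sum>j\<le>n div 2. sint (\<lambda>x. f x * h j x))"
        by (rule sint_sum[where n = "\<lambda>j. n + (n - 2 * j)"])
           (intro hpoly_mult harmonic_hpoly[OF f] harmonic_hpoly[OF h(1)], simp)
      also have "\<dots> = (\<Sum>j\<in>{0}. sint (\<lambda>x. f x * h j x))"
        by (rule sum.mono_neutral_right) (auto intro!: harmonic_orthogonal[OF dim f h(1)])
      finally show ?thesis by simp
    qed
    have h0: "h 0 \<in> harmonic_homogeneous n" using h(1)[of 0] by simp
    note hR = harmonic_reflect[OF h0 assms(1)]
    have "sint (\<lambda>x. kernel n a (?R x) * h 0 x) = sint (\<lambda>x. kernel n a x * h 0 (?R x))"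
      using inv[OF hpoly_mult[OF harmonic_hpoly[OF k] harmonic_hpoly[OF hR]]] by (simp add: RR)
    also have "\<dots> = h 0 (?R a)" using kernel_reproducing[OF hR, of n a] by simp
    also have "\<dots> = sint (\<lambda>x. kernel n a x * h 0 x)"
      using kernel_reproducing[OF h0, of n a] by (simp add: squeeze_orthogonal[OF assms(3)])
    finally show "sint (\<lambda>x. (kernel n a (?R x) - kernel n a x) * q x) = 0"
      unfolding left_diff_distrib
      by (subst sint_diff[OF hpoly_mult[OF harmonic_hpoly[OF kR] q] hpoly_mult[OF harmonic_hpoly[OF k] q]])
         (simp add: expand[OF k] expand[OF kR])
  qed
  then have "(\<lambda>x. kernel n a (?R x)) = kernel n a"
    by (intro hpoly_eq_on_sphere[OF harmonic_hpoly[OF kR] harmonic_hpoly[OF k]]) simp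
  then show ?thesis by (rule fun_cong)
qed

end

section \<open>The expansion in Gaunt coefficients\<close>

text \<open>The start of the recursion, which becomes the constant in \<open>pv_inner_mult\<close>.
  Writing the dimension as e + 3 removes the subtraction in n + d - 3.\<close>

lemma nu_1: "nu (Suc 0) (e + 3) = - 1 / real (dfact (Suc e))"
  by (simp add: nu_def)

text \<open>For J = 2 i + 2 the factors J and J + d - 2 are the weights with which the parts of
  degrees J - 1 and J + 1 of (x . \<omega>) h contribute at \<omega>, for h harmonic of degree
  J.\<close>

lemma nu_rec:
  "real (2 * i + 2) * nu (2 * i + 1) (e + 3) + real (2 * i + 3 + e) * nu (2 * i + 3) (e + 3) = 0"
proof -
  have pos: "dfact n > 0" for n by (induction n rule: dfact.induct) auto
  have 1: "nu (2 * i + 1) (e + 3) = (-1) ^ Suc i * real (dfact (2 * i)) / real (dfact (2 * i + 1 + e))"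
    by (simp add: nu_def)
  have "nu (2 * i + 3) (e + 3) = (-1) ^ Suc (Suc i) * real (dfact (Suc (Suc (2 * i)))) / real (dfact (Suc (Suc (2 * i + 1 + e))))"
    by (simp add: nu_def numeral_3_eq_3)
  also have "\<dots> = - ((-1) ^ Suc i * (real (2 * i + 2) * real (dfact (2 * i))) / (real (2 * i + 3 + e) * real (dfact (2 * i + 1 + e))))"
    unfolding dfact.simps(3) of_nat_mult by (simp add: add_ac numeral_3_eq_3)
  finally have 2: "nu (2 * i + 3) (e + 3) = - ((-1) ^ Suc i * (real (2 * i + 2) * real (dfact (2 * i))) / (real (2 * i + 3 + e) * real (dfact (2 * i + 1 + e))))" .
  show ?thesis unfolding 1 2 using pos[of "2 * i + 1 + e"] by (simp add: divide_simps)
qed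

section \<open>The principal value functional and the Cauchy data of the double sum\<close>

context spherical_harmonics
begin

lemma proj_add:
  assumes "hpoly k f" "hpoly l g"
  shows "proj n (\<lambda>x. f x + g x) x = proj n f x + proj n g x"
  using proj_sum[of "UNIV :: bool set" "\<lambda>b. if b then k else l" "\<lambda>b. if b then f else g" n x] assms
  by (simp add: UNIV_bool add.commute)

text \<open>Up to a constant factor this is the principal value of the integral of \<open>q \<xi> / (\<xi> \<bullet> \<omega>)\<close>, for \<open>q\<close>
  of odd degree at most \<open>M\<close>, as \<open>pv_inner_mult\<close> and \<open>pv_reflect\<close> characterise it.\<close>

definition pv :: "nat \<Rightarrow> 'a \<Rightarrow> ('a \<Rightarrow> complex) \<Rightarrow> complex" where
  "pv M \<omega> q = (\<Sum>n\<in>{n. n \<le> M \<and> odd n}. of_real (nu n DIM('a)) * proj n q \<omega>)"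

lemma finite_odd: "finite {n. n \<le> M \<and> odd (n::nat)}"
  by (rule finite_subset[of _ "{..M}"]) auto

lemma pv_cong: "(\<And>\<xi>. \<xi> \<in> sphere 0 1 \<Longrightarrow> f \<xi> = g \<xi>) \<Longrightarrow> pv M \<omega> f = pv M \<omega> g"
  unfolding pv_def by (intro sum.cong refl arg_cong2[where f = "(*)"] proj_cong)

lemma pv_cmult: "pv M \<omega> (\<lambda>x. c * f x) = c * pv M \<omega> f"
  unfolding pv_def by (simp add: proj_cmult sum_distrib_left mult_ac)

lemma pv_sum:
  assumes "\<And>j. j \<in> J \<Longrightarrow> hpoly (k j) (f j)"
  shows "pv M \<omega> (\<lambda>x. \<Sum>j\<in>J. f j x) = (\<Sum>j\<in>J. pv M \<omega> (f j))"
proof -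
  have "pv M \<omega> (\<lambda>x. \<Sum>j\<in>J. f j x)
      = (\<Sum>n\<in>{n. n \<le> M \<and> odd n}. \<Sum>j\<in>J. of_real (nu n DIM('a)) * proj n (f j) \<omega>)"
    unfolding pv_def by (simp add: proj_sum[OF assms] sum_distrib_left)
  also have "\<dots> = (\<Sum>j\<in>J. pv M \<omega> (f j))"
    unfolding pv_def by (rule sum.swap)
  finally show ?thesis .
qed

lemma pv_add:
  assumes "hpoly k f" "hpoly l g"
  shows "pv M \<omega> (\<lambda>x. f x + g x) = pv M \<omega> f + pv M \<omega> g"
  unfolding pv_def by (simp add: proj_add[OF assms] distrib_left sum.distrib)

lemma pv_harmonic:
  assumes "q \<in> harmonic_homogeneous n" "odd n" "n \<le> M"
  shows "pv M \<omega> q = of_real (nu n DIM('a)) * q \<omega>"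
proof -
  have "pv M \<omega> q = (\<Sum>k\<in>{n. n \<le> M \<and> odd n}. if k = n then of_real (nu n DIM('a)) * q \<omega> else 0)"
    unfolding pv_def by (intro sum.cong refl) (simp add: proj_harmonic[OF assms(1)])
  then show ?thesis using assms by (simp add: finite_odd)
qed

text \<open>On the sphere (x . \<omega>) h splits into harmonics of degrees J + 1 and J - 1, whose
  values at \<omega> are, by Euler's relation, J + d - 2 and J times the same number. For J > 0 they
  cancel by \<open>nu_rec\<close>, and the integral of h is 0; for J = 0 only the first is left and
  \<open>nu_1\<close> gives the constant.\<close>

lemma pv_inner_mult_harmonic:
  assumes dim3: "3 \<le> DIM('a)" and h: "h \<in> harmonic_homogeneous J" and J: "even J" "J < M" and \<omega>: "norm \<omega> = 1"
  shows "pv M \<omega> (\<lambda>x. of_real (x \<bullet> \<omega>) * h x)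
    = - sint h / (sint (\<lambda>x::'a. 1) * of_nat (dfact (DIM('a) - 2)))"
proof -
  obtain e where e: "DIM('a) = e + 3"
    using dim3 by (metis add.commute le_Suc_ex)
  let ?c = "of_nat (2 * J + DIM('a)) - 2 :: complex"
  let ?g = "\<lambda>x. of_real (x \<bullet> \<omega>) * h x - of_real (x \<bullet> x) * (dderiv \<omega> h x / ?c)"
  let ?f = "\<lambda>x. dderiv \<omega> h x / ?c"
  have c: "?c = of_nat (2 * J + e + 1)" by (simp add: e)
  have c0: "?c \<noteq> 0" unfolding c by (simp only: of_nat_eq_0_iff)
  have g: "?g \<in> harmonic_homogeneous (Suc J)"
    by (rule harmonic_inner_mult[OF h]) (use dim3 in simp)
  have f: "?f \<in> harmonic_homogeneous (J - 1)"
    using harmonic_cmult[OF harmonic_dderiv[OF h refl, of \<omega>], of "1 / ?c"] by simp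
  have f\<omega>: "?f \<omega> = of_nat J * h \<omega> / ?c"
    by (simp add: euler[OF harmonic_hpoly[OF h]])
  have g\<omega>: "?g \<omega> = of_nat (J + e + 1) * h \<omega> / ?c"
  proof -
    have "?g \<omega> = h \<omega> - of_nat J * h \<omega> / ?c"
      using \<omega> by (simp add: euler[OF harmonic_hpoly[OF h]] dot_square_norm)
    also have "\<dots> = (?c - of_nat J) * h \<omega> / ?c"
    proof -
      have "z - w * z / c = (c - w) * z / c" if "c \<noteq> 0" for z w c :: complex
        using that by (simp add: field_simps)
      from this[OF c0] show ?thesis .
    qed
    also have "?c - of_nat J = of_nat (J + e + 1)" unfolding c by simp
    finally show ?thesis .
  qed
  have "pv M \<omega> (\<lambda>x. of_real (x \<bullet> \<omega>) * h x) = pv M \<omega> (\<lambda>x. ?g x + ?f x)"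
    by (rule pv_cong) (simp add: on_sphere del: mem_sphere)
  also have "\<dots> = pv M \<omega> ?g + pv M \<omega> ?f"
    by (rule pv_add[OF harmonic_hpoly[OF g] harmonic_hpoly[OF f]])
  also have "pv M \<omega> ?g = of_real (nu (Suc J) DIM('a)) * ?g \<omega>"
    by (rule pv_harmonic[OF g]) (use J in auto)
  finally have main: "pv M \<omega> (\<lambda>x. of_real (x \<bullet> \<omega>) * h x)
      = of_real (nu (Suc J) DIM('a)) * (of_nat (J + e + 1) * h \<omega> / ?c) + pv M \<omega> ?f"
    unfolding g\<omega> .
  show ?thesis
  proof (cases "J = 0")
    case True
    have "dderiv \<omega> h x = 0" for x using harmonic_hpoly[OF h] True hpoly_0_dderiv by auto
    then have "pv M \<omega> ?f = 0" by (simp add: pv_def proj_def sint_def)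
    moreover have "sint h = h \<omega> * sint (\<lambda>x::'a. 1)"
      unfolding sint_cmult[symmetric]
      by (rule sint_cong) (use harmonic_hpoly[OF h] True hpoly_0_const[of h _ \<omega>] in simp)
    moreover have "sint (\<lambda>x::'a. 1) \<noteq> 0"
      unfolding sint_const using less_imp_neq[OF unit_ball_vol_pos[OF of_nat_0_le_iff], of "DIM('a)"] by simp
    moreover have "(of_nat (e + 1) :: complex) \<noteq> 0" by (simp only: of_nat_eq_0_iff)
    ultimately show ?thesis
      unfolding main c using True by (simp add: nu_1 e)
  next
    case False
    then obtain i where i: "J = 2 * i + 2" using J(1) by (metis evenE mult_Suc_right not0_implies_Suc add.commute mult_0_right)
    have "pv M \<omega> ?f = of_real (nu (J - 1) DIM('a)) * ?f \<omega>"
      by (rule pv_harmonic[OF f]) (use i J in auto)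
    also have "\<dots> = of_real (nu (2 * i + 1) (e + 3)) * (of_nat (2 * i + 2) * (h \<omega> / ?c))"
      unfolding f\<omega> by (simp add: i e)
    finally have pf: "pv M \<omega> ?f = of_real (nu (2 * i + 1) (e + 3)) * (of_nat (2 * i + 2) * (h \<omega> / ?c))" .
    have J': "Suc J = 2 * i + 3" "J + e + 1 = 2 * i + 3 + e" using i by simp_all
    have pg: "of_real (nu (Suc J) DIM('a)) * (of_nat (J + e + 1) * h \<omega> / ?c)
        = of_real (nu (2 * i + 3) (e + 3)) * (of_nat (2 * i + 3 + e) * (h \<omega> / ?c))"
      unfolding e J' times_divide_eq_right ..
    have "pv M \<omega> (\<lambda>x. of_real (x \<bullet> \<omega>) * h x)
        = of_real (real (2 * i + 2) * nu (2 * i + 1) (e + 3) + real (2 * i + 3 + e) * nu (2 * i + 3) (e + 3)) * (h \<omega> / ?c)"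
      unfolding main pf pg by (simp only: of_real_add of_real_mult of_real_of_nat_eq distrib_right distrib_left mult_ac add_ac)
    then have "pv M \<omega> (\<lambda>x. of_real (x \<bullet> \<omega>) * h x) = 0" unfolding nu_rec by simp
    moreover have "sint (\<lambda>x. h x * 1) = 0"
      by (rule harmonic_orthogonal_lower[OF dim h hpoly_const]) (use False in simp)
    ultimately show ?thesis by simp
  qed
qed

lemma pv_inner_mult:
  assumes dim3: "3 \<le> DIM('a)" and r: "hpoly J r" and J: "even J" "J < M" and \<omega>: "norm \<omega> = 1"
  shows "pv M \<omega> (\<lambda>x. of_real (x \<bullet> \<omega>) * r x)
    = - sint r / (sint (\<lambda>x::'a. 1) * of_nat (dfact (DIM('a) - 2)))"
proof -
  let ?C = "sint (\<lambda>x::'a. 1) * of_nat (dfact (DIM('a) - 2))"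
  obtain h where h: "\<And>j. j \<le> J div 2 \<Longrightarrow> h j \<in> harmonic_homogeneous (J - 2 * j)"
    "\<And>x. r x = (\<Sum>j\<le>J div 2. of_real (x \<bullet> x) ^ j * h j x)"
    using harmonic_decomposition[OF r] by blast
  have "pv M \<omega> (\<lambda>x. of_real (x \<bullet> \<omega>) * r x) = pv M \<omega> (\<lambda>x. \<Sum>j\<le>J div 2. of_real (x \<bullet> \<omega>) * h j x)"
    by (rule pv_cong) (simp add: h(2) on_sphere sum_distrib_left del: mem_sphere)
  also have "\<dots> = (\<Sum>j\<le>J div 2. pv M \<omega> (\<lambda>x. of_real (x \<bullet> \<omega>) * h j x))"
    by (rule pv_sum[where k = "\<lambda>j. Suc (J - 2 * j)"]) (intro hpoly_inner_mult harmonic_hpoly[OF h(1)], simp)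
  also have "\<dots> = (\<Sum>j\<le>J div 2. - sint (h j) / ?C)"
    by (intro sum.cong refl pv_inner_mult_harmonic[OF dim3 h(1) _ _ \<omega>]) (use J in auto)
  also have "\<dots> = - (\<Sum>j\<le>J div 2. sint (h j)) / ?C"
    by (simp add: sum_divide_distrib sum_negf)
  also have "(\<Sum>j\<le>J div 2. sint (h j)) = sint (\<lambda>x. \<Sum>j\<le>J div 2. h j x)"
    by (rule sint_sum[where n = "\<lambda>j. J - 2 * j", symmetric]) (intro harmonic_hpoly[OF h(1)], simp)
  also have "\<dots> = sint r"
    by (rule sint_cong) (simp add: h(2) on_sphere del: mem_sphere)
  finally show ?thesis .
qed

text \<open>Composed with the reflection, a harmonic decomposition of q is again one, so both
  compute the same number. But the reflection sends \<omega> to - \<omega> and all degrees are odd,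
  so the two numbers differ in sign.\<close>

lemma pv_reflect:
  assumes q: "hpoly K q" and K: "odd K" "K \<le> M" and \<omega>: "norm \<omega> = 1"
    and even: "\<And>x. q (squeeze \<omega> (-1) x) = q x"
  shows "pv M \<omega> q = 0"
proof -
  let ?R = "squeeze \<omega> (-1)"
  obtain h where h: "\<And>j. j \<le> K div 2 \<Longrightarrow> h j \<in> harmonic_homogeneous (K - 2 * j)"
    "\<And>x. q x = (\<Sum>j\<le>K div 2. of_real (x \<bullet> x) ^ j * h j x)"
    using harmonic_decomposition[OF q] by blast
  have expand: "pv M \<omega> q = (\<Sum>j\<le>K div 2. of_real (nu (K - 2 * j) DIM('a)) * g j \<omega>)"
    if g: "\<And>j. j \<le> K div 2 \<Longrightarrow> g j \<in> harmonic_homogeneous (K - 2 * j)"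
      "\<And>x. q x = (\<Sum>j\<le>K div 2. of_real (x \<bullet> x) ^ j * g j x)" for g
  proof -
    have "pv M \<omega> q = pv M \<omega> (\<lambda>x. \<Sum>j\<le>K div 2. g j x)"
      by (rule pv_cong) (simp add: g(2) on_sphere del: mem_sphere)
    also have "\<dots> = (\<Sum>j\<le>K div 2. pv M \<omega> (g j))"
      by (rule pv_sum[where k = "\<lambda>j. K - 2 * j"]) (intro harmonic_hpoly[OF g(1)], simp)
    also have "\<dots> = (\<Sum>j\<le>K div 2. of_real (nu (K - 2 * j) DIM('a)) * g j \<omega>)"
      by (intro sum.cong refl pv_harmonic[OF g(1)]) (use K in auto)
    finally show ?thesis .
  qed
  have R: "?R x \<bullet> ?R x = x \<bullet> x" for x by (simp add: squeeze_inner_squeeze[OF \<omega>])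
  have "q x = (\<Sum>j\<le>K div 2. of_real (x \<bullet> x) ^ j * h j (?R x))" for x
    using h(2)[of "?R x"] by (simp add: even R)
  then have "pv M \<omega> q = (\<Sum>j\<le>K div 2. of_real (nu (K - 2 * j) DIM('a)) * h j (?R \<omega>))"
    by (intro expand[of "\<lambda>j x. h j (?R x)"] harmonic_reflect[OF h(1) \<omega>])
  also have "\<dots> = (\<Sum>j\<le>K div 2. - (of_real (nu (K - 2 * j) DIM('a)) * h j \<omega>))"
  proof (intro sum.cong refl)
    fix j assume j: "j \<in> {..K div 2}"
    have "?R \<omega> = (-1) *\<^sub>R \<omega>"
      using \<omega> by (simp add: squeeze_def dot_square_norm scaleR_2)
    then have "h j (?R \<omega>) = of_real ((-1) ^ (K - 2 * j)) * h j \<omega>"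
      using j by (simp only: hpoly_homogeneous[OF harmonic_hpoly[OF h(1)]] atMost_iff)
    moreover have "odd (K - 2 * j)" using K j by auto
    ultimately show "of_real (nu (K - 2 * j) DIM('a)) * h j (?R \<omega>) = - (of_real (nu (K - 2 * j) DIM('a)) * h j \<omega>)"
      by simp
  qed
  also have "\<dots> = - pv M \<omega> q" by (simp add: expand[OF h] sum_negf)
  finally show ?thesis by simp
qed

text \<open>The double sum of the theorem without \<open>mu\<close>, with a replaced by any x.
  Through \<open>y\<close> it is a polynomial in x; n runs over all odd numbers up to the upper
  limit, the added ones contributing 0.\<close>

definition G :: "nat \<Rightarrow> nat \<Rightarrow> nat \<Rightarrow> 'a \<Rightarrow> 'a \<Rightarrow> complex" where
  "G m l k \<omega> x = (\<Sum>j=1..harm_dim (Suc m) DIM('a). cnj (y (Suc m) j x)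
     * pv (m + 1 + l) \<omega> (\<lambda>\<xi>. y (Suc m) j \<xi> * y l k \<xi>))"

lemma G_harmonic: "G m l k \<omega> \<in> harmonic_homogeneous (Suc m)"
  unfolding G_def[abs_def] mult.commute[of "cnj _"]
  by (intro harmonic_sum harmonic_cmult harmonic_cnj y_harmonic)

text \<open>Assembles kernels inside the functional: z is the conjugated basis at a point for the
  value of \<open>G\<close>, and its conjugated normal derivative for that of
  \<open>G\<close>.\<close>

lemma pv_kernel:
  assumes "k \<in> {1..harm_dim l DIM('a)}"
  shows "(\<Sum>j=1..harm_dim n DIM('a). z j * pv M \<omega> (\<lambda>\<xi>. y n j \<xi> * y l k \<xi>))
    = pv M \<omega> (\<lambda>\<xi>. (\<Sum>j=1..harm_dim n DIM('a). z j * y n j \<xi>) * y l k \<xi>)"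
proof -
  have "pv M \<omega> (\<lambda>\<xi>. \<Sum>j=1..harm_dim n DIM('a). z j * (y n j \<xi> * y l k \<xi>))
      = (\<Sum>j=1..harm_dim n DIM('a). pv M \<omega> (\<lambda>\<xi>. z j * (y n j \<xi> * y l k \<xi>)))"
    by (rule pv_sum[where k = "\<lambda>_. n + l"]) (intro hpoly_cmult hpoly_mult y_hpoly assms)
  then show ?thesis by (simp add: pv_cmult sum_distrib_right mult.assoc)
qed

text \<open>The Gaunt coefficients are the coordinates of the product of two harmonics, so the sum
  over i is its projection onto degree n.\<close>

lemma gaunt_expansion:
  assumes k: "k \<in> {1..harm_dim l DIM('a)}" and a: "a \<in> sphere 0 1" and \<omega>: "\<omega> \<in> sphere 0 1"
  shows "(\<Sum>j=1..harm_dim (m + 1) DIM('a). cnj (Y (m + 1) j a) *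
       (\<Sum>n\<in>{n \<in> {m + 1 - l..m + 1 + l}. odd n}. of_real (nu n DIM('a)) *
          (\<Sum>i=1..harm_dim n DIM('a). gaunt Y n i (m + 1) j l k * Y n i \<omega>))) = G m l k \<omega> a"
  unfolding G_def Suc_eq_plus1
proof (intro sum.cong refl)
  fix j assume j: "j \<in> {1..harm_dim (m + 1) DIM('a)}"
  let ?q = "\<lambda>\<xi>. y (m + 1) j \<xi> * y l k \<xi>"
  have 1: "(\<Sum>i=1..harm_dim n DIM('a). gaunt Y n i (m + 1) j l k * Y n i \<omega>) = proj n ?q \<omega>" for n
    unfolding proj_def
  proof (intro sum.cong refl)
    fix i assume i: "i \<in> {1..harm_dim n DIM('a)}"
    have "gaunt Y n i (m + 1) j l k = sint (\<lambda>\<xi>. ?q \<xi> * cnj (y n i \<xi>))"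
      unfolding gaunt_def sint_def[symmetric]
      by (rule sint_cong) (simp only: Y_eq_y[OF i] Y_eq_y[OF j] Y_eq_y[OF k])
    then show "gaunt Y n i (m + 1) j l k * Y n i \<omega> = sint (\<lambda>\<xi>. ?q \<xi> * cnj (y n i \<xi>)) * y n i \<omega>"
      by (simp only: Y_eq_y[OF i \<omega>])
  qed
  have "(\<Sum>n\<in>{n \<in> {m + 1 - l..m + 1 + l}. odd n}. of_real (nu n DIM('a)) * proj n ?q \<omega>) = pv (m + 1 + l) \<omega> ?q"
    unfolding pv_def
  proof (rule sum.mono_neutral_left[OF finite_odd])
    show "\<forall>n\<in>{n. n \<le> m + 1 + l \<and> odd n} - {n \<in> {m + 1 - l..m + 1 + l}. odd n}.
        complex_of_real (nu n DIM('a)) * proj n ?q \<omega> = 0"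
    proof
      fix n assume "n \<in> {n. n \<le> m + 1 + l \<and> odd n} - {n \<in> {m + 1 - l..m + 1 + l}. odd n}"
      then have "n + l < m + 1" by auto
      then show "complex_of_real (nu n DIM('a)) * proj n ?q \<omega> = 0"
        by (simp only: proj_eq_0_if_lower[OF y_harmonic[OF j] y_hpoly[OF k]] mult_zero_right)
    qed
  qed auto
  then show "cnj (Y (m + 1) j a) * (\<Sum>n\<in>{n \<in> {m + 1 - l..m + 1 + l}. odd n}. of_real (nu n DIM('a)) *
          (\<Sum>i=1..harm_dim n DIM('a). gaunt Y n i (m + 1) j l k * Y n i \<omega>))
      = cnj (y (m + 1) j a) * pv (m + 1 + l) \<omega> ?q"
    unfolding 1 by (simp only: Y_eq_y[OF j a])
qed

text \<open>The value at a is \<open>pv\<close> of kernel times y. The part of y that is constant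
  along \<omega> makes this product even under reflection; the rest is x . \<omega> times the kernel
  times a polynomial of lower degree, whose integral vanishes. For the derivative,
  \<open>kernel_dderiv_eq\<close> supplies the factor x . \<omega> directly.\<close>

lemma G_cauchy_data:
  assumes dim3: "3 \<le> DIM('a)" and k: "k \<in> {1..harm_dim l DIM('a)}" and l: "l \<le> m" "even (l + m)"
    and \<omega>: "norm \<omega> = 1" and a: "a \<in> sphere 0 1" "a \<bullet> \<omega> = 0"
  shows G_orthogonal: "G m l k \<omega> a = 0"
    and G_dderiv: "dderiv \<omega> (G m l k \<omega>) a
      = - (of_nat (2 * m + DIM('a)) / (sint (\<lambda>x::'a. 1) * of_nat (dfact (DIM('a) - 2)))) * y l k a"
proof -
  let ?M = "m + 1 + l"
  let ?C = "sint (\<lambda>x::'a. 1) * of_nat (dfact (DIM('a) - 2))"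
  let ?z = "kernel (Suc m) a"
  let ?y = "y l k"
  have yh: "hpoly l ?y" by (rule y_hpoly[OF k])
  have z: "hpoly (Suc m) ?z" by (rule harmonic_hpoly[OF kernel_harmonic])
  obtain C where C: "hpoly (l - 1) C" "l = 0 \<Longrightarrow> C = (\<lambda>x. 0)"
    "\<And>x. ?y x = ?y (squeeze \<omega> 0 x) + of_real (x \<bullet> \<omega>) * C x"
    using hpoly_divide[OF yh \<omega>] by blast
  let ?p = "\<lambda>x. ?z x * ?y (squeeze \<omega> 0 x)"
  let ?r = "\<lambda>x. of_real (x \<bullet> \<omega>) * (?z x * C x)"
  have p: "hpoly ?M ?p"
    using hpoly_mult[OF z hpoly_linear[OF yh linear_squeeze]] by simp
  have zC: "hpoly (Suc m + (l - 1)) (\<lambda>x. ?z x * C x)"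
    by (rule hpoly_mult[OF z C(1)])
  have "G m l k \<omega> a = pv ?M \<omega> (\<lambda>\<xi>. ?z \<xi> * ?y \<xi>)"
    unfolding G_def pv_kernel[OF k] kernel_def ..
  also have "\<dots> = pv ?M \<omega> (\<lambda>x. ?p x + ?r x)"
    by (rule pv_cong) (subst C(3), simp add: algebra_simps)
  also have "\<dots> = pv ?M \<omega> ?p + pv ?M \<omega> ?r"
    by (rule pv_add[OF p hpoly_inner_mult[OF zC]])
  also have "pv ?M \<omega> ?p = 0"
    by (rule pv_reflect[OF p _ order_refl \<omega>])
       (use l(2) in \<open>simp_all add: kernel_reflect[OF \<omega> a] squeeze_squeeze[OF \<omega>] add.commute\<close>)
  also have "pv ?M \<omega> ?r = 0"
  proof (cases "l = 0")
    case True
    then show ?thesis by (simp add: C(2) pv_def proj_def sint_def)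
  next
    case False
    have "pv ?M \<omega> ?r = - sint (\<lambda>x. ?z x * C x) / ?C"
      by (rule pv_inner_mult[OF dim3 zC _ _ \<omega>]) (use False l in auto)
    also have "sint (\<lambda>x. ?z x * C x) = 0"
      by (rule harmonic_orthogonal_lower[OF dim kernel_harmonic C(1)]) (use False l in auto)
    finally show ?thesis by simp
  qed
  finally show "G m l k \<omega> a = 0" by simp
  let ?k = "\<lambda>x. \<Sum>j=1..harm_dim (Suc m) DIM('a). cnj (dderiv \<omega> (y (Suc m) j) a) * y (Suc m) j x"
  let ?K = "poly_kernel m a"
  have "dderiv \<omega> (G m l k \<omega>) a = (\<Sum>j=1..harm_dim (Suc m) DIM('a).
     dderiv \<omega> (\<lambda>x. pv ?M \<omega> (\<lambda>\<xi>. y (Suc m) j \<xi> * ?y \<xi>) * cnj (y (Suc m) j x)) a)"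
    unfolding G_def[abs_def] mult.commute[of "cnj _"]
    by (rule dderiv_sum[OF hpoly_cmult[OF hpoly_cnj[OF y_hpoly]]])
  also have "\<dots> = (\<Sum>j=1..harm_dim (Suc m) DIM('a). cnj (dderiv \<omega> (y (Suc m) j) a)
     * pv ?M \<omega> (\<lambda>\<xi>. y (Suc m) j \<xi> * ?y \<xi>))"
    by (intro sum.cong refl)
       (simp add: dderiv_cmult[OF hpoly_cnj[OF y_hpoly]] dderiv_cnj[OF y_hpoly])
  also have "\<dots> = pv ?M \<omega> (\<lambda>\<xi>. ?k \<xi> * ?y \<xi>)" by (rule pv_kernel[OF k])
  also have "\<dots> = pv ?M \<omega> (\<lambda>x. of_nat (2 * m + DIM('a)) * (of_real (x \<bullet> \<omega>) * (?K x * ?y x)))"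
    by (rule pv_cong) (simp only: kernel_dderiv_eq[OF a], simp add: mult_ac)
  also have "\<dots> = of_nat (2 * m + DIM('a)) * (- sint (\<lambda>x. ?K x * ?y x) / ?C)"
    unfolding pv_cmult
    by (subst pv_inner_mult[OF dim3 hpoly_mult[OF poly_kernel_hpoly yh] _ _ \<omega>]) (use l in auto)
  also have "sint (\<lambda>x. ?K x * ?y x) = ?y a"
  proof -
    \<comment> \<open>This power of x . x raises y from degree l to the degree m at which the kernel
      reproduces.\<close>
    let ?i = "(m - l) div 2"
    have "hpoly m (\<lambda>x. of_real (x \<bullet> x) ^ ?i * ?y x)"
      by (rule hpoly_sqnorm_power_mult[OF yh]) (use l in auto)
    from poly_kernel_reproducing[OF this a(1)]
    have "sint (\<lambda>x. ?K x * (of_real (x \<bullet> x) ^ ?i * ?y x)) = ?y a" by (simp add: on_sphere[OF a(1)])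
    moreover have "sint (\<lambda>x. ?K x * (of_real (x \<bullet> x) ^ ?i * ?y x)) = sint (\<lambda>x. ?K x * ?y x)"
      by (rule sint_cong) (simp add: on_sphere del: mem_sphere)
    ultimately show ?thesis by simp
  qed
  finally show "dderiv \<omega> (G m l k \<omega>) a = - (of_nat (2 * m + DIM('a)) / ?C) * ?y a" by simp
qed

end

section \<open>Integrals over chords\<close>

text \<open>The coefficient of z^j in the Jacobi polynomial with parameters 0 and \<beta> at 2 z -
  1.\<close>

definition jacobi_coeff :: "nat \<Rightarrow> real \<Rightarrow> nat \<Rightarrow> real" where
  "jacobi_coeff n \<beta> j = (-1) ^ (n - j) * real (n choose j) * ((real (n + j) + \<beta>) gchoose n)"

text \<open>Expanding (z - 1)^i in the explicit formula leaves, at each power of z, a sum over i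
  that Vandermonde's convolution evaluates.\<close>

lemma jacobi_expand: "jacobi n 0 \<beta> (2 * s\<^sup>2 - 1) = (\<Sum>j\<le>n. jacobi_coeff n \<beta> j * (s\<^sup>2) ^ j)"
proof -
  define z where "z = s\<^sup>2"
  have x: "(2 * s\<^sup>2 - 1 - 1) / 2 = z - 1" "(2 * s\<^sup>2 - 1 + 1) / 2 = z" by (simp_all add: z_def)
  have pow: "(z - 1) ^ i * z ^ (n - i) = (\<Sum>k\<le>n. real (i choose k) * (-1) ^ k * z ^ (n - k))" if "i \<le> n" for i
  proof -
    have "(z - 1) ^ i = (\<Sum>k\<le>i. real (i choose k) * (-1) ^ k * z ^ (i - k))"
      using binomial_ring[of "-1" z i] by simp
    then have "(z - 1) ^ i * z ^ (n - i) = (\<Sum>k\<le>i. real (i choose k) * (-1) ^ k * (z ^ (i - k) * z ^ (n - i)))"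
      by (simp add: sum_distrib_right mult.assoc)
    also have "\<dots> = (\<Sum>k\<le>i. real (i choose k) * (-1) ^ k * z ^ (n - k))"
      using that by (intro sum.cong refl) (simp add: power_add[symmetric])
    also have "\<dots> = (\<Sum>k\<le>n. real (i choose k) * (-1) ^ k * z ^ (n - k))"
      using that by (intro sum.mono_neutral_left) auto
    finally show ?thesis .
  qed
  have gb: "(real n + 0) gchoose (n - i) = real (n choose i)" if "i \<le> n" for i
    using that by (simp add: binomial_gbinomial[symmetric] binomial_symmetric[symmetric])
  have "jacobi n 0 \<beta> (2 * s\<^sup>2 - 1)
      = (\<Sum>i\<le>n. real (n choose i) * ((real n + \<beta>) gchoose i) * ((z - 1) ^ i * z ^ (n - i)))"
    unfolding jacobi_def x by (intro sum.cong refl) (simp add: gb[unfolded add_0_right] mult.assoc)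
  also have "\<dots> = (\<Sum>i\<le>n. \<Sum>k\<le>n. (-1) ^ k * z ^ (n - k) *
      (((real n + \<beta>) gchoose i) * (real (n choose i) * real (i choose k))))"
  proof (intro sum.cong refl)
    fix i assume "i \<in> {..n}"
    then have i: "i \<le> n" by simp
    show "real (n choose i) * ((real n + \<beta>) gchoose i) * ((z - 1) ^ i * z ^ (n - i))
        = (\<Sum>k\<le>n. (-1) ^ k * z ^ (n - k) * (((real n + \<beta>) gchoose i) * (real (n choose i) * real (i choose k))))"
      unfolding pow[OF i] sum_distrib_left by (intro sum.cong refl) (simp only: mult_ac)
  qed
  also have "\<dots> = (\<Sum>k\<le>n. \<Sum>i\<le>n. (-1) ^ k * z ^ (n - k) *
      (((real n + \<beta>) gchoose i) * (real (n choose i) * real (i choose k))))"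
    by (rule sum.swap)
  also have "\<dots> = (\<Sum>k\<le>n. (-1) ^ k * z ^ (n - k) * (real (n choose k) * ((real (2 * n - k) + \<beta>) gchoose n)))"
  proof (intro sum.cong refl)
    fix k assume "k \<in> {..n}"
    then have k: "k \<le> n" by simp
    \<comment> \<open>Trinomial revision, with the lower index n - i that Vandermonde asks for; if i
      < k both sides are 0.\<close>
    have c: "real (n choose i) * real (i choose k) = real (n choose k) * (real (n - k) gchoose (n - i))" if "i \<le> n" for i
    proof (cases "k \<le> i")
      case True
      have "(n choose i) * (i choose k) = (n choose k) * ((n - k) choose (i - k))"
        by (rule choose_mult[OF True that])
      also have "(n - k) choose (i - k) = (n - k) choose (n - i)"
        using True that by (subst binomial_symmetric) auto
      finally show ?thesis by (simp only: of_nat_mult[symmetric] binomial_gbinomial[symmetric])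
    next
      case False
      then have "i choose k = 0" "(n - k) choose (n - i) = 0" using that k by auto
      then show ?thesis by (simp only: binomial_gbinomial[symmetric] of_nat_0 mult_zero_right)
    qed
    have "(\<Sum>i\<le>n. ((real n + \<beta>) gchoose i) * (real (n choose i) * real (i choose k)))
        = real (n choose k) * (\<Sum>i=0..n. ((real n + \<beta>) gchoose i) * (real (n - k) gchoose (n - i)))"
      unfolding sum_distrib_left atMost_atLeast0
    proof (intro sum.cong refl)
      fix i assume "i \<in> {0..n}"
      then have i: "i \<le> n" by simp
      show "((real n + \<beta>) gchoose i) * (real (n choose i) * real (i choose k))
          = real (n choose k) * (((real n + \<beta>) gchoose i) * (real (n - k) gchoose (n - i)))"
        unfolding c[OF i] by (simp only: mult_ac)
    qed
    also have "(\<Sum>i=0..n. ((real n + \<beta>) gchoose i) * (real (n - k) gchoose (n - i)))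
        = (real n + \<beta> + real (n - k)) gchoose n"
      by (rule gbinomial_Vandermonde)
    also have "real n + \<beta> + real (n - k) = real (2 * n - k) + \<beta>" using k by simp
    finally show "(\<Sum>i\<le>n. (-1) ^ k * z ^ (n - k) *
        (((real n + \<beta>) gchoose i) * (real (n choose i) * real (i choose k))))
        = (-1) ^ k * z ^ (n - k) * (real (n choose k) * ((real (2 * n - k) + \<beta>) gchoose n))"
      unfolding sum_distrib_left[symmetric] by simp
  qed
  also have "\<dots> = (\<Sum>j\<le>n. jacobi_coeff n \<beta> j * z ^ j)"
  proof (rule sum.reindex_bij_witness[of _ "\<lambda>j. n - j" "\<lambda>k. n - k"])
    fix k assume "k \<in> {..n}"
    then have k: "k \<le> n" by simp
    have "n + (n - k) = 2 * n - k" "n - (n - k) = k" using k by auto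
    then show "jacobi_coeff n \<beta> (n - k) * z ^ (n - k)
        = (-1) ^ k * z ^ (n - k) * (real (n choose k) * ((real (2 * n - k) + \<beta>) gchoose n))"
      unfolding jacobi_coeff_def binomial_symmetric[OF k, symmetric] by simp
  qed auto
  finally show ?thesis by (simp add: z_def)
qed

text \<open>The value at the end point 1. By \<open>chord_poly_dderiv\<close> it is the factor in
  the normal derivative of the chord integral.\<close>

lemma sum_jacobi_coeff: "(\<Sum>j\<le>n. jacobi_coeff n \<beta> j) = 1"
proof -
  have "jacobi n 0 \<beta> 1 = 1"
    unfolding jacobi_1 by (simp add: binomial_gbinomial[symmetric])
  then show ?thesis using jacobi_expand[of n \<beta> 1] by simp
qed

text \<open>In the form needed for \<open>chord_poly_harmonic\<close>: up to a common 4, the factors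
  are those that the Laplacian produces when \<beta> = l + (d - 2) / 2.\<close>

lemma jacobi_coeff_rec:
  assumes "j < n"
  shows "jacobi_coeff n \<beta> (Suc j) * (real (Suc j) * (real (Suc j) + \<beta>))
    + jacobi_coeff n \<beta> j * (real (n - j) * (real (n + Suc j) + \<beta>)) = 0"
proof -
  have 1: "real (Suc j) * real (n choose Suc j) = real (n - j) * real (n choose j)"
    using binomial_absorb_comp[of n j] binomial_absorption[of j n] by (metis of_nat_mult)
  have 2: "(real (Suc j) + \<beta>) * ((real (n + Suc j) + \<beta>) gchoose n)
      = (real (n + Suc j) + \<beta>) * ((real (n + j) + \<beta>) gchoose n)"
    using gbinomial_absorb_comp[of "real (n + Suc j) + \<beta>" n] by (simp add: add_ac)
  have 3: "(-1::real) ^ (n - j) = - ((-1) ^ (n - Suc j))"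
    using assms by (metis Suc_diff_Suc power_Suc mult_minus1)
  have "jacobi_coeff n \<beta> (Suc j) * (real (Suc j) * (real (Suc j) + \<beta>))
      = (-1) ^ (n - Suc j) * (real (Suc j) * real (n choose Suc j))
        * ((real (Suc j) + \<beta>) * ((real (n + Suc j) + \<beta>) gchoose n))"
    unfolding jacobi_coeff_def by (simp only: mult_ac)
  also have "\<dots> = (-1) ^ (n - Suc j) * (real (n - j) * real (n choose j))
        * ((real (n + Suc j) + \<beta>) * ((real (n + j) + \<beta>) gchoose n))"
    unfolding 1 2 ..
  also have "\<dots> = - (jacobi_coeff n \<beta> j * (real (n - j) * (real (n + Suc j) + \<beta>)))"
    unfolding jacobi_coeff_def 3 by (simp add: mult_ac)
  finally show ?thesis by simp
qed

section \<open>The chord integral as a harmonic polynomial\<close>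

lemma avg_cmult: "avg \<omega> (\<lambda>x. c * f x) x = c * avg \<omega> f x"
  by (simp add: avg_def)

text \<open>Up to homogenisation, half the integral of \<open>\<Sum>j\<le>n. c j * (x \<bullet> x) ^ j * p x\<close> over the chord from
  the mirror image of \<open>x\<close> to \<open>x\<close>; see \<open>chord_poly_sphere\<close>.\<close>

definition chord_poly :: "nat \<Rightarrow> (nat \<Rightarrow> real) \<Rightarrow> ('a::euclidean_space \<Rightarrow> complex) \<Rightarrow> 'a \<Rightarrow> 'a \<Rightarrow> complex" where
  "chord_poly n c p \<omega> x = (\<Sum>j\<le>n. of_real (c j) * (of_real (x \<bullet> x) ^ (n - j)
     * (of_real (x \<bullet> \<omega>) * avg \<omega> (\<lambda>x. of_real (x \<bullet> x) ^ j * p x) x)))"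

context
  fixes n l :: nat and c :: "nat \<Rightarrow> real" and p :: "'a::euclidean_space \<Rightarrow> complex" and \<omega> :: 'a
  assumes p: "p \<in> harmonic_homogeneous l" and \<omega>: "norm \<omega> = 1"
begin

private definition q :: "nat \<Rightarrow> 'a \<Rightarrow> complex" where "q j x = of_real (x \<bullet> x) ^ j * p x"
private definition P :: "nat \<Rightarrow> 'a \<Rightarrow> complex" where "P j x = of_real (x \<bullet> \<omega>) * avg \<omega> (q j) x"

private lemma q: "hpoly (2 * j + l) (q j)"
  unfolding q_def[abs_def] by (rule hpoly_sqnorm_power_mult[OF harmonic_hpoly[OF p] refl])

private lemma avg_q: "hpoly (2 * j + l) (avg \<omega> (q j))"
  by (rule hpoly_avg[OF q \<omega>])

private lemma P: "hpoly (Suc (2 * j + l)) (P j)"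
  unfolding P_def[abs_def] by (rule hpoly_inner_mult[OF avg_q])

text \<open>Inherited from \<open>q j\<close>, because chord integrals commute with the
  Laplacian.\<close>

private lemma laplacian_P:
  "laplacian (P j) x = of_nat (2 * j) * (of_nat (2 * j + 2 * l + DIM('a)) - 2) * P (j - 1) x"
proof -
  let ?k = "of_nat (2 * j) * (of_nat (2 * j + 2 * l + DIM('a)) - 2) :: complex"
  have "laplacian (q j) = (\<lambda>x. ?k * q (j - 1) x)"
    unfolding q_def[abs_def]
    by (rule ext) (simp only: laplacian_sqnorm_power_mult[OF harmonic_hpoly[OF p]] harmonic_laplacian[OF p]
        mult_zero_right add_0_left)
  then show ?thesis
    unfolding P_def[abs_def] laplacian_inner_mult_avg[OF q \<omega>]
    by (simp only: avg_cmult) (simp only: mult_ac)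
qed

private lemma chord_poly_eq: "chord_poly n c p \<omega> x = (\<Sum>j\<le>n. of_real (c j) * (of_real (x \<bullet> x) ^ (n - j) * P j x))"
  unfolding chord_poly_def P_def q_def[abs_def] ..

private lemma chord_term: "j \<le> n \<Longrightarrow> hpoly (Suc (2 * n + l)) (\<lambda>x. of_real (x \<bullet> x) ^ (n - j) * P j x)"
  by (rule hpoly_sqnorm_power_mult[OF P]) auto

lemma hpoly_chord_poly: "hpoly (Suc (2 * n + l)) (chord_poly n c p \<omega>)"
  unfolding chord_poly_eq[abs_def] by (intro hpoly_sum hpoly_cmult chord_term) simp

lemma chord_poly_harmonic:
  assumes rec: "\<And>j. j < n \<Longrightarrow> c (Suc j) * (real (Suc j) * (real (Suc j) + (real l + (real DIM('a) - 2) / 2)))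
    + c j * (real (n - j) * (real (n + Suc j) + (real l + (real DIM('a) - 2) / 2))) = 0"
  shows "chord_poly n c p \<omega> \<in> harmonic_homogeneous (Suc (2 * n + l))"
proof -
  have "laplacian (chord_poly n c p \<omega>) x = 0" for x
  proof -
    let ?r = "complex_of_real (x \<bullet> x)"
    let ?d = "real DIM('a)"
    \<comment> \<open>The Laplacian of the j-th term has a part in \<open>P (j - 1)\<close> with
      coefficient A j and one in \<open>P j\<close> with coefficient B j. After an index shift A (j
      + 1) and B j multiply the same function, and their sum is 4 times the recursion.\<close>
    define A where "A j = c j * (2 * real j * (2 * real j + 2 * real l + ?d - 2))" for j
    define B where "B j = c j * (2 * real (n - j) * (2 * real n + 2 * real j + 2 * real l + ?d))" for j
    have AB: "A (Suc j) + B j = 0" if "j < n" for j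
      using rec[OF that] that unfolding A_def B_def by (simp add: field_simps)
    have "laplacian (chord_poly n c p \<omega>) x
        = (\<Sum>j\<le>n. laplacian (\<lambda>x. of_real (c j) * (of_real (x \<bullet> x) ^ (n - j) * P j x)) x)"
      unfolding chord_poly_eq[abs_def]
      by (rule laplacian_sum[where n = "Suc (2 * n + l)"]) (intro hpoly_cmult chord_term, simp)
    also have "\<dots> = (\<Sum>j\<le>n. of_real (A j) * (?r ^ (n - j) * P (j - 1) x) + of_real (B j) * (?r ^ (n - j - 1) * P j x))"
    proof (intro sum.cong refl)
      fix j assume j: "j \<in> {..n}"
      have e: "real (2 * (n - j) + 2 * Suc (2 * j + l) + DIM('a)) - 2 = 2 * real n + 2 * real j + 2 * real l + ?d"
        using j by simp
      have "laplacian (\<lambda>x. of_real (c j) * (of_real (x \<bullet> x) ^ (n - j) * P j x)) x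
          = of_real (c j) * (?r ^ (n - j) * (of_real (2 * real j * (real (2 * j + 2 * l + DIM('a)) - 2)) * P (j - 1) x)
            + of_real (2 * real (n - j) * (real (2 * (n - j) + 2 * Suc (2 * j + l) + DIM('a)) - 2)) * (?r ^ (n - j - 1) * P j x))"
        using j by (simp add: laplacian_cmult[OF chord_term] laplacian_sqnorm_power_mult[OF P] laplacian_P)
      then show "laplacian (\<lambda>x. of_real (c j) * (of_real (x \<bullet> x) ^ (n - j) * P j x)) x
          = of_real (A j) * (?r ^ (n - j) * P (j - 1) x) + of_real (B j) * (?r ^ (n - j - 1) * P j x)"
        unfolding e A_def B_def by (simp add: algebra_simps)
    qed
    also have "\<dots> = (\<Sum>j\<le>n. of_real (A j) * (?r ^ (n - j) * P (j - 1) x)) + (\<Sum>j\<le>n. of_real (B j) * (?r ^ (n - j - 1) * P j x))"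
      by (rule sum.distrib)
    also have "(\<Sum>j\<le>n. of_real (A j) * (?r ^ (n - j) * P (j - 1) x))
        = (\<Sum>j<n. of_real (A (Suc j)) * (?r ^ (n - Suc j) * P j x))"
      using sum.lessThan_Suc_shift[of "\<lambda>j. of_real (A j) * (?r ^ (n - j) * P (j - 1) x)" n]
      by (simp add: lessThan_Suc_atMost A_def)
    also have "(\<Sum>j\<le>n. of_real (B j) * (?r ^ (n - j - 1) * P j x)) = (\<Sum>j<n. of_real (B j) * (?r ^ (n - Suc j) * P j x))"
      by (simp add: lessThan_Suc_atMost[symmetric] B_def)
    also have "(\<Sum>j<n. of_real (A (Suc j)) * (?r ^ (n - Suc j) * P j x)) + (\<Sum>j<n. of_real (B j) * (?r ^ (n - Suc j) * P j x))
        = (\<Sum>j<n. of_real (A (Suc j) + B j) * (?r ^ (n - Suc j) * P j x))"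
      unfolding sum.distrib[symmetric] of_real_add distrib_right ..
    also have "\<dots> = 0" by (simp add: AB del: of_real_add)
    finally show ?thesis .
  qed
  then show ?thesis using hpoly_chord_poly by (simp add: harmonic_homogeneous_iff)
qed

lemma chord_poly_orthogonal: "x \<bullet> \<omega> = 0 \<Longrightarrow> chord_poly n c p \<omega> x = 0"
  by (simp add: chord_poly_def)

text \<open>On the hyperplane the segment shrinks to a point, so the mean is the value there, and
  only the derivative of the factor x . \<omega> survives.\<close>

lemma chord_poly_dderiv:
  assumes x: "x \<bullet> \<omega> = 0" "x \<in> sphere 0 1"
  shows "dderiv \<omega> (chord_poly n c p \<omega>) x = of_real (\<Sum>j\<le>n. c j) * p x"
proof -
  have "dderiv \<omega> (chord_poly n c p \<omega>) x
      = (\<Sum>j\<le>n. dderiv \<omega> (\<lambda>x. of_real (c j) * (of_real (x \<bullet> x) ^ (n - j) * P j x)) x)"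
    unfolding chord_poly_eq[abs_def]
    by (rule dderiv_sum[where n = "Suc (2 * n + l)"]) (intro hpoly_cmult chord_term, simp)
  also have "\<dots> = (\<Sum>j\<le>n. of_real (c j) * p x)"
  proof (intro sum.cong refl)
    fix j assume j: "j \<in> {..n}"
    have "P j x = 0" by (simp add: P_def x(1))
    moreover have "dderiv \<omega> (P j) x = p x"
      using dderiv_inner_mult[OF avg_q, of \<omega> \<omega> j x] x \<omega>
      by (simp add: P_def[abs_def] avg_orthogonal q_def on_sphere dot_square_norm)
    ultimately show "dderiv \<omega> (\<lambda>x. of_real (c j) * (of_real (x \<bullet> x) ^ (n - j) * P j x)) x = of_real (c j) * p x"
      using j by (simp add: dderiv_cmult[OF chord_term] dderiv_mult[OF hpoly_sqnorm_power P] on_sphere[OF x(2)])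
  qed
  finally show ?thesis by (simp add: sum_distrib_right)
qed

lemma chord_poly_sphere:
  assumes x: "x \<in> sphere 0 1"
  shows "chord_poly n c p \<omega> x = of_real (x \<bullet> \<omega>) *
    integral {-1..1} (\<lambda>s. \<Sum>j\<le>n. of_real (c j) * (of_real (squeeze \<omega> s x \<bullet> squeeze \<omega> s x) ^ j * p (squeeze \<omega> s x))) / 2"
proof -
  have "integral {-1..1} (\<lambda>s. \<Sum>j\<le>n. of_real (c j) * q j (squeeze \<omega> s x))
      = (\<Sum>j\<le>n. of_real (c j) * integral {-1..1} (\<lambda>s. q j (squeeze \<omega> s x)))"
    using squeeze_integrable[OF q]
    by (subst integral_sum) (auto intro: integrable_on_mult_right)
  then show ?thesis
    unfolding chord_poly_eq P_def avg_def q_def[symmetric] on_sphere[OF x]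
    by (simp add: sum_distrib_left sum_divide_distrib mult_ac)
qed

end

text \<open>The line through the point \<open>a\<close> of the sphere leaves the ball at the mirror image of \<open>a\<close>, so a
  cone-beam integral is either trivial or the integral over a whole chord.\<close>

lemma cone_beam_chord:
  fixes f g :: "'a::euclidean_space \<Rightarrow> complex"
  assumes a: "norm a = 1" and \<omega>: "norm \<omega> = 1" and g: "continuous_on UNIV g"
    and f: "\<And>x. f x = (if norm x \<le> 1 then g x else 0)"
  shows "cone_beam f a \<omega> = (if a \<bullet> \<omega> < 0
    then - of_real (a \<bullet> \<omega>) * integral {-1..1} (\<lambda>s. g (squeeze \<omega> s a)) else 0)"
proof -
  let ?c = "a \<bullet> \<omega>"
  let ?F = "\<lambda>t. g (a + t *\<^sub>R \<omega>)"
  have norm_iff: "norm (a + t *\<^sub>R \<omega>) \<le> 1 \<longleftrightarrow> t * (t + 2 * ?c) \<le> 0" for t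
  proof -
    have "(norm (a + t *\<^sub>R \<omega>))\<^sup>2 = 1 + t * (t + 2 * ?c)"
      unfolding power2_norm_eq_inner using a \<omega>
      by (simp add: inner_simps norm_eq_1 inner_commute algebra_simps)
    moreover have "norm (a + t *\<^sub>R \<omega>) \<le> 1 \<longleftrightarrow> (norm (a + t *\<^sub>R \<omega>))\<^sup>2 \<le> 1"
      by (simp add: power2_le_iff_abs_le abs_square_le_1)
    ultimately show ?thesis by simp
  qed
  have cF: "continuous_on S ?F" for S
    by (rule continuous_on_compose2[OF g]) (auto intro!: continuous_intros)
  have [measurable]: "?F \<in> borel_measurable borel"
    by (rule borel_measurable_continuous_onI[OF cF])
  \<comment> \<open>The point t = 0 is left out: for a . \<omega> > 0 the ray meets the ball in a
    alone, while the interval on the right is empty.\<close>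
  have ind: "indicator {0..} t *\<^sub>R f (a + t *\<^sub>R \<omega>) = indicator {0..-2 * ?c} t *\<^sub>R ?F t" if "t \<noteq> 0" for t :: real
  proof (cases "t > 0")
    case True
    then have "t * (t + 2 * ?c) \<le> 0 \<longleftrightarrow> t \<le> -2 * ?c" by (auto simp: mult_le_0_iff)
    then show ?thesis using True by (simp add: f norm_iff indicator_def)
  qed (use that in \<open>auto simp: indicator_def\<close>)
  have eq: "(\<lambda>t. indicator {0..} t *\<^sub>R f (a + t *\<^sub>R \<omega>))
      = (\<lambda>t. if t = 0 then g a else indicator {0..-2 * ?c} t *\<^sub>R ?F t)"
    using ind a by (auto simp: fun_eq_iff f)
  have "cone_beam f a \<omega> = (LINT t|lborel. indicator {0..-2 * ?c} t *\<^sub>R ?F t)"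
    unfolding cone_beam_def set_lebesgue_integral_def
  proof (rule integral_cong_AE)
    show "AE t in lborel. indicat_real {0..} t *\<^sub>R f (a + t *\<^sub>R \<omega>) = indicat_real {0..-2 * ?c} t *\<^sub>R ?F t"
      using AE_lborel_singleton[of "0::real"] by eventually_elim (rule ind)
    show "(\<lambda>t. indicat_real {0..} t *\<^sub>R f (a + t *\<^sub>R \<omega>)) \<in> borel_measurable lborel"
      unfolding eq measurable_lborel1 by measurable
  qed measurable
  also have "\<dots> = integral {0..-2 * ?c} ?F"
    unfolding set_lebesgue_integral_def[symmetric]
    by (rule set_borel_integral_eq_integral(2)) (rule borel_integrable_atLeastAtMost', rule cF)
  also have "\<dots> = (if ?c < 0 then - of_real ?c * integral {-1..1} (\<lambda>s. g (squeeze \<omega> s a)) else 0)"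
  proof (cases "?c < 0")
    case True
    have "(?F has_integral integral {0..-2 * ?c} ?F) (cbox 0 (-2 * ?c))"
      using integrable_integral[OF integrable_continuous_real[OF cF]] by simp
    \<comment> \<open>Substitution t = c (s - 1) with c = a . \<omega> < 0: s = 1 is the point a and
      s = - 1 its mirror image.\<close>
    from has_integral_affinity[OF this, of ?c "- ?c"] True
    have "((\<lambda>s. ?F (?c * s - ?c)) has_integral (1 / \<bar>?c\<bar>) *\<^sub>R integral {0..-2 * ?c} ?F)
        ((\<lambda>x. (1 / ?c) *\<^sub>R x + 1) ` {0..-2 * ?c})"
      by simp
    moreover have "(\<lambda>x. (1 / ?c) *\<^sub>R x + 1) ` {0..-2 * ?c} = {-1..1}"
    proof -
      have "(\<lambda>x. (1 / ?c) * x + 1) ` {0..-2 * ?c} = {-1..1}"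
        using True image_affinity_atLeastAtMost[of "1 / ?c" 1 0 "-2 * ?c"] by (simp add: divide_less_0_iff)
      then show ?thesis by simp
    qed
    moreover have "?F (?c * s - ?c) = g (squeeze \<omega> s a)" for s
      by (simp add: squeeze_def algebra_simps)
    ultimately have "integral {-1..1} (\<lambda>s. g (squeeze \<omega> s a)) = (1 / \<bar>?c\<bar>) *\<^sub>R integral {0..-2 * ?c} ?F"
      by (simp add: integral_unique)
    then show ?thesis using True by (simp add: scaleR_conv_of_real)
  next
    case False
    then have "integral {0..-2 * ?c} ?F = 0" by (cases "?c = 0") auto
    then show ?thesis using False by simp
  qed
  finally show ?thesis .
qed

text \<open>At most one of \<omega> and - \<omega> points from a into the ball, and
  \<open>squeeze\<close> does not distinguish them. The sign in the odd part turns the two cases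
  into a single formula, with a . \<omega> carrying the orientation.\<close>

lemma odd_cone_beam_chord:
  fixes f g :: "'a::euclidean_space \<Rightarrow> complex"
  assumes a: "norm a = 1" and \<omega>: "norm \<omega> = 1" and g: "continuous_on UNIV g"
    and f: "\<And>x. f x = (if norm x \<le> 1 then g x else 0)"
  shows "odd_cone_beam f a \<omega> = - (of_real (a \<bullet> \<omega>) * integral {-1..1} (\<lambda>s. g (squeeze \<omega> s a)) / 2)"
proof -
  have "squeeze (- \<omega>) s a = squeeze \<omega> s a" for s
    by (simp add: squeeze_def)
  then show ?thesis
    unfolding odd_cone_beam_def cone_beam_chord[OF assms]
    using cone_beam_chord[of a "- \<omega>" g f] assms by auto
qed

text \<open>For odd d both exponents under the root are even, and the ball volume has in its
  denominator a Pochhammer symbol at 1/2, that is, an odd double factorial up to a power of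
  2.\<close>

lemma sphere_area:
  assumes "odd DIM('a::euclidean_space)" "3 \<le> DIM('a)"
  shows "real DIM('a) * unit_ball_vol (real DIM('a)) * real (dfact (DIM('a) - 2))
    = sqrt (2 ^ (DIM('a) + 1) * pi ^ (DIM('a) - 1))"
proof -
  obtain e where e: "DIM('a) = 2 * e + 3"
    using assms by (metis add_2_eq_Suc' add.commute le_Suc_ex odd_add odd_numeral evenE numeral_3_eq_3)
  have poch: "pochhammer (1 / 2) (Suc n) * 2 ^ Suc n = real (dfact (2 * n + 1))" for n
  proof (induction n)
    case (Suc n)
    have "pochhammer (1 / 2) (Suc (Suc n)) * 2 ^ Suc (Suc n)
        = (pochhammer (1 / 2) (Suc n) * 2 ^ Suc n) * real (2 * n + 3)"
      by (subst pochhammer_Suc) (simp add: algebra_simps)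
    also have "\<dots> = real (dfact (Suc (Suc (2 * n + 1))))"
      unfolding Suc.IH dfact.simps(3) of_nat_mult by simp
    finally show ?case by simp
  qed simp
  have vol: "real (2 * e + 3) * unit_ball_vol (real (2 * e + 3)) * real (dfact (2 * e + 1)) = 2 * (2 * pi) ^ (e + 1)"
  proof -
    define P where "P = pochhammer (1 / 2 :: real) (Suc (e + 1))"
    have P: "P * 2 ^ (e + 2) = real (2 * e + 3) * real (dfact (2 * e + 1))"
      using poch[of "e + 1"] unfolding P_def
      by (simp add: algebra_simps)
    have "P \<noteq> 0" unfolding P_def by (intro less_imp_neq[symmetric] pochhammer_pos) simp
    have "unit_ball_vol (real (2 * e + 3)) = pi ^ (e + 1) / P"
      using unit_ball_vol_odd'[of "e + 1"] by (simp add: P_def algebra_simps)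
    then have "real (2 * e + 3) * unit_ball_vol (real (2 * e + 3)) * real (dfact (2 * e + 1))
        = (P * 2 ^ (e + 2)) * (pi ^ (e + 1) / P)"
      unfolding P by simp
    also have "\<dots> = 2 * (2 * pi) ^ (e + 1)"
      using \<open>P \<noteq> 0\<close> by (simp add: power_mult_distrib)
    finally show ?thesis .
  qed
  have "sqrt (2 ^ (2 * e + 3 + 1) * pi ^ (2 * e + 3 - 1)) = sqrt ((2 * (2 * pi) ^ (e + 1))\<^sup>2)"
  proof -
    have "2 * e + 3 + 1 = (e + 2) * 2" "2 * e + 3 - 1 = (e + 1) * 2" by simp_all
    moreover have "2 * (2 * pi) ^ (e + 1) = 2 ^ (e + 2) * pi ^ (e + 1)"
      by (simp add: power_mult_distrib)
    ultimately show ?thesis by (simp only: power_mult power_mult_distrib)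
  qed
  also have "\<dots> = 2 * (2 * pi) ^ (e + 1)" unfolding real_sqrt_abs by simp
  finally show ?thesis unfolding e using vol by simp
qed

theorem theorem4p4:
  fixes Y :: "nat \<Rightarrow> nat \<Rightarrow> 'a::euclidean_space \<Rightarrow> complex"
    and a \<omega> :: 'a and m l k d :: nat
  assumes "d = DIM('a)" and "3 \<le> d" and "odd d"
    and "spherical_harmonic_basis Y"
    and "l \<le> m" and "even (l + m)"
    and "k \<in> {1..harm_dim l d}"
    and "a \<in> sphere 0 1" and "\<omega> \<in> sphere 0 1"
  shows "odd_cone_beam (V_ball Y m l k) a \<omega> =
    of_real (mu m d) *
      (\<Sum>j=1..harm_dim (m + 1) d. cnj (Y (m + 1) j a) *
         (\<Sum>n\<in>{n \<in> {m + 1 - l..m + 1 + l}. odd n}. of_real (nu n d) *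
            (\<Sum>i=1..harm_dim n d. gaunt Y n i (m + 1) j l k * Y n i \<omega>)))"
proof -
  have dim3: "3 \<le> DIM('a)" using assms(1,2) by simp
  interpret spherical_harmonics Y
    using assms(4) dim3 by unfold_locales auto
  have k: "k \<in> {1..harm_dim l DIM('a)}" using assms(1,7) by simp
  have a: "norm a = 1" and \<omega>: "norm \<omega> = 1" using assms(8,9) by auto
  define n where "n = (m - l) div 2"
  have mn: "Suc (2 * n + l) = Suc m" using assms(5,6) by (auto simp: n_def)
  define c where "c = jacobi_coeff n (real l + (real DIM('a) - 2) / 2)"
  define C where "C = sqrt (real (2 * m + DIM('a)))"
  have C: "C > 0" "C * C = real (2 * m + DIM('a))" using dim3 by (simp_all add: C_def)
  let ?p = "y l k"
  have p: "?p \<in> harmonic_homogeneous l" by (rule y_harmonic[OF k])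
  let ?U = "chord_poly n c ?p \<omega>"
  let ?A = "sint (\<lambda>x::'a. 1) * of_nat (dfact (DIM('a) - 2))"
  define g where "g x = of_real C * (\<Sum>j\<le>n. of_real (c j) * (of_real (x \<bullet> x) ^ j * ?p x))" for x
  \<comment> \<open>The denominator in \<open>G_dderiv\<close>; this identity ties \<open>mu\<close>
    to the area of the sphere.\<close>
  have A: "?A = of_real (mu m d * C)"
  proof -
    have "mu m d * C = sqrt (2 ^ (DIM('a) + 1) * pi ^ (DIM('a) - 1))"
      using C(1) by (simp add: mu_def C_def assms(1) real_sqrt_divide)
    also have "\<dots> = real DIM('a) * unit_ball_vol (real DIM('a)) * real (dfact (DIM('a) - 2))"
      using sphere_area[where 'a = 'a] assms(1-3) by simp
    finally show ?thesis by (simp add: sint_const)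
  qed
  have mu: "mu m d > 0" using dim3 by (simp add: mu_def assms(1))
  have gc: "continuous_on UNIV g"
    unfolding g_def by (intro continuous_intros hpoly_continuous_on[OF harmonic_hpoly[OF p]])
  have V: "V_ball Y m l k x = (if norm x \<le> 1 then g x else 0)" for x
  proof (cases "norm x \<le> 1")
    case True
    let ?s = "norm x" and ?\<xi> = "direction x"
    have "V_ball Y m l k x = V_polar Y m l k ?s ?\<xi>" using True by (simp add: V_ball_def)
    also have "\<dots> = of_real C * of_real (jacobi n 0 (real l + (real DIM('a) - 2) / 2) (2 * ?s\<^sup>2 - 1))
        * (of_real (?s ^ l) * ?p ?\<xi>)"
      using direction(1)[of x] Y_eq_y[OF k, of ?\<xi>] by (simp add: V_polar_def C_def n_def mult_ac)
    also have "of_real (?s ^ l) * ?p ?\<xi> = ?p x"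
      using hpoly_homogeneous[OF harmonic_hpoly[OF p], of ?s ?\<xi>] direction(2)[of x] by simp
    also have "of_real C * of_real (jacobi n 0 (real l + (real DIM('a) - 2) / 2) (2 * ?s\<^sup>2 - 1)) * ?p x = g x"
      unfolding jacobi_expand g_def c_def by (simp add: dot_square_norm sum_distrib_right mult.assoc)
    finally show ?thesis using True by simp
  qed (simp add: V_ball_def)
  have odd_U: "odd_cone_beam (V_ball Y m l k) a \<omega> = - of_real C * ?U a"
    unfolding odd_cone_beam_chord[OF a \<omega> gc V] chord_poly_sphere[OF p \<omega> assms(8)] g_def
    by simp
  have U: "?U \<in> harmonic_homogeneous (Suc m)"
    using chord_poly_harmonic[OF p \<omega>, of n c] jacobi_coeff_rec[of _ n] unfolding c_def mn by blast
  have Gh: "G m l k \<omega> \<in> harmonic_homogeneous (Suc m)" by (rule G_harmonic)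
  \<comment> \<open>The transform is - C times U, so h a = 0 is the claim.\<close>
  define h where "h x = of_real C * ?U x + of_real (mu m d) * G m l k \<omega> x" for x
  have h: "h \<in> harmonic_homogeneous (Suc m)"
    unfolding h_def[abs_def] by (intro harmonic_add harmonic_cmult U Gh)
  have h_sphere: "h x = 0" "dderiv \<omega> h x = 0" if x: "x \<in> sphere 0 1" "x \<bullet> \<omega> = 0" for x
  proof -
    show "h x = 0"
      unfolding h_def chord_poly_orthogonal[OF p \<omega> x(2)]
        G_orthogonal[OF dim3 k assms(5,6) \<omega> x] by simp
    have "dderiv \<omega> h x = of_real C * dderiv \<omega> ?U x + of_real (mu m d) * dderiv \<omega> (G m l k \<omega>) x"
      unfolding h_def[abs_def]
      using dderiv_add[OF hpoly_cmult[OF harmonic_hpoly[OF U]] hpoly_cmult[OF harmonic_hpoly[OF Gh]],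
          of \<omega> "of_real C" "of_real (mu m d)" x]
      by (simp add: dderiv_cmult[OF harmonic_hpoly[OF U]] dderiv_cmult[OF harmonic_hpoly[OF Gh]])
    also have "dderiv \<omega> ?U x = ?p x"
      using chord_poly_dderiv[OF p \<omega> x(2,1), of n c] by (simp add: c_def sum_jacobi_coeff)
    \<comment> \<open>As C^2 = 2 m + d, the constant of \<open>G_dderiv\<close> is - C / mu, which
      cancels the normal derivative of C U.\<close>
    also have "dderiv \<omega> (G m l k \<omega>) x = - (of_real (C * C) / of_real (mu m d * C)) * ?p x"
      unfolding G_dderiv[OF dim3 k assms(5,6) \<omega> x] A C(2) by simp
    finally show "dderiv \<omega> h x = 0" using C(1) mu by simp
  qed
  \<comment> \<open>At the origin there is nothing to normalise; some unit vector of the hyperplane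
    has to stand in, and d at least 2 provides one.\<close>
  obtain b :: 'a where b: "b \<noteq> 0" "orthogonal \<omega> b"
    using orthogonal_to_vector_exists[OF dim] by blast
  have on_plane: "f x = 0"
    if f: "hpoly N f" "\<And>x. x \<in> sphere 0 1 \<Longrightarrow> x \<bullet> \<omega> = 0 \<Longrightarrow> f x = 0" and x: "x \<bullet> \<omega> = 0" for f x N
  proof -
    define u where "u = (if x = 0 then b else x) /\<^sub>R norm (if x = 0 then b else x)"
    have u: "x = norm x *\<^sub>R u" "norm u = 1" "u \<bullet> \<omega> = 0"
      using b x by (auto simp: u_def orthogonal_def inner_commute)
    have "f x = of_real (norm x ^ N) * f u"
      by (subst u(1)) (rule hpoly_homogeneous[OF f(1)])
    also have "f u = 0" by (rule f(2)) (use u in auto)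
    finally show ?thesis by simp
  qed
  have hh: "hpoly (Suc m) h" by (rule harmonic_hpoly[OF h])
  have "h a = 0"
    by (rule harmonic_cauchy_unique[OF h \<omega>])
       (rule on_plane[OF hh h_sphere(1)] on_plane[OF hpoly_dderiv_aux[OF hh] h_sphere(2)]; assumption)+
  then have "of_real C * ?U a + of_real (mu m d) * G m l k \<omega> a = 0"
    by (simp add: h_def)
  from minus_unique[OF this] show ?thesis
    unfolding odd_U gaunt_expansion[OF k assms(8,9), of m, folded assms(1)] by simp
qed

end
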